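(* For any non-zero rational number $\alpha$, the restriction of the functor $\Pi_{\mathbb Q}:\mathrm{Ch}_*(\mathrm{MHS}_{\mathbb Q})\to\mathrm{Ch}_*(\mathbb Q)$ to the full subcategory $\mathrm{Ch}_*(\mathrm{MHS}_{\mathbb Q})^{\alpha\text{-pure}}$ is formal (as a lax symmetric monoidal functor).
   Context: $\mathrm{MHS}_{\mathbb Q}$ is the abelian symmetric monoidal category of mixed Hodge structures $(V,W,F)$ on finite-dimensional $\mathbb Q$-vector spaces. $\Pi_{\mathbb Q}$ is induced by $(V,W,F)\mapsto V$. $\mathrm{Ch}_*(\mathrm{MHS}_{\mathbb Q})^{\alpha\text{-pure}}$ consists of the complexes $K$ of mixed Hodge structures such that for every $n$ the weight $p$ graded piece of the mixed Hodge structure $H_n(K)$, $Gr^W_pH_n(K)=W_pH_n(K)/W_{p-1}H_n(K)$, vanishes for all $p\ne\alpha n$. Monoidal structure: tensor product of complexes; for unbounded complexes (where the degreewise infinite direct sums need not exist in $\mathrm{MHS}_{\mathbb Q}$) one regards $\mathrm{Ch}_*(\mathrm{MHS}_{\mathbb Q})$ as the colored operad in which a multimorphism $(K_1,\dots,K_r)\to L$ is a family of morphisms of mixed Hodge structures $(K_1)_{i_1}\otimes\cdots\otimes(K_r)_{i_r}\to L_{i_1+\cdots+i_r}$ satisfying the Leibniz rule; "lax symmetric monoidal functor" means map of colored operads. Formality: a lax symmetric monoidal functor $F:\mathcal C\to\mathrm{Ch}_*(\mathbb Q)$ is formal if there is a finite zig-zag of monoidal natural transformations of lax symmetric monoidal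 functors $F\xleftarrow{\Phi_1}F_1\to\cdots\leftarrow F_n\xrightarrow{\Phi_n}H\circ F$ all of whose components are quasi-isomorphisms; $H$ is homology, lax symmetric monoidal via the Künneth morphism, graded vector spaces being regarded as complexes with zero differential. *)

theory Defs
  imports
    Complex_Main
    "HOL-Algebra.Module"
    "HOL-Algebra.AbelCoset"
    "HOL-Library.Poly_Mapping"
    "HOL-Combinatorics.Permutations"
begin

section \<open>Vector spaces with explicit carriers\<close>

text \<open>
  A vector space over a field (given as a type) is a module in the sense of HOL-Algebra over the
  following ring.  The record of a module inherits fields \<open>mult\<close> and \<open>one\<close> from the record of rings;
  the laws of a module do not mention them, and they are left undefined below.
\<close>

definition field_ring :: "'k::field ring"
  where "field_ring = \<lparr>carrier = UNIV, monoid.mult = (*), monoid.one = 1, zero = 0, add = (+)\<rparr>"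

definition vspace :: "('k::field, 'a) module \<Rightarrow> bool"
  where "vspace V \<longleftrightarrow> Module.module field_ring V"

definition subspc :: "('k::field, 'a) module \<Rightarrow> 'a set \<Rightarrow> bool"
  where "subspc V N \<longleftrightarrow> submodule N field_ring V"

definition generated :: "('k::field, 'a) module \<Rightarrow> 'a set \<Rightarrow> 'a set"
  where "generated V S = \<Inter> {N. subspc V N \<and> S \<subseteq> N}"

definition fin_dim :: "('k::field, 'a) module \<Rightarrow> bool"
  where "fin_dim V \<longleftrightarrow> (\<exists>S. finite S \<and> S \<subseteq> carrier V \<and> generated V S = carrier V)"

definition lin :: "('k::field, 'a) module \<Rightarrow> ('k, 'b) module \<Rightarrow> ('a \<Rightarrow> 'b) \<Rightarrow> bool"
  where "lin V V' f \<longleftrightarrow>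
    (\<forall>x\<in>carrier V. f x \<in> carrier V') \<and>
    (\<forall>x\<in>carrier V. \<forall>y\<in>carrier V. f (x \<oplus>\<^bsub>V\<^esub> y) = f x \<oplus>\<^bsub>V'\<^esub> f y) \<and>
    (\<forall>q. \<forall>x\<in>carrier V. f (q \<odot>\<^bsub>V\<^esub> x) = q \<odot>\<^bsub>V'\<^esub> f x)"

definition multilin :: "('k::field, 'a) module list \<Rightarrow> ('k, 'b) module \<Rightarrow> ('a list \<Rightarrow> 'b) \<Rightarrow> bool"
  where "multilin Vs V f \<longleftrightarrow>
    (\<forall>xs\<in>listset (map carrier Vs). f xs \<in> carrier V) \<and>
    (\<forall>xs\<in>listset (map carrier Vs). \<forall>j<length Vs. lin (Vs ! j) V (\<lambda>x. f (xs[j := x])))"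

definition quot :: "('k::field, 'a) module \<Rightarrow> 'a set \<Rightarrow> ('k, 'a set) module"
  where "quot V N =
    \<lparr>carrier = a_rcosets\<^bsub>V\<^esub> N, monoid.mult = undefined, monoid.one = undefined, zero = N, add = set_add V,
     smult = (\<lambda>q X. N <+>\<^bsub>V\<^esub> ((\<lambda>x. q \<odot>\<^bsub>V\<^esub> x) ` X))\<rparr>"

definition subquot :: "('k::field, 'a) module \<Rightarrow> 'a set \<Rightarrow> 'a set \<Rightarrow> ('k, 'a set) module"
  where "subquot V Z B = quot (V\<lparr>carrier := Z\<rparr>) B"

definition free_space :: "'s set \<Rightarrow> ('k::field, 's \<Rightarrow>\<^sub>0 'k) module"
  where "free_space S =
    \<lparr>carrier = {f. Poly_Mapping.keys f \<subseteq> S}, monoid.mult = undefined, monoid.one = undefined, zero = 0,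
     add = (+), smult = (\<lambda>q. Poly_Mapping.map (\<lambda>z. q * z))\<rparr>"


section \<open>Tensor products\<close>

definition tensor_relations :: "('k::field, 'a) module list \<Rightarrow> ('a list \<Rightarrow>\<^sub>0 'k) set"
  where "tensor_relations Vs = generated (free_space (listset (map carrier Vs)))
    ({Poly_Mapping.single (xs[j := x \<oplus>\<^bsub>Vs ! j\<^esub> y]) 1
        - Poly_Mapping.single (xs[j := x]) 1 - Poly_Mapping.single (xs[j := y]) 1 |xs j x y.
        xs \<in> listset (map carrier Vs) \<and> j < length Vs \<and>
        x \<in> carrier (Vs ! j) \<and> y \<in> carrier (Vs ! j)} \<union>
     {Poly_Mapping.single (xs[j := q \<odot>\<^bsub>Vs ! j\<^esub> x]) 1 - Poly_Mapping.single (xs[j := x]) q |xs j q x.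
        xs \<in> listset (map carrier Vs) \<and> j < length Vs \<and> x \<in> carrier (Vs ! j)})"

definition tensor_space :: "('k::field, 'a) module list \<Rightarrow> ('k, ('a list \<Rightarrow>\<^sub>0 'k) set) module"
  where "tensor_space Vs = quot (free_space (listset (map carrier Vs))) (tensor_relations Vs)"

definition pure_tensor :: "('k::field, 'a) module list \<Rightarrow> 'a list \<Rightarrow> ('a list \<Rightarrow>\<^sub>0 'k) set"
  where "pure_tensor Vs xs =
    tensor_relations Vs +>\<^bsub>free_space (listset (map carrier Vs))\<^esub> Poly_Mapping.single xs 1"

text \<open>
  The complexification of a rational vector space \<open>V\<close>: its tensor product with the complex numbers,
  where \<open>Poly_Mapping.single v c\<close> represents \<open>v \<otimes> c\<close>.
\<close>

definition cx_relations :: "(rat, 'a) module \<Rightarrow> ('a \<Rightarrow>\<^sub>0 complex) set"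
  where "cx_relations V = generated (free_space (carrier V))
    ({Poly_Mapping.single (x \<oplus>\<^bsub>V\<^esub> y) 1 - Poly_Mapping.single x 1 - Poly_Mapping.single y 1 |x y.
        x \<in> carrier V \<and> y \<in> carrier V} \<union>
     {Poly_Mapping.single (q \<odot>\<^bsub>V\<^esub> x) 1 - Poly_Mapping.single x (of_rat q) |q x. x \<in> carrier V})"

definition cx :: "(rat, 'a) module \<Rightarrow> (complex, ('a \<Rightarrow>\<^sub>0 complex) set) module"
  where "cx V = quot (free_space (carrier V)) (cx_relations V)"

definition cx_conj :: "('a \<Rightarrow>\<^sub>0 complex) set \<Rightarrow> ('a \<Rightarrow>\<^sub>0 complex) set"
  where "cx_conj X = Poly_Mapping.map cnj ` X"

text \<open>
  The complex multilinear extension of a rational multilinear map \<open>f\<close> with values in \<open>V\<close>: it sends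
  \<open>(v\<^sub>1 \<otimes> c\<^sub>1, \<dots>, v\<^sub>r \<otimes> c\<^sub>r)\<close> to \<open>f [v\<^sub>1, \<dots>, v\<^sub>r] \<otimes> (c\<^sub>1 \<cdots> c\<^sub>r)\<close>.
  The union runs over all choices of representatives, which all give the same coset.
\<close>

definition cx_multi :: "(rat, 'b) module \<Rightarrow> ('a list \<Rightarrow> 'b) \<Rightarrow>
    ('a \<Rightarrow>\<^sub>0 complex) set list \<Rightarrow> ('b \<Rightarrow>\<^sub>0 complex) set"
  where "cx_multi V f Xs = (\<Union>xs\<in>listset Xs. cx_relations V +>\<^bsub>free_space (carrier V)\<^esub>
    (\<Sum>vs\<in>listset (map Poly_Mapping.keys xs).
      Poly_Mapping.single (f vs) (\<Prod>j<length xs. Poly_Mapping.lookup (xs ! j) (vs ! j))))"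

definition cx_map :: "(rat, 'b) module \<Rightarrow> ('a \<Rightarrow> 'b) \<Rightarrow>
    ('a \<Rightarrow>\<^sub>0 complex) set \<Rightarrow> ('b \<Rightarrow>\<^sub>0 complex) set"
  where "cx_map V f X = cx_multi V (\<lambda>vs. f (hd vs)) [X]"


section \<open>Mixed Hodge structures\<close>

record 'a mhs =
  space :: "(rat, 'a) module"
  wt :: "int \<Rightarrow> 'a set"
  hdg :: "int \<Rightarrow> ('a \<Rightarrow>\<^sub>0 complex) set set"

definition weight_filtration :: "(rat, 'a) module \<Rightarrow> (int \<Rightarrow> 'a set) \<Rightarrow> bool"
  where "weight_filtration V W \<longleftrightarrow>
    (\<forall>p. subspc V (W p)) \<and> (\<forall>p q. p \<le> q \<longrightarrow> W p \<subseteq> W q) \<and>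
    (\<exists>p. W p = {\<zero>\<^bsub>V\<^esub>}) \<and> (\<exists>p. W p = carrier V)"

definition hodge_filtration ::
    "(rat, 'a) module \<Rightarrow> (int \<Rightarrow> ('a \<Rightarrow>\<^sub>0 complex) set set) \<Rightarrow> bool"
  where "hodge_filtration V F \<longleftrightarrow>
    (\<forall>p. subspc (cx V) (F p)) \<and> (\<forall>p q. p \<le> q \<longrightarrow> F q \<subseteq> F p) \<and>
    (\<exists>p. F p = {\<zero>\<^bsub>cx V\<^esub>}) \<and> (\<exists>p. F p = carrier (cx V))"

definition pure_hodge_structure ::
    "int \<Rightarrow> (rat, 'a) module \<Rightarrow> (int \<Rightarrow> ('a \<Rightarrow>\<^sub>0 complex) set set) \<Rightarrow> bool"
  where "pure_hodge_structure n V F \<longleftrightarrow>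
    hodge_filtration V F \<and>
    (\<forall>p q. p + q = n + 1 \<longrightarrow>
      F p <+>\<^bsub>cx V\<^esub> (cx_conj ` F q) = carrier (cx V) \<and>
      F p \<inter> cx_conj ` F q = {\<zero>\<^bsub>cx V\<^esub>})"

text \<open>
  The filtrations induced on a subquotient \<open>Z / B\<close>: intersect with \<open>Z\<close> (or its complexification),
  then take the image in the quotient (or its complexification).
\<close>

definition subquot_mhs :: "'a mhs \<Rightarrow> 'a set \<Rightarrow> 'a set \<Rightarrow> 'a set mhs"
  where "subquot_mhs V Z B =
    \<lparr>space = subquot (space V) Z B,
     wt = (\<lambda>p. (\<lambda>x. B +>\<^bsub>space V\<^esub> x) ` (Z \<inter> wt V p)),
     hdg = (\<lambda>p. cx_map (subquot (space V) Z B) (\<lambda>x. B +>\<^bsub>space V\<^esub> x) `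
        {X \<in> carrier (cx ((space V)\<lparr>carrier := Z\<rparr>)). cx_map (space V) (\<lambda>x. x) X \<in> hdg V p})\<rparr>"

definition gr_wt :: "'a mhs \<Rightarrow> int \<Rightarrow> 'a set mhs"
  where "gr_wt V p = subquot_mhs V (wt V p) (wt V (p - 1))"

definition is_mhs :: "'a mhs \<Rightarrow> bool"
  where "is_mhs V \<longleftrightarrow>
    vspace (space V) \<and> fin_dim (space V) \<and>
    weight_filtration (space V) (wt V) \<and> hodge_filtration (space V) (hdg V) \<and>
    (\<forall>n. pure_hodge_structure n (space (gr_wt V n)) (hdg (gr_wt V n)))"

definition mhs_hom :: "'a mhs \<Rightarrow> 'b mhs \<Rightarrow> ('a \<Rightarrow> 'b) \<Rightarrow> bool"
  where "mhs_hom V V' f \<longleftrightarrow>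
    lin (space V) (space V') f \<and>
    (\<forall>p. \<forall>x\<in>wt V p. f x \<in> wt V' p) \<and>
    (\<forall>p. \<forall>X\<in>hdg V p. cx_map (space V') f X \<in> hdg V' p)"

text \<open>
  The inequalities on the sum of the indices could be equalities for a nonempty list; as stated,
  they also give the unit \<open>\<rat>(0)\<close> for the empty list.  The complex multilinear extension of
  \<open>pure_tensor\<close> is the canonical map from the product of the complexifications to the
  complexification of the tensor product.
\<close>

definition tensor_mhs :: "'a mhs list \<Rightarrow> ('a list \<Rightarrow>\<^sub>0 rat) set mhs"
  where "tensor_mhs Vs =
    (let Us = map space Vs; T = tensor_space Us in
    \<lparr>space = T,
     wt = (\<lambda>n. generated T {pure_tensor Us xs |xs ps. length ps = length Vs \<and> sum_list ps \<le> n \<and>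
        xs \<in> listset (map2 wt Vs ps)}),
     hdg = (\<lambda>n. generated (cx T) {cx_multi T (pure_tensor Us) Xs |Xs ps.
        length ps = length Vs \<and> n \<le> sum_list ps \<and> Xs \<in> listset (map2 hdg Vs ps)})\<rparr>)"

definition mhs_multi :: "'a mhs list \<Rightarrow> 'b mhs \<Rightarrow> ('a list \<Rightarrow> 'b) \<Rightarrow> bool"
  where "mhs_multi Vs V f \<longleftrightarrow>
    (\<exists>\<phi>. mhs_hom (tensor_mhs Vs) V \<phi> \<and>
      (\<forall>xs\<in>listset (map (carrier \<circ> space) Vs). f xs = \<phi> (pure_tensor (map space Vs) xs)))"


section \<open>Symmetric colored operads\<close>

text \<open>
  \<open>pcomp Ls Ks Ls' g f\<close> is the partial composition plugging \<open>f \<in> ops Ks M\<close> into the slot \<open>M\<close> of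
  \<open>g \<in> ops (Ls @ [M] @ Ls') N\<close>; partial compositions and identities determine all compositions.
  \<open>act Ks L \<sigma>\<close> maps \<open>ops Ks L\<close> to \<open>ops (permute_list \<sigma> Ks) L\<close>.  The colors of the operation
  sets are explicit arguments, since one function may be an operation for several of them.
\<close>

record ('o, 'm) operad =
  colors :: "'o set"
  ops :: "'o list \<Rightarrow> 'o \<Rightarrow> 'm set"
  ident :: "'o \<Rightarrow> 'm"
  pcomp :: "'o list \<Rightarrow> 'o list \<Rightarrow> 'o list \<Rightarrow> 'm \<Rightarrow> 'm \<Rightarrow> 'm"
  act :: "'o list \<Rightarrow> 'o \<Rightarrow> (nat \<Rightarrow> nat) \<Rightarrow> 'm \<Rightarrow> 'm"

record ('o, 'm, 'p, 'n) operad_map =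
  on_col :: "'o \<Rightarrow> 'p"
  on_op :: "'o list \<Rightarrow> 'o \<Rightarrow> 'm \<Rightarrow> 'n"

definition is_operad_map ::
    "('o, 'm) operad \<Rightarrow> ('p, 'n) operad \<Rightarrow> ('o, 'm, 'p, 'n) operad_map \<Rightarrow> bool"
  where "is_operad_map C D F \<longleftrightarrow>
    (\<forall>c\<in>colors C. on_col F c \<in> colors D \<and> on_op F [c] c (ident C c) = ident D (on_col F c)) \<and>
    (\<forall>Ks\<in>lists (colors C). \<forall>L\<in>colors C. \<forall>f\<in>ops C Ks L.
      on_op F Ks L f \<in> ops D (map (on_col F) Ks) (on_col F L) \<and>
      (\<forall>\<sigma>. \<sigma> permutes {..<length Ks} \<longrightarrow>
        on_op F (permute_list \<sigma> Ks) L (act C Ks L \<sigma> f) =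
        act D (map (on_col F) Ks) (on_col F L) \<sigma> (on_op F Ks L f))) \<and>
    (\<forall>Ls\<in>lists (colors C). \<forall>Ks\<in>lists (colors C). \<forall>Ls'\<in>lists (colors C).
      \<forall>M\<in>colors C. \<forall>N\<in>colors C. \<forall>g\<in>ops C (Ls @ [M] @ Ls') N. \<forall>f\<in>ops C Ks M.
        on_op F (Ls @ Ks @ Ls') N (pcomp C Ls Ks Ls' g f) =
        pcomp D (map (on_col F) Ls) (map (on_col F) Ks) (map (on_col F) Ls')
          (on_op F (Ls @ [M] @ Ls') N g) (on_op F Ks M f))"

definition operad_map_comp ::
    "('p, 'n, 'q, 'l) operad_map \<Rightarrow> ('o, 'm, 'p, 'n) operad_map \<Rightarrow> ('o, 'm, 'q, 'l) operad_map"
  where "operad_map_comp G F =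
    \<lparr>on_col = (\<lambda>c. on_col G (on_col F c)),
     on_op = (\<lambda>Ks L f. on_op G (map (on_col F) Ks) (on_col F L) (on_op F Ks L f))\<rparr>"


section \<open>Complexes of rational vector spaces\<close>

record ('v, 'a) complexes =
  obj :: "int \<Rightarrow> 'v"
  dif :: "int \<Rightarrow> 'a \<Rightarrow> 'a"

type_synonym 'a ch = "((rat, 'a) module, 'a) complexes"

definition is_ch :: "'a ch \<Rightarrow> bool"
  where "is_ch K \<longleftrightarrow>
    (\<forall>n. vspace (obj K n) \<and> lin (obj K n) (obj K (n - 1)) (dif K n) \<and>
      dif K n \<in> extensional (carrier (obj K n)) \<and>
      (\<forall>x\<in>carrier (obj K n). dif K (n - 1) (dif K n x) = \<zero>\<^bsub>obj K (n - 2)\<^esub>))"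

definition cycles :: "'a ch \<Rightarrow> int \<Rightarrow> 'a set"
  where "cycles K n = {x \<in> carrier (obj K n). dif K n x = \<zero>\<^bsub>obj K (n - 1)\<^esub>}"

definition boundaries :: "'a ch \<Rightarrow> int \<Rightarrow> 'a set"
  where "boundaries K n = dif K (n + 1) ` carrier (obj K (n + 1))"

definition homology :: "'a ch \<Rightarrow> int \<Rightarrow> (rat, 'a set) module"
  where "homology K n = subquot (obj K n) (cycles K n) (boundaries K n)"

definition chain_map :: "'a ch \<Rightarrow> 'b ch \<Rightarrow> (int \<Rightarrow> 'a \<Rightarrow> 'b) \<Rightarrow> bool"
  where "chain_map K L h \<longleftrightarrow>
    (\<forall>n. lin (obj K n) (obj L n) (h n) \<and>
      (\<forall>x\<in>carrier (obj K n). dif L n (h n x) = h (n - 1) (dif K n x)))"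

definition homology_map :: "'b ch \<Rightarrow> (int \<Rightarrow> 'a \<Rightarrow> 'b) \<Rightarrow> int \<Rightarrow> 'a set \<Rightarrow> 'b set"
  where "homology_map L h n X = (\<Union>x\<in>X. boundaries L n +>\<^bsub>obj L n\<^esub> h n x)"

definition quasi_iso :: "'a ch \<Rightarrow> 'b ch \<Rightarrow> (int \<Rightarrow> 'a \<Rightarrow> 'b) \<Rightarrow> bool"
  where "quasi_iso K L h \<longleftrightarrow> chain_map K L h \<and>
    (\<forall>n. bij_betw (homology_map L h n) (carrier (homology K n)) (carrier (homology L n)))"

text \<open>
  A multimorphism \<open>f\<close> is encoded as \<open>f [i\<^sub>1, \<dots>, i\<^sub>r] [x\<^sub>1, \<dots>, x\<^sub>r]\<close> with \<open>x\<^sub>j\<close> of degree \<open>i\<^sub>j\<close>,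
  and is undefined on all other arguments, so that equality of multimorphisms is equality in HOL.
\<close>

type_synonym 'a multimor = "int list \<Rightarrow> 'a list \<Rightarrow> 'a"

definition inputs :: "'a ch list \<Rightarrow> int list \<Rightarrow> 'a list set"
  where "inputs Ks is = listset (map2 (\<lambda>K i. carrier (obj K i)) Ks is)"

definition restr :: "'a ch list \<Rightarrow> 'a multimor \<Rightarrow> 'a multimor"
  where "restr Ks f = (\<lambda>is xs.
    if length is = length Ks \<and> xs \<in> inputs Ks is then f is xs else undefined)"

definition parity_sign :: "int \<Rightarrow> rat"
  where "parity_sign i = (if even i then 1 else - 1)"

definition leibniz :: "'a ch list \<Rightarrow> 'a ch \<Rightarrow> 'a multimor \<Rightarrow> bool"
  where "leibniz Ks L f \<longleftrightarrow>
    (\<forall>is. \<forall>xs\<in>inputs Ks is. length is = length Ks \<longrightarrow>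
      dif L (sum_list is) (f is xs) =
      (\<Oplus>\<^bsub>obj L (sum_list is - 1)\<^esub>j\<in>{..<length is}.
         parity_sign (sum_list (take j is)) \<odot>\<^bsub>obj L (sum_list is - 1)\<^esub>
           f (is[j := is ! j - 1]) (xs[j := dif (Ks ! j) (is ! j) (xs ! j)])))"

definition ch_ops :: "'a ch list \<Rightarrow> 'a ch \<Rightarrow> 'a multimor set"
  where "ch_ops Ks L = {f.
    (\<forall>is. length is = length Ks \<longrightarrow> multilin (map2 obj Ks is) (obj L (sum_list is)) (f is)) \<and>
    leibniz Ks L f \<and> restr Ks f = f}"

definition ch_ident :: "'a ch \<Rightarrow> 'a multimor"
  where "ch_ident K = restr [K] (\<lambda>is xs. hd xs)"

definition ch_pcomp ::
    "'a ch list \<Rightarrow> 'a ch list \<Rightarrow> 'a ch list \<Rightarrow> 'a multimor \<Rightarrow> 'a multimor \<Rightarrow> 'a multimor"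
  where "ch_pcomp Ls Ks Ls' g f = restr (Ls @ Ks @ Ls') (\<lambda>is xs.
    let a = length Ls; b = length Ks; js = take b (drop a is); ys = take b (drop a xs) in
    g (take a is @ [sum_list js] @ drop (a + b) is) (take a xs @ [f js ys] @ drop (a + b) xs))"

text \<open>The sign produced by moving inputs of degrees \<open>is\<close> past each other along \<open>\<sigma>\<close>.\<close>

definition koszul_sign :: "(nat \<Rightarrow> nat) \<Rightarrow> int list \<Rightarrow> rat"
  where "koszul_sign \<sigma> is =
    (\<Prod>(k, l)\<in>{(k, l). k < l \<and> l < length is \<and> \<sigma> l < \<sigma> k}. parity_sign (is ! k * is ! l))"

definition ch_act :: "'a ch list \<Rightarrow> 'a ch \<Rightarrow> (nat \<Rightarrow> nat) \<Rightarrow> 'a multimor \<Rightarrow> 'a multimor"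
  where "ch_act Ks L \<sigma> f = restr (permute_list \<sigma> Ks) (\<lambda>is xs.
    koszul_sign \<sigma> is \<odot>\<^bsub>obj L (sum_list is)\<^esub>
      f (permute_list (inv_into UNIV \<sigma>) is) (permute_list (inv_into UNIV \<sigma>) xs))"

definition Ch_Q :: "('a ch, 'a multimor) operad"
  where "Ch_Q = \<lparr>colors = {K. is_ch K}, ops = ch_ops, ident = ch_ident, pcomp = ch_pcomp,
    act = ch_act\<rparr>"


section \<open>Homology as a lax symmetric monoidal functor\<close>

definition homology_ch :: "'a ch \<Rightarrow> 'a set ch"
  where "homology_ch K =
    \<lparr>obj = homology K,
     dif = (\<lambda>n. restrict (\<lambda>X. \<zero>\<^bsub>homology K (n - 1)\<^esub>) (carrier (homology K n)))\<rparr>"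

text \<open>
  The action on multimorphisms incorporates the Kuenneth morphism:
  \<open>([x\<^sub>1], \<dots>, [x\<^sub>r]) \<mapsto> [f (x\<^sub>1, \<dots>, x\<^sub>r)]\<close>.
\<close>

definition homology_functor :: "('a ch, 'a multimor, 'a set ch, 'a set multimor) operad_map"
  where "homology_functor =
    \<lparr>on_col = homology_ch,
     on_op = (\<lambda>Ks L f. restr (map homology_ch Ks) (\<lambda>is Xs.
       \<Union>xs\<in>listset Xs. boundaries L (sum_list is) +>\<^bsub>obj L (sum_list is)\<^esub> f is xs))\<rparr>"


section \<open>Formality\<close>

text \<open>A lax symmetric monoidal functor to complexes is a map of colored operads to \<open>Ch_Q\<close>.\<close>

type_synonym ('o, 'm, 'a) ch_functor = "('o, 'm, 'a ch, 'a multimor) operad_map"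

definition monoidal_transformation :: "('o, 'm) operad \<Rightarrow> ('o, 'm, 'a) ch_functor \<Rightarrow>
    ('o, 'm, 'b) ch_functor \<Rightarrow> ('o \<Rightarrow> int \<Rightarrow> 'a \<Rightarrow> 'b) \<Rightarrow> bool"
  where "monoidal_transformation C F G \<eta> \<longleftrightarrow>
    (\<forall>c\<in>colors C. chain_map (on_col F c) (on_col G c) (\<eta> c)) \<and>
    (\<forall>cs\<in>lists (colors C). \<forall>c\<in>colors C. \<forall>f\<in>ops C cs c. \<forall>is.
      \<forall>xs\<in>inputs (map (on_col F) cs) is. length is = length cs \<longrightarrow>
        \<eta> c (sum_list is) (on_op F cs c f is xs) =
        on_op G cs c f is (map (\<lambda>j. \<eta> (cs ! j) (is ! j) (xs ! j)) [0..<length cs]))"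

definition quasi_iso_arrow ::
    "('o, 'm) operad \<Rightarrow> ('o, 'm, 'a) ch_functor \<Rightarrow> ('o, 'm, 'b) ch_functor \<Rightarrow> bool"
  where "quasi_iso_arrow C F G \<longleftrightarrow>
    (\<exists>\<eta>. monoidal_transformation C F G \<eta> \<and>
      (\<forall>c\<in>colors C. quasi_iso (on_col F c) (on_col G c) (\<eta> c)))"

text \<open>
  The zig-zag is \<open>F \<leftarrow> Fs ! 0 \<rightarrow> Fs ! 1 \<leftarrow> Fs ! 2 \<rightarrow> \<dots> \<leftarrow> last Fs \<rightarrow> H \<circ> F\<close>.  As types cannot be
  quantified inside a formula, the complexes in the zig-zag are required to have their underlying
  sets in the type \<open>'a\<close> that is used for \<open>F\<close>; those of \<open>H \<circ> F\<close> consist of cosets.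
\<close>

definition formal :: "('o, 'm) operad \<Rightarrow> ('o, 'm, 'a) ch_functor \<Rightarrow> bool"
  where "formal C F \<longleftrightarrow>
    is_operad_map C Ch_Q F \<and>
    (\<exists>Fs :: ('o, 'm, 'a) ch_functor list.
      odd (length Fs) \<and> (\<forall>G\<in>set Fs. is_operad_map C Ch_Q G) \<and>
      quasi_iso_arrow C (hd Fs) F \<and>
      (\<forall>i. Suc i < length Fs \<longrightarrow>
        (if even i then quasi_iso_arrow C (Fs ! i) (Fs ! Suc i)
         else quasi_iso_arrow C (Fs ! Suc i) (Fs ! i))) \<and>
      quasi_iso_arrow C (last Fs) (operad_map_comp homology_functor F))"


section \<open>Complexes of mixed Hodge structures\<close>

type_synonym 'a mhs_complex = "('a mhs, 'a) complexes"

definition underlying :: "'a mhs_complex \<Rightarrow> 'a ch"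
  where "underlying K = \<lparr>obj = (\<lambda>n. space (obj K n)), dif = dif K\<rparr>"

definition is_mhs_complex :: "'a mhs_complex \<Rightarrow> bool"
  where "is_mhs_complex K \<longleftrightarrow> is_ch (underlying K) \<and>
    (\<forall>n. is_mhs (obj K n) \<and> mhs_hom (obj K n) (obj K (n - 1)) (dif K n))"

definition Ch_MHS :: "('a mhs_complex, 'a multimor) operad"
  where "Ch_MHS =
    \<lparr>colors = {K. is_mhs_complex K},
     ops = (\<lambda>Ks L. {f \<in> ch_ops (map underlying Ks) (underlying L).
        \<forall>is. length is = length Ks \<longrightarrow>
          mhs_multi (map2 obj Ks is) (obj L (sum_list is)) (f is)}),
     ident = (\<lambda>K. ch_ident (underlying K)),
     pcomp = (\<lambda>Ls Ks Ls'. ch_pcomp (map underlying Ls) (map underlying Ks) (map underlying Ls')),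
     act = (\<lambda>Ks L. ch_act (map underlying Ks) (underlying L))\<rparr>"

definition homology_mhs :: "'a mhs_complex \<Rightarrow> int \<Rightarrow> 'a set mhs"
  where "homology_mhs K n =
    subquot_mhs (obj K n) (cycles (underlying K) n) (boundaries (underlying K) n)"

definition alpha_pure :: "rat \<Rightarrow> 'a mhs_complex \<Rightarrow> bool"
  where "alpha_pure \<alpha> K \<longleftrightarrow>
    (\<forall>n p. of_int p \<noteq> \<alpha> * of_int n \<longrightarrow>
      (let G = space (gr_wt (homology_mhs K n) p) in carrier G = {\<zero>\<^bsub>G\<^esub>}))"

definition full_suboperad :: "('o, 'm) operad \<Rightarrow> ('o \<Rightarrow> bool) \<Rightarrow> ('o, 'm) operad"
  where "full_suboperad C P = C\<lparr>colors := {c \<in> colors C. P c}\<rparr>"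

text \<open>
  The restriction of \<open>Pi_Q\<close> to a full suboperad is given by the same data, since \<open>is_operad_map\<close> and
  \<open>monoidal_transformation\<close> only look at the colors of their source.
\<close>

definition Pi_Q :: "('a mhs_complex, 'a multimor, 'a) ch_functor"
  where "Pi_Q = \<lparr>on_col = underlying, on_op = (\<lambda>Ks L f. f)\<rparr>"

end

theory Submission
  imports Defs
begin

text \<open>
  Suppose that the terms of every complex carry a decomposition by weights which is defined over the
  rational numbers, natural, and multiplicative: a product of vectors of weights \<open>p\<^sub>1, \<dots>, p\<^sub>r\<close> has
  weight \<open>p\<^sub>1 + \<dots> + p\<^sub>r\<close>.  Call \<open>p / \<alpha>\<close> the slope of the weight \<open>p\<close>.  Slopes add up in products,
  as degrees do, and purity says that the homology in degree \<open>n\<close> has slope \<open>n\<close>.  Let \<open>T\<^sub>n\<close> consist of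
  the elements of degree \<open>n\<close> with slopes at most \<open>n\<close> whose differential has slopes at most \<open>n - 1\<close>.
  These subspaces form a subcomplex and are stable under all multimorphisms.  As the differential
  preserves weights, a cycle splits into cycles of a single weight, and those of slope other than \<open>n\<close>
  are boundaries; so the inclusion of \<open>T\<close> is a quasi-isomorphism.  The component of slope exactly \<open>n\<close>
  of an element of \<open>T\<^sub>n\<close> is a cycle, and sending an element to the homology class of this component is
  a multiplicative quasi-isomorphism onto homology: if some factor has smaller slope than its degree,
  so has the product.  Hence one intermediate functor is enough; its two arrows are
  \<open>inclusion_arrow\<close> and \<open>homology_arrow\<close>.

  For positive \<open>\<alpha>\<close> this argument could be run with the weight filtration instead of a decomposition.
  For negative \<open>\<alpha>\<close> the filtration by slopes runs against the weight filtration, and formality would fail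
  for arbitrary filtered complexes; here the Hodge filtrations are indispensable.  Deligne's subspaces
  \<open>I\<^bsup>p,q\<^esup>\<close> of the complexification of a mixed Hodge structure are natural, multiplicative, and split the
  weight filtration (\<open>graph_total\<close>, \<open>graph_weight\<close>), but their definition uses the complex conjugate of
  the Hodge filtration, so they are not rational.

  The descent to the rational numbers uses the operator \<open>y\<close> on the complexification which is
  multiplication by \<open>p + q\<close> on \<open>I\<^bsup>p,q\<^esup>\<close>.  It commutes with morphisms, satisfies the Leibniz rule for
  products, and acts as \<open>k\<close> on the graded piece of weight \<open>k\<close>.  These conditions on \<open>y\<close> are affine linear
  with rational coefficients.  Therefore they survive if a rational linear retraction \<open>\<lambda>\<close> of the complex
  numbers onto the rational numbers is applied to the coefficients of \<open>y (v \<otimes> 1)\<close>.  The result is the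
  rational operator \<open>grading\<close>, with \<open>grading_weight\<close> and \<open>grading_leibniz\<close>, and its eigenspaces
  are the required decomposition.

  Vectors in a complexification are handled through representatives, which are formal combinations
  \<open>\<Sum> v \<otimes> c\<close>.  A representative represents zero if and only if \<open>\<Sum> \<mu> c \<cdot> v\<close> vanishes for every rational
  linear functional \<open>\<mu>\<close> on the complex numbers (\<open>relations_iff\<close>); exactness properties of the
  complexification are read off from this.
\<close>

section \<open>Vector spaces, quotients and linear maps\<close>

lemma field_ring_simps [simp]:
  "carrier field_ring = UNIV" "monoid.mult field_ring = (*)" "monoid.one field_ring = 1"
  "zero field_ring = 0" "add field_ring = (+)"
  by (simp_all add: field_ring_def)

lemma field_ring_cring: "cring (field_ring :: 'k::field ring)"
proof (rule cringI)
  show "abelian_group (field_ring :: 'k ring)"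
    by (rule abelian_groupI) (auto simp: add.assoc add.commute intro: exI[of _ "- x" for x])
  show "comm_monoid (field_ring :: 'k ring)"
    by (rule comm_monoidI) (auto simp: mult.assoc mult.commute)
qed (auto simp: distrib_right)

locale vs =
  fixes V :: "('k::field, 'a) module" (structure)
  assumes vspace: "vspace V"
begin

lemma is_module: "Module.module field_ring V"
  using vspace by (simp add: vspace_def)

sublocale abelian_group V
  using is_module by (simp add: Module.module_def)

lemma smult_closed [simp, intro]: "x \<in> carrier V \<Longrightarrow> q \<odot> x \<in> carrier V"
  using module.smult_closed[OF is_module] by simp

lemma smult_l_distr: "x \<in> carrier V \<Longrightarrow> (a + b) \<odot> x = a \<odot> x \<oplus> b \<odot> x"
  using module.smult_l_distr[OF is_module, of a b x] by simp

lemma smult_r_distr: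
  "x \<in> carrier V \<Longrightarrow> y \<in> carrier V \<Longrightarrow> a \<odot> (x \<oplus> y) = a \<odot> x \<oplus> a \<odot> y"
  using module.smult_r_distr[OF is_module, of a x y] by simp

lemma smult_assoc: "x \<in> carrier V \<Longrightarrow> (a * b) \<odot> x = a \<odot> (b \<odot> x)"
  using module.smult_assoc1[OF is_module, of a b x] by simp

lemma smult_one [simp]: "x \<in> carrier V \<Longrightarrow> 1 \<odot> x = x"
  using module.smult_one[OF is_module, of x] by simp

lemma smult_zero_left [simp]: "x \<in> carrier V \<Longrightarrow> 0 \<odot> x = \<zero>"
  using smult_l_distr[of x 0 0] smult_closed[of x 0]
  by (metis add.l_cancel_one add_0)

lemma smult_zero_right [simp]: "q \<odot> \<zero> = \<zero>"
  using smult_assoc[of "\<zero>" q 0] smult_zero_left by (metis mult_zero_right zero_closed)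

lemma smult_uminus: "x \<in> carrier V \<Longrightarrow> (- a) \<odot> x = \<ominus> (a \<odot> x)"
  using smult_l_distr[of x "- a" a] by (simp add: minus_equality)

lemma a_inv_eq: "x \<in> carrier V \<Longrightarrow> \<ominus> x = (- 1) \<odot> x"
  using smult_uminus[of x 1] by simp

lemma smult_eq_zeroD: "x \<in> carrier V \<Longrightarrow> q \<odot> x = \<zero> \<Longrightarrow> q \<noteq> 0 \<Longrightarrow> x = \<zero>"
  using smult_assoc[of x "inverse q" q] by simp

lemma subspc_iff:
  "subspc V N \<longleftrightarrow> N \<subseteq> carrier V \<and> \<zero> \<in> N \<and> (\<forall>x\<in>N. \<forall>y\<in>N. x \<oplus> y \<in> N) \<and>
     (\<forall>q. \<forall>x\<in>N. q \<odot> x \<in> N)" (is "_ \<longleftrightarrow> ?R")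
proof
  assume "subspc V N"
  then have s: "submodule N field_ring V" by (simp add: subspc_def)
  then have "subgroup N (add_monoid V)" by (simp add: submodule_def)
  then show ?R using submodule.smult_closed[OF s]
    using subgroup.subset[of N "add_monoid V"] subgroup.one_closed[of N "add_monoid V"]
      subgroup.m_closed[of N "add_monoid V"] by auto
next
  assume R: ?R
  show "subspc V N"
    unfolding subspc_def
  proof (rule module.submoduleI[OF is_module])
    fix a assume a: "a \<in> N"
    then have "\<ominus> a = (- 1) \<odot> a" using R a_inv_eq by blast
    then show "\<ominus> a \<in> N" using R a by simp
  qed (use R in auto)
qed

lemma subspcD:
  assumes "subspc V N"
  shows "N \<subseteq> carrier V" "\<zero> \<in> N" "x \<in> N \<Longrightarrow> y \<in> N \<Longrightarrow> x \<oplus> y \<in> N" "x \<in> N \<Longrightarrow> q \<odot> x \<in> N"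
    "x \<in> N \<Longrightarrow> y \<in> N \<Longrightarrow> x \<ominus> y \<in> N"
proof -
  show *: "N \<subseteq> carrier V" "\<zero> \<in> N" "\<And>x y. x \<in> N \<Longrightarrow> y \<in> N \<Longrightarrow> x \<oplus> y \<in> N"
    "\<And>q x. x \<in> N \<Longrightarrow> q \<odot> x \<in> N" using assms by (auto simp: subspc_iff)
  show "x \<in> N \<Longrightarrow> y \<in> N \<Longrightarrow> x \<ominus> y \<in> N"
    using * by (metis a_inv_eq a_minus_def subsetD)
qed

lemma subspcI:
  assumes "N \<subseteq> carrier V" "\<zero> \<in> N" "\<And>x y. x \<in> N \<Longrightarrow> y \<in> N \<Longrightarrow> x \<oplus> y \<in> N"
    "\<And>q x. x \<in> N \<Longrightarrow> q \<odot> x \<in> N"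
  shows "subspc V N"
  using assms by (auto simp: subspc_iff)

lemma subspc_carrier: "subspc V (carrier V)"
  by (auto simp: subspc_iff)

lemma subspc_zero: "subspc V {\<zero>}"
  by (auto simp: subspc_iff)

lemma subspc_inter: "subspc V N \<Longrightarrow> subspc V N' \<Longrightarrow> subspc V (N \<inter> N')"
  by (auto simp: subspc_iff)

lemma generated_incl: "S \<subseteq> generated V S"
  by (auto simp: generated_def)

lemma generated_least: "subspc V N \<Longrightarrow> S \<subseteq> N \<Longrightarrow> generated V S \<subseteq> N"
  by (auto simp: generated_def)

lemma generated_mono: "S \<subseteq> S' \<Longrightarrow> generated V S \<subseteq> generated V S'"
  by (auto simp: generated_def)

lemma generated_subspc:
  assumes "S \<subseteq> carrier V"
  shows "subspc V (generated V S)"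
proof -
  have "generated V S \<subseteq> carrier V"
    using generated_least[OF subspc_carrier assms] .
  then show ?thesis by (auto simp: subspc_iff generated_def)
qed

lemma diff_eq_zero_iff: "x \<in> carrier V \<Longrightarrow> y \<in> carrier V \<Longrightarrow> x \<ominus> y = \<zero> \<longleftrightarrow> x = y"
  by (simp add: a_minus_def add.inv_solve_right')

lemma restrict_carrier:
  assumes "subspc V N"
  shows "vs (V\<lparr>carrier := N\<rparr>)"
proof -
  note N = subspcD[OF assms]
  have NV: "\<And>x. x \<in> N \<Longrightarrow> x \<in> carrier V" using N by auto
  have ex: "\<exists>y\<in>N. y \<oplus> x = \<zero>" if "x \<in> N" for x
  proof
    show "(- 1) \<odot> x \<in> N" using that N by blast
    show "(- 1) \<odot> x \<oplus> x = \<zero>" using that N NV by (simp flip: a_inv_eq add: l_neg)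
  qed
  have "abelian_group (V\<lparr>carrier := N\<rparr>)"
    by (rule abelian_groupI) (use N(2,3) ex in \<open>auto simp: a_assoc NV intro: a_comm\<close>)
  then have "Module.module field_ring (V\<lparr>carrier := N\<rparr>)"
    by (rule moduleI[OF field_ring_cring])
      (use N(4) in \<open>auto simp: smult_l_distr smult_r_distr smult_assoc NV\<close>)
  then show ?thesis by (simp add: vs_def vspace_def)
qed

lemma rcos_mem_iff:
  assumes "subspc V N" "x \<in> carrier V"
  shows "y \<in> N +> x \<longleftrightarrow> y \<in> carrier V \<and> y \<ominus> x \<in> N"
proof -
  have NV: "\<And>h. h \<in> N \<Longrightarrow> h \<in> carrier V" using subspcD(1)[OF assms(1)] by auto
  show ?thesis
  proof
    assume "y \<in> N +> x"
    then obtain h where h: "h \<in> N" "y = h \<oplus> x" by (auto simp: a_r_coset_def')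
    then have "y \<ominus> x = h" using NV assms by (simp add: a_minus_def a_assoc r_neg)
    then show "y \<in> carrier V \<and> y \<ominus> x \<in> N" using h NV assms by auto
  next
    assume y: "y \<in> carrier V \<and> y \<ominus> x \<in> N"
    then have "y = (y \<ominus> x) \<oplus> x" using assms by (simp add: a_minus_def a_assoc l_neg)
    then show "y \<in> N +> x" using y by (auto simp: a_r_coset_def')
  qed
qed

lemma rcos_eq_iff:
  assumes "subspc V N" "x \<in> carrier V" "y \<in> carrier V"
  shows "N +> x = N +> y \<longleftrightarrow> x \<ominus> y \<in> N"
proof
  assume "N +> x = N +> y"
  moreover have "x \<in> N +> x" using assms subspcD(2) by (simp add: rcos_mem_iff a_minus_def r_neg)
  ultimately show "x \<ominus> y \<in> N" using rcos_mem_iff[OF assms(1,3)] by blast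
next
  assume h: "x \<ominus> y \<in> N"
  have trans: "z \<ominus> y \<in> N"
    if "z \<ominus> x \<in> N" "x \<ominus> y \<in> N" "x \<in> carrier V" "y \<in> carrier V" "z \<in> carrier V" for x y z
  proof -
    have "(z \<ominus> x) \<oplus> (x \<ominus> y) = z \<ominus> y"
      using that(3-) by (simp add: a_minus_def a_assoc) (simp add: a_assoc[symmetric] l_neg)
    then show ?thesis using subspcD(3)[OF assms(1) that(1,2)] by simp
  qed
  have "y \<ominus> x = (- 1) \<odot> (x \<ominus> y)"
    using assms by (simp add: a_minus_def smult_r_distr a_inv_eq flip: smult_assoc) (simp add: a_comm)
  then have "y \<ominus> x \<in> N" using subspcD(4)[OF assms(1) h] by simp
  then have "z \<ominus> x \<in> N \<longleftrightarrow> z \<ominus> y \<in> N" if "z \<in> carrier V" for z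
    using trans h assms that by blast
  then show "N +> x = N +> y" by (intro Set.set_eqI) (auto simp: rcos_mem_iff assms)
qed

lemma rcos_zero: "subspc V N \<Longrightarrow> N +> \<zero> = N"
  using subspcD(1) a_coset_add_zero by blast

lemma rcos_self: "subspc V N \<Longrightarrow> x \<in> carrier V \<Longrightarrow> x \<in> N +> x"
  using subspcD(2) by (simp add: rcos_mem_iff a_minus_def r_neg)

lemma rcos_eq_zero_iff: "subspc V N \<Longrightarrow> x \<in> carrier V \<Longrightarrow> N +> x = N \<longleftrightarrow> x \<in> N"
  using rcos_eq_iff[of N x "\<zero>"] rcos_zero[of N] by (simp add: a_minus_def a_inv_eq)

lemma quot_carrier: "carrier (quot V N) = (\<lambda>x. N +> x) ` carrier V"
  by (auto simp: quot_def A_RCOSETS_def RCOSETS_def a_r_coset_def)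

lemma quot_zero: "\<zero>\<^bsub>quot V N\<^esub> = N"
  by (simp add: quot_def)

lemma quot_add:
  assumes "subspc V N" "x \<in> carrier V" "y \<in> carrier V"
  shows "(N +> x) \<oplus>\<^bsub>quot V N\<^esub> (N +> y) = N +> (x \<oplus> y)"
proof -
  note N = subspcD[OF assms(1)]
  have NV: "\<And>h. h \<in> N \<Longrightarrow> h \<in> carrier V" using N by auto
  have "set_add V (N +> x) (N +> y) = N +> (x \<oplus> y)"
  proof (intro Set.set_eqI iffI)
    fix z assume "z \<in> set_add V (N +> x) (N +> y)"
    then obtain h k where hk: "h \<in> N" "k \<in> N" "z = (h \<oplus> x) \<oplus> (k \<oplus> y)"
      by (auto simp: set_add_def' a_r_coset_def')
    then have "z = (h \<oplus> k) \<oplus> (x \<oplus> y)" using NV assms by (simp add: a_ac)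
    then show "z \<in> N +> (x \<oplus> y)" using hk N by (auto simp: a_r_coset_def')
  next
    fix z assume "z \<in> N +> (x \<oplus> y)"
    then obtain h where h: "h \<in> N" "z = h \<oplus> (x \<oplus> y)" by (auto simp: a_r_coset_def')
    then have "z = (h \<oplus> x) \<oplus> (\<zero> \<oplus> y)" using NV assms by (simp add: a_ac)
    then show "z \<in> set_add V (N +> x) (N +> y)" using h N
      by (auto simp: set_add_def' a_r_coset_def' intro!: bexI)
  qed
  then show ?thesis by (simp add: quot_def)
qed

lemma quot_smult:
  assumes "subspc V N" "x \<in> carrier V"
  shows "q \<odot>\<^bsub>quot V N\<^esub> (N +> x) = N +> (q \<odot> x)"
proof -
  note N = subspcD[OF assms(1)]
  have NV: "\<And>h. h \<in> N \<Longrightarrow> h \<in> carrier V" using N by auto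
  have "set_add V N ((\<lambda>y. q \<odot> y) ` (N +> x)) = N +> (q \<odot> x)"
  proof (intro Set.set_eqI iffI)
    fix z assume "z \<in> set_add V N ((\<lambda>y. q \<odot> y) ` (N +> x))"
    then obtain h k where hk: "h \<in> N" "k \<in> N" "z = h \<oplus> q \<odot> (k \<oplus> x)"
      by (auto simp: set_add_def' a_r_coset_def')
    then have "z = (h \<oplus> q \<odot> k) \<oplus> q \<odot> x" using NV assms by (simp add: smult_r_distr a_ac)
    then show "z \<in> N +> (q \<odot> x)" using hk N by (auto simp: a_r_coset_def')
  next
    fix z assume "z \<in> N +> (q \<odot> x)"
    then obtain h where h: "h \<in> N" "z = h \<oplus> q \<odot> x" by (auto simp: a_r_coset_def')
    then have "z = h \<oplus> q \<odot> (\<zero> \<oplus> x)" using NV assms by (simp add: a_ac)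
    then show "z \<in> set_add V N ((\<lambda>y. q \<odot> y) ` (N +> x))" using h N
      by (auto simp: set_add_def' a_r_coset_def' intro!: bexI)
  qed
  then show ?thesis by (simp add: quot_def)
qed

lemma quot_vs:
  assumes N: "subspc V N"
  shows "vs (quot V N)"
proof -
  note simps = quot_carrier quot_zero quot_add[OF N] quot_smult[OF N]
  have z: "N = N +> \<zero>" using rcos_zero[OF N] by simp
  have "abelian_group (quot V N)"
  proof (rule abelian_groupI)
    show "\<zero>\<^bsub>quot V N\<^esub> \<in> carrier (quot V N)" using z by (auto simp: simps)
    fix X assume "X \<in> carrier (quot V N)"
    then obtain x where x: "x \<in> carrier V" "X = N +> x" by (auto simp: simps)
    show "\<zero>\<^bsub>quot V N\<^esub> \<oplus>\<^bsub>quot V N\<^esub> X = X"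
      using quot_add[OF N, of "\<zero>" x] x z by (simp add: simps)
    show "\<exists>Y\<in>carrier (quot V N). Y \<oplus>\<^bsub>quot V N\<^esub> X = \<zero>\<^bsub>quot V N\<^esub>"
    proof
      show "(N +> (\<ominus> x)) \<oplus>\<^bsub>quot V N\<^esub> X = \<zero>\<^bsub>quot V N\<^esub>"
        using x z by (simp add: simps l_neg)
      show "N +> (\<ominus> x) \<in> carrier (quot V N)" using x by (auto simp: simps)
    qed
      fix Y assume "Y \<in> carrier (quot V N)"
    then obtain y where y: "y \<in> carrier V" "Y = N +> y" by (auto simp: simps)
    show "X \<oplus>\<^bsub>quot V N\<^esub> Y = Y \<oplus>\<^bsub>quot V N\<^esub> X"
      using x y by (simp add: simps a_comm)
  qed (auto simp: simps a_assoc)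
  then have "Module.module field_ring (quot V N)"
    by (rule moduleI[OF field_ring_cring])
      (auto simp: simps smult_l_distr smult_r_distr smult_assoc)
  then show ?thesis by (simp add: vs_def vspace_def)
qed

end

lemma subquot_rcos: "B +>\<^bsub>V\<lparr>carrier := Z\<rparr>\<^esub> x = B +>\<^bsub>V\<^esub> x"
  by (simp add: a_r_coset_def')

lemma subquot_simps:
  assumes "vs V" "subspc V Z" "subspc V B" "B \<subseteq> Z"
  shows "carrier (subquot V Z B) = (\<lambda>x. B +>\<^bsub>V\<^esub> x) ` Z"
    and "\<zero>\<^bsub>subquot V Z B\<^esub> = B"
    and "x \<in> Z \<Longrightarrow> y \<in> Z \<Longrightarrow> (B +>\<^bsub>V\<^esub> x) \<oplus>\<^bsub>subquot V Z B\<^esub> (B +>\<^bsub>V\<^esub> y) = B +>\<^bsub>V\<^esub> (x \<oplus>\<^bsub>V\<^esub> y)"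
    and "x \<in> Z \<Longrightarrow> q \<odot>\<^bsub>subquot V Z B\<^esub> (B +>\<^bsub>V\<^esub> x) = B +>\<^bsub>V\<^esub> (q \<odot>\<^bsub>V\<^esub> x)"
    and "vs (subquot V Z B)"
proof -
  interpret vs V by fact
  interpret Z: vs "V\<lparr>carrier := Z\<rparr>" using restrict_carrier assms by blast
  have B: "subspc (V\<lparr>carrier := Z\<rparr>) B"
    using assms by (auto simp: Z.subspc_iff subspc_iff)
  show "carrier (subquot V Z B) = (\<lambda>x. B +>\<^bsub>V\<^esub> x) ` Z" "\<zero>\<^bsub>subquot V Z B\<^esub> = B" "vs (subquot V Z B)"
    using Z.quot_carrier[of B] Z.quot_zero[of B] Z.quot_vs[OF B] by (auto simp: subquot_def subquot_rcos)
  show "x \<in> Z \<Longrightarrow> y \<in> Z \<Longrightarrow> (B +>\<^bsub>V\<^esub> x) \<oplus>\<^bsub>subquot V Z B\<^esub> (B +>\<^bsub>V\<^esub> y) = B +>\<^bsub>V\<^esub> (x \<oplus>\<^bsub>V\<^esub> y)"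
    using Z.quot_add[OF B] by (simp add: subquot_def subquot_rcos)
  show "x \<in> Z \<Longrightarrow> q \<odot>\<^bsub>subquot V Z B\<^esub> (B +>\<^bsub>V\<^esub> x) = B +>\<^bsub>V\<^esub> (q \<odot>\<^bsub>V\<^esub> x)"
    using Z.quot_smult[OF B] by (simp add: subquot_def subquot_rcos)
qed

locale lin_map = V: vs V + V': vs V' for V :: "('k::field, 'a) module" and V' :: "('k, 'b) module" +
  fixes f :: "'a \<Rightarrow> 'b"
  assumes lin: "lin V V' f"
begin

lemma closed [simp, intro]: "x \<in> carrier V \<Longrightarrow> f x \<in> carrier V'"
  and add: "x \<in> carrier V \<Longrightarrow> y \<in> carrier V \<Longrightarrow> f (x \<oplus>\<^bsub>V\<^esub> y) = f x \<oplus>\<^bsub>V'\<^esub> f y"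
  and smult: "x \<in> carrier V \<Longrightarrow> f (q \<odot>\<^bsub>V\<^esub> x) = q \<odot>\<^bsub>V'\<^esub> f x"
  using lin by (auto simp: lin_def)

lemma zero [simp]: "f \<zero>\<^bsub>V\<^esub> = \<zero>\<^bsub>V'\<^esub>"
  using smult[of "\<zero>\<^bsub>V\<^esub>" 0] by simp

lemma diff: "x \<in> carrier V \<Longrightarrow> y \<in> carrier V \<Longrightarrow> f (x \<ominus>\<^bsub>V\<^esub> y) = f x \<ominus>\<^bsub>V'\<^esub> f y"
  by (simp add: a_minus_def V.a_inv_eq V'.a_inv_eq add smult)

lemma finsum:
  assumes "finite A" "\<And>i. i \<in> A \<Longrightarrow> g i \<in> carrier V"
  shows "f (\<Oplus>\<^bsub>V\<^esub>i\<in>A. g i) = (\<Oplus>\<^bsub>V'\<^esub>i\<in>A. f (g i))"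
  using assms
proof (induction A rule: finite_induct)
  case (insert i A)
  then have "g \<in> A \<rightarrow> carrier V" "(\<lambda>i. f (g i)) \<in> A \<rightarrow> carrier V'" by auto
  then show ?case using insert V.finsum_closed by (simp add: add)
qed simp

lemma vimage_subspc:
  assumes "subspc V' N"
  shows "subspc V {x \<in> carrier V. f x \<in> N}"
  using V'.subspcD[OF assms] by (intro V.subspcI) (auto simp: add smult)

lemma image_subspc:
  assumes "subspc V N"
  shows "subspc V' (f ` N)"
proof -
  note N = V.subspcD[OF assms]
  have NV: "\<And>x. x \<in> N \<Longrightarrow> x \<in> carrier V" using N by auto
  show ?thesis
  proof (rule V'.subspcI)
    show "\<zero>\<^bsub>V'\<^esub> \<in> f ` N" using imageI[OF N(2), of f] by simp
    fix u v q assume "u \<in> f ` N"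
    then obtain x where x: "x \<in> N" "u = f x" by auto
    show "q \<odot>\<^bsub>V'\<^esub> u \<in> f ` N"
      using N(4)[OF x(1), of q] x NV by (auto simp flip: smult)
    assume "v \<in> f ` N"
    then obtain y where y: "y \<in> N" "v = f y" by auto
    show "u \<oplus>\<^bsub>V'\<^esub> v \<in> f ` N"
      using N(3)[OF x(1) y(1)] x y NV by (auto simp flip: add)
  qed (use NV in auto)
qed

end

lemma lin_mapI: "vs V \<Longrightarrow> vs V' \<Longrightarrow> lin V V' f \<Longrightarrow> lin_map V V' f"
  by (simp add: lin_map_def lin_map_axioms_def)

text \<open>
  The truncated complexes are subspaces of the given ones, while the Leibniz rule mentions sums in the
  space itself; this lemma moves sums between the two.
\<close>

lemma finsum_restrict_carrier:
  assumes "vs V" "subspc V N" "finite A" "\<And>i. i \<in> A \<Longrightarrow> g i \<in> N"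
  shows "(\<Oplus>\<^bsub>V\<lparr>carrier := N\<rparr>\<^esub>i\<in>A. g i) = (\<Oplus>\<^bsub>V\<^esub>i\<in>A. g i)"
proof -
  interpret vs V by fact
  interpret N: vs "V\<lparr>carrier := N\<rparr>" using restrict_carrier assms by blast
  have "lin (V\<lparr>carrier := N\<rparr>) V (\<lambda>x. x)" using subspcD(1)[OF assms(2)] by (auto simp: lin_def)
  then interpret lin_map "V\<lparr>carrier := N\<rparr>" V "\<lambda>x. x" by unfold_locales
  show ?thesis using finsum[of A g] assms by simp
qed

lemma (in vs) finsum_in_subspc:
  assumes "subspc V N" "finite A" "\<And>i. i \<in> A \<Longrightarrow> g i \<in> N"
  shows "(\<Oplus>i\<in>A. g i) \<in> N"
  using assms(2,3)
proof (induction A rule: finite_induct)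
  case empty then show ?case using subspcD(2)[OF assms(1)] by simp
next
  case (insert i A)
  have "g \<in> A \<rightarrow> carrier V" "g i \<in> carrier V" using insert subspcD(1)[OF assms(1)] by auto
  then show ?case using insert subspcD[OF assms(1)] by simp
qed

section \<open>Representatives in a complexification\<close>

abbreviation single :: "'a \<Rightarrow> 'b \<Rightarrow> 'a \<Rightarrow>\<^sub>0 'b::zero" where "single \<equiv> Poly_Mapping.single"
abbreviation lookup :: "('a \<Rightarrow>\<^sub>0 'b::zero) \<Rightarrow> 'a \<Rightarrow> 'b" where "lookup \<equiv> Poly_Mapping.lookup"
abbreviation keys :: "('a \<Rightarrow>\<^sub>0 'b::zero) \<Rightarrow> 'a set" where "keys \<equiv> Poly_Mapping.keys"

definition csc :: "'k::field \<Rightarrow> ('a \<Rightarrow>\<^sub>0 'k) \<Rightarrow> 'a \<Rightarrow>\<^sub>0 'k"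
  where "csc c = Poly_Mapping.map ((*) c)"

lemma lookup_map0: "g 0 = 0 \<Longrightarrow> lookup (Poly_Mapping.map g x) v = g (lookup x v)"
  by (simp add: Poly_Mapping.map.rep_eq "when_def")

lemma lookup_csc [simp]: "lookup (csc c x) v = c * lookup x v"
  by (simp add: csc_def lookup_map0)

lemma keys_csc: "keys (csc c x) \<subseteq> keys x"
  by (auto simp: in_keys_iff)

lemma csc_single [simp]: "csc c (single v a) = single v (c * a)"
  by (rule poly_mapping_eqI) (simp add: lookup_single "when_def")

global_interpretation cvs: vector_space "csc :: 'k::field \<Rightarrow> ('a \<Rightarrow>\<^sub>0 'k) \<Rightarrow> _"
  by unfold_locales
    (auto intro!: poly_mapping_eqI simp: lookup_add distrib_left distrib_right mult.assoc)

lemma single_sum: "single v (sum c B) = (\<Sum>b\<in>B. single v (c b))"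
  by (induction B rule: infinite_finite_induct) (auto simp: single_add)

lemma poly_expand:
  assumes "finite A" "keys x \<subseteq> A"
  shows "x = (\<Sum>v\<in>A. single v (lookup x v))"
proof (rule poly_mapping_eqI)
  fix w
  show "lookup x w = lookup (\<Sum>v\<in>A. single v (lookup x v)) w"
    using assms by (cases "w \<in> A") (auto simp: lookup_sum lookup_single "when_def" in_keys_iff
        sum.delta' intro!: sum.neutral)
qed

lemma free_space_simps [simp]:
  "carrier (free_space S) = {f. keys f \<subseteq> S}" "zero (free_space S) = 0" "add (free_space S) = (+)"
  "smult (free_space S) = csc"
  by (simp_all add: free_space_def csc_def fun_eq_iff)

lemma keys_add_sub: "keys x \<subseteq> S \<Longrightarrow> keys y \<subseteq> S \<Longrightarrow> keys (x + y) \<subseteq> S"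
  using Poly_Mapping.keys_add[of x y] by blast

lemma keys_csc_sub: "keys x \<subseteq> S \<Longrightarrow> keys (csc c x) \<subseteq> S"
  using keys_csc[of c x] by blast

lemma keys_sum_sub: "(\<And>i. i \<in> I \<Longrightarrow> keys (g i) \<subseteq> S) \<Longrightarrow> keys (sum g I) \<subseteq> S"
proof (induction I rule: infinite_finite_induct)
  case (insert i I)
  then show ?case by (simp add: keys_add_sub)
qed auto

lemma keys_subspace: "cvs.subspace {x. keys x \<subseteq> S}"
  unfolding cvs.subspace_def by (simp add: keys_add_sub keys_csc_sub)

lemma free_space_vs: "vs (free_space S :: ('k::field, _) module)"
proof -
  have "Module.module field_ring (free_space S :: ('k, _) module)"
  proof (rule moduleI[OF field_ring_cring])
    show "abelian_group (free_space S :: ('k, _) module)"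
    proof (rule abelian_groupI)
      fix x assume "x \<in> carrier (free_space S :: ('k, _) module)"
      then show "\<exists>y\<in>carrier (free_space S). y \<oplus>\<^bsub>free_space S\<^esub> x = \<zero>\<^bsub>free_space S\<^esub>"
        by (intro bexI[of _ "csc (- 1) x"]) (auto simp: keys_csc_sub)
    qed (auto simp: add.assoc add.commute keys_add_sub dest: subsetD[OF keys_add_sub])
  qed (auto simp: cvs.scale_right_distrib cvs.scale_left_distrib keys_csc_sub dest: subsetD[OF keys_csc])
  then show ?thesis by (simp add: vs_def vspace_def)
qed

lemma free_subspc_iff:
  "subspc (free_space S :: ('k::field, _) module) N \<longleftrightarrow> N \<subseteq> {x. keys x \<subseteq> S} \<and> cvs.subspace N"
proof -
  interpret vs "free_space S :: ('k, _) module" by (rule free_space_vs)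
  show ?thesis by (auto simp: subspc_iff cvs.subspace_def)
qed

lemma free_rcos: "N +>\<^bsub>free_space S\<^esub> x = (\<lambda>r. r + x) ` N"
  by (auto simp: a_r_coset_def')

lemma free_rcos_mem:
  assumes "cvs.subspace N"
  shows "y \<in> N +>\<^bsub>free_space S\<^esub> x \<longleftrightarrow> y - x \<in> N"
  by (auto simp: free_rcos image_iff) (metis diff_add_cancel)

lemma free_rcos_eq:
  assumes "cvs.subspace N"
  shows "N +>\<^bsub>free_space S\<^esub> x = N +>\<^bsub>free_space S'\<^esub> y \<longleftrightarrow> x - y \<in> N"
proof
  assume "N +>\<^bsub>free_space S\<^esub> x = N +>\<^bsub>free_space S'\<^esub> y"
  moreover have "x \<in> N +>\<^bsub>free_space S\<^esub> x"
    using cvs.subspace_0[OF assms] by (simp add: free_rcos_mem[OF assms])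
  ultimately show "x - y \<in> N" using free_rcos_mem[OF assms] by blast
next
  assume h: "x - y \<in> N"
  have "z - x \<in> N \<longleftrightarrow> z - y \<in> N" for z
    using cvs.subspace_add[OF assms, of "z - x" "x - y"] cvs.subspace_diff[OF assms, of "z - y" "x - y"] h
    by (auto simp: algebra_simps)
  then show "N +>\<^bsub>free_space S\<^esub> x = N +>\<^bsub>free_space S'\<^esub> y"
    by (intro Set.set_eqI) (simp add: free_rcos_mem[OF assms])
qed

definition rlin :: "(complex \<Rightarrow> rat) \<Rightarrow> bool"
  where "rlin \<mu> \<longleftrightarrow> (\<forall>a b. \<mu> (a + b) = \<mu> a + \<mu> b) \<and> (\<forall>q a. \<mu> (of_rat q * a) = q * \<mu> a)"

lemma rlinD:
  assumes "rlin \<mu>"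
  shows "\<mu> (a + b) = \<mu> a + \<mu> b" "\<mu> (of_rat q * a) = q * \<mu> a" "\<mu> 0 = 0"
proof -
  show "\<mu> (a + b) = \<mu> a + \<mu> b" "\<mu> (of_rat q * a) = q * \<mu> a" using assms by (auto simp: rlin_def)
  have "\<mu> (of_rat 0 * 0) = 0 * \<mu> 0" using assms unfolding rlin_def by blast
  then show "\<mu> 0 = 0" by simp
qed

lemma rlin_mult: "rlin \<mu> \<Longrightarrow> rlin (\<lambda>a. \<mu> (c * a))"
  unfolding rlin_def by (simp add: distrib_left mult.left_commute[of c])

lemma cnj_of_rat: "cnj (of_rat q) = of_rat q"
  by (cases q) (simp add: of_rat_rat)

lemma rlin_cnj: "rlin \<mu> \<Longrightarrow> rlin (\<lambda>a. \<mu> (cnj a))"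
  unfolding rlin_def by (auto simp: cnj_of_rat)

global_interpretation qc: vector_space "\<lambda>(q::rat) (c::complex). of_rat q * c"
  by unfold_locales (auto simp: distrib_left distrib_right of_rat_add of_rat_mult)

text \<open>
  It contains 1, so that the coordinate along 1 is a retraction onto the rational numbers.
\<close>

definition rbasis :: "complex set"
  where "rbasis = qc.extend_basis {1}"

lemma rbasis: "1 \<in> rbasis" "qc.independent rbasis" "qc.span rbasis = UNIV"
proof -
  have "qc.independent {1}" by simp
  from qc.extend_basis_superset[OF this] qc.independent_extend_basis[OF this] qc.span_extend_basis[OF this]
  show "1 \<in> rbasis" "qc.independent rbasis" "qc.span rbasis = UNIV" by (auto simp: rbasis_def)
qed

definition coord :: "complex \<Rightarrow> complex \<Rightarrow> rat"
  where "coord b a = qc.representation rbasis a b"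

lemma rlin_coord: "rlin (coord b)"
  using qc.representation_add[OF rbasis(2)] qc.representation_scale[OF rbasis(2)] rbasis(3)
  by (auto simp: rlin_def coord_def)

lemma coord_one: "coord 1 1 = 1"
  by (simp add: coord_def qc.representation_basis[OF rbasis(2,1)])

lemma coord_finite: "finite {b. coord b a \<noteq> 0}"
  by (simp add: coord_def qc.finite_representation)

lemma coord_sum:
  assumes "finite B" "{b. coord b a \<noteq> 0} \<subseteq> B"
  shows "(\<Sum>b\<in>B. of_rat (coord b a) * b) = a"
proof -
  have "(\<Sum>b\<in>B. of_rat (coord b a) * b) = (\<Sum>b\<in>{b. coord b a \<noteq> 0}. of_rat (coord b a) * b)"
    using assms by (intro sum.mono_neutral_right) auto
  also have "\<dots> = a"
    using qc.sum_nonzero_representation_eq[OF rbasis(2), of a] rbasis(3) by (simp add: coord_def)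
  finally show ?thesis .
qed

text \<open>
  The map \<open>id \<otimes> \<mu>\<close> from the complexification back to the space, on representatives.
\<close>

definition ev :: "(rat, 'a) module \<Rightarrow> (complex \<Rightarrow> rat) \<Rightarrow> ('a \<Rightarrow>\<^sub>0 complex) \<Rightarrow> 'a"
  where "ev V \<mu> x = (\<Oplus>\<^bsub>V\<^esub>v\<in>keys x. \<mu> (lookup x v) \<odot>\<^bsub>V\<^esub> v)"

definition reps :: "(rat, 'a) module \<Rightarrow> ('a \<Rightarrow>\<^sub>0 complex) set"
  where "reps V = {x. keys x \<subseteq> carrier V}"

text \<open>
  Representatives of vectors in the complexification of a subspace.  In this form, stability under
  conjugation and under linear maps is immediate; generators are recovered in \<open>reps_in_eq_span\<close>.
\<close>

definition reps_in :: "(rat, 'a) module \<Rightarrow> 'a set \<Rightarrow> ('a \<Rightarrow>\<^sub>0 complex) set"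
  where "reps_in V N = {x \<in> reps V. \<forall>\<mu>. rlin \<mu> \<longrightarrow> ev V \<mu> x \<in> N}"

lemma reps_subspace: "cvs.subspace (reps V)"
  by (simp add: reps_def keys_subspace)

lemma single_reps [simp]: "v \<in> carrier V \<Longrightarrow> single v c \<in> reps V"
  by (simp add: reps_def)

locale qvs = vs V for V :: "(rat, 'a) module" (structure)
begin

lemma ev_superset:
  assumes "rlin \<mu>" "finite A" "keys x \<subseteq> A" "A \<subseteq> carrier V"
  shows "ev V \<mu> x = (\<Oplus>v\<in>A. \<mu> (lookup x v) \<odot> v)"
  unfolding ev_def
  by (rule add.finprod_mono_neutral_cong_left)
    (use assms in \<open>auto simp: in_keys_iff rlinD(3) subset_iff\<close>)

lemma ev_closed: "x \<in> reps V \<Longrightarrow> ev V \<mu> x \<in> carrier V"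
  unfolding ev_def reps_def by (rule finsum_closed) auto

lemma ev_add:
  assumes "rlin \<mu>" "x \<in> reps V" "y \<in> reps V"
  shows "ev V \<mu> (x + y) = ev V \<mu> x \<oplus> ev V \<mu> y"
proof -
  let ?A = "keys x \<union> keys y"
  have A: "finite ?A" "?A \<subseteq> carrier V" using assms by (auto simp: reps_def)
  have "(\<lambda>v. \<mu> (lookup x v) \<odot> v) \<in> ?A \<rightarrow> carrier V" "(\<lambda>v. \<mu> (lookup y v) \<odot> v) \<in> ?A \<rightarrow> carrier V"
    using A by blast+
  moreover have "ev V \<mu> (x + y) = (\<Oplus>v\<in>?A. \<mu> (lookup x v) \<odot> v \<oplus> \<mu> (lookup y v) \<odot> v)"
    unfolding ev_superset[OF assms(1) A(1) Poly_Mapping.keys_add A(2)] using A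
    by (intro finsum_cong') (auto simp: lookup_add rlinD(1)[OF assms(1)] smult_l_distr subset_iff)
  ultimately show ?thesis
    using ev_superset[OF assms(1) A(1) _ A(2), of x] ev_superset[OF assms(1) A(1) _ A(2), of y]
    by (simp add: finsum_addf)
qed

lemma ev_csc: "rlin \<mu> \<Longrightarrow> x \<in> reps V \<Longrightarrow> ev V \<mu> (csc c x) = ev V (\<lambda>a. \<mu> (c * a)) x"
  using ev_superset[of \<mu> "keys x" "csc c x"] keys_csc[of c x]
  by (simp add: reps_def ev_def)

lemma finsum_smult:
  assumes "finite A" "\<And>i. i \<in> A \<Longrightarrow> g i \<in> carrier V"
  shows "(\<Oplus>i\<in>A. q \<odot> g i) = q \<odot> (\<Oplus>i\<in>A. g i)"
  using assms
proof (induction A rule: finite_induct)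
  case (insert i A)
  then have "g \<in> A \<rightarrow> carrier V" "(\<lambda>i. q \<odot> g i) \<in> A \<rightarrow> carrier V" by auto
  then show ?case using insert by (simp add: smult_r_distr finsum_closed)
qed simp

lemma ev_csc_rat:
  assumes "rlin \<mu>" "x \<in> reps V"
  shows "ev V \<mu> (csc (of_rat q) x) = q \<odot> ev V \<mu> x"
proof -
  have "ev V \<mu> (csc (of_rat q) x) = (\<Oplus>v\<in>keys x. q \<odot> (\<mu> (lookup x v) \<odot> v))"
    unfolding ev_csc[OF assms] unfolding ev_def using assms
    by (intro finsum_cong') (auto simp: rlinD(2) reps_def smult_assoc subset_iff)
  also have "\<dots> = q \<odot> ev V \<mu> x"
    unfolding ev_def using assms by (intro finsum_smult) (auto simp: reps_def)
  finally show ?thesis .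
qed

lemma ev_single:
  assumes "rlin \<mu>" "v \<in> carrier V"
  shows "ev V \<mu> (single v c) = \<mu> c \<odot> v"
  using ev_superset[OF assms(1), of "{v}" "single v c"] assms by (simp add: lookup_single)

lemma ev_zero: "ev V \<mu> 0 = \<zero>"
  by (simp add: ev_def)

lemma reps_in_subspace:
  assumes "subspc V N"
  shows "cvs.subspace (reps_in V N)"
  unfolding cvs.subspace_def reps_in_def
  using subspcD[OF assms] cvs.subspace_0[OF reps_subspace] cvs.subspace_add[OF reps_subspace]
    cvs.subspace_scale[OF reps_subspace]
  by (auto simp: ev_zero ev_add ev_csc rlin_mult)

lemma reps_in_mono: "N \<subseteq> N' \<Longrightarrow> reps_in V N \<subseteq> reps_in V N'"
  by (auto simp: reps_in_def)

lemma reps_in_carrier: "reps_in V (carrier V) = reps V"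
  by (auto simp: reps_in_def ev_closed)

lemma single_reps_in: "subspc V N \<Longrightarrow> v \<in> N \<Longrightarrow> single v c \<in> reps_in V N"
  using subspcD[of N] by (auto simp: reps_in_def ev_single subset_iff)

lemma cx_relations_subspace: "cvs.subspace (cx_relations V)"
  and cx_relations_reps: "cx_relations V \<subseteq> reps V"
proof -
  interpret f: vs "free_space (carrier V) :: (complex, _) module" by (rule free_space_vs)
  have "subspc (free_space (carrier V)) (cx_relations V)"
    unfolding cx_relations_def
  proof (rule f.generated_subspc)
    note sub = cvs.subspace_diff[OF keys_subspace[of "carrier V"], simplified]
    show "{single (x \<oplus> y) 1 - single x 1 - single y 1 |x y. x \<in> carrier V \<and> y \<in> carrier V} \<union>
      {single (q \<odot> x) 1 - single x (of_rat q) |q x. x \<in> carrier V} \<subseteq> carrier (free_space (carrier V) :: (complex, _) module)"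
      by (auto dest!: subsetD[OF sub, rotated -1] simp: split: if_splits)
  qed
  then show "cvs.subspace (cx_relations V)" "cx_relations V \<subseteq> reps V"
    by (auto simp: free_subspc_iff reps_def)
qed

lemma rel_add:
  assumes "x \<in> carrier V" "y \<in> carrier V"
  shows "single (x \<oplus> y) c - single x c - single y c \<in> cx_relations V"
proof -
  have "single (x \<oplus> y) 1 - single x 1 - single y 1 \<in> cx_relations V"
    unfolding cx_relations_def by (rule subsetD[OF vs.generated_incl[OF free_space_vs]]) (use assms in blast)
  then have "csc c (single (x \<oplus> y) 1 - single x 1 - single y 1) \<in> cx_relations V"
    by (rule cvs.subspace_scale[OF cx_relations_subspace])
  then show ?thesis by (simp add: cvs.scale_right_diff_distrib)
qed

lemma rel_smult:
  assumes "x \<in> carrier V"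
  shows "single (q \<odot> x) c - single x (of_rat q * c) \<in> cx_relations V"
proof -
  have "single (q \<odot> x) 1 - single x (of_rat q) \<in> cx_relations V"
    unfolding cx_relations_def by (rule subsetD[OF vs.generated_incl[OF free_space_vs]]) (use assms in blast)
  then have "csc c (single (q \<odot> x) 1 - single x (of_rat q)) \<in> cx_relations V"
    by (rule cvs.subspace_scale[OF cx_relations_subspace])
  then show ?thesis by (simp add: cvs.scale_right_diff_distrib mult.commute)
qed

lemma rel_zero: "single \<zero> c \<in> cx_relations V"
proof -
  have "single (\<zero> \<oplus> \<zero>) (- c) - single \<zero> (- c) - single \<zero> (- c) \<in> cx_relations V"
    by (rule rel_add) auto
  then show ?thesis by (simp add: single_uminus)
qed

text \<open>
  Writing all coefficients in a basis of the complex numbers over the rational numbers turns a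
  representative into \<open>\<Sum> v\<^sub>b \<otimes> b\<close>, where \<open>v\<^sub>b\<close> is its coordinate along \<open>b\<close>.
\<close>

lemma ev_expand:
  assumes "x \<in> reps V"
  obtains B where "finite B" "x - (\<Sum>b\<in>B. single (ev V (coord b) x) b) \<in> cx_relations V"
proof -
  note R = cx_relations_subspace
  define B where "B = (\<Union>v\<in>keys x. {b. coord b (lookup x v) \<noteq> 0})"
  have B: "finite B" by (simp add: B_def coord_finite)
  have "A \<subseteq> keys x \<Longrightarrow> (\<Sum>v\<in>A. single v (lookup x v)) -
      (\<Sum>b\<in>B. single (ev V (coord b) (\<Sum>v\<in>A. single v (lookup x v))) b) \<in> cx_relations V" if "finite A" for A
    using that
  proof (induction A rule: finite_induct)
    case empty
    have "(\<Sum>b\<in>B. single \<zero> b) \<in> cx_relations V"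
      by (intro cvs.subspace_sum[OF R] rel_zero)
    then show ?case using cvs.subspace_neg[OF R] by (simp add: ev_zero)
  next
    case (insert v A)
    let ?y = "\<Sum>v\<in>A. single v (lookup x v)" and ?c = "lookup x v"
    have v: "v \<in> carrier V" using insert assms by (auto simp: reps_def)
    have y: "?y \<in> reps V" using insert assms
      by (intro cvs.subspace_sum[OF reps_subspace]) (auto simp: reps_def)
    have "{b. coord b ?c \<noteq> 0} \<subseteq> B" using insert by (auto simp: B_def)
    then have "single v ?c = (\<Sum>b\<in>B. single v (of_rat (coord b ?c) * b))"
      using coord_sum[OF B] by (simp flip: single_sum)
    moreover have "(\<Sum>b\<in>B. - (single (coord b ?c \<odot> v) b - single v (of_rat (coord b ?c) * b))) \<in> cx_relations V"
      by (intro cvs.subspace_sum[OF R] cvs.subspace_neg[OF R] rel_smult v)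
    ultimately have 1: "single v ?c - (\<Sum>b\<in>B. single (coord b ?c \<odot> v) b) \<in> cx_relations V"
      by (simp add: sum_subtractf)
    have 2: "(\<Sum>b\<in>B. - (single (coord b ?c \<odot> v \<oplus> ev V (coord b) ?y) b - single (coord b ?c \<odot> v) b
        - single (ev V (coord b) ?y) b)) \<in> cx_relations V"
      by (intro cvs.subspace_sum[OF R] cvs.subspace_neg[OF R] rel_add smult_closed v ev_closed y)
    have "ev V (coord b) (single v ?c + ?y) = coord b ?c \<odot> v \<oplus> ev V (coord b) ?y" for b
      by (simp add: ev_add ev_single rlin_coord v y)
    moreover have "(\<Sum>v\<in>insert v A. single v (lookup x v)) = single v ?c + ?y" using insert by simp
    moreover have "?y - (\<Sum>b\<in>B. single (ev V (coord b) ?y) b) \<in> cx_relations V" using insert by simp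
    moreover have "\<And>b. ev V (coord b) (single v ?c + ?y) = coord b ?c \<odot> v \<oplus> ev V (coord b) ?y"
      by (simp add: ev_add ev_single rlin_coord v y)
    ultimately have 3: "?y - (\<Sum>b\<in>B. single (ev V (coord b) ?y) b) \<in> cx_relations V"
      and eq: "(\<Sum>v\<in>insert v A. single v (lookup x v)) = single v ?c + ?y"
       "\<And>b. ev V (coord b) (single v ?c + ?y) = coord b ?c \<odot> v \<oplus> ev V (coord b) ?y" by auto
    show ?case
      unfolding eq using cvs.subspace_add[OF R cvs.subspace_add[OF R 1 2] 3]
      by (simp add: sum_subtractf sum.distrib sum_negf algebra_simps)
  qed
  from this[of "keys x"] poly_expand[of "keys x" x] show ?thesis using that[OF B] by simp
qed

lemma ev_relations:
  assumes "rlin \<mu>" "x \<in> cx_relations V"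
  shows "ev V \<mu> x = \<zero>"
proof -
  have "x \<in> reps_in V {\<zero>}"
  proof (rule subsetD[OF _ assms(2)], unfold cx_relations_def, rule vs.generated_least[OF free_space_vs])
    show "subspc (free_space (carrier V)) (reps_in V {\<zero>})"
      using reps_in_subspace[OF subspc_zero] by (auto simp: free_subspc_iff reps_in_def reps_def)
    have ed: "ev V \<mu> (x - y) = ev V \<mu> x \<ominus> ev V \<mu> y" if "rlin \<mu>" "x \<in> reps V" "y \<in> reps V" for \<mu> x y
      using ev_add[OF that(1), of x "csc (of_rat (- 1)) y"] that
      by (simp only: ev_csc_rat cvs.subspace_scale[OF reps_subspace])
        (simp add: a_minus_def a_inv_eq ev_closed)
    have add_minus_cancel: "(a \<oplus> b) \<ominus> a \<ominus> b = \<zero>" if "a \<in> carrier V" "b \<in> carrier V" for a b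
      using that by (simp add: a_comm[of a b]) (simp add: a_minus_def a_assoc r_neg)
    note rs = cvs.subspace_diff[OF reps_subspace]
    have "ev V \<mu> (single (x \<oplus> y) 1 - single x 1 - single y 1) = \<zero>"
      if "rlin \<mu>" "x \<in> carrier V" "y \<in> carrier V" for \<mu> x y
      using that by (simp add: ed rs ev_single smult_r_distr add_minus_cancel)
    moreover have "ev V \<mu> (single (q \<odot> x) 1 - single x (of_rat q)) = \<zero>"
      if "rlin \<mu>" "x \<in> carrier V" for \<mu> x q
      using that rlinD(2)[OF that(1), of q 1]
      by (simp add: ed rs ev_single flip: smult_assoc) (simp add: a_minus_def r_neg mult.commute)
    ultimately show "{single (x \<oplus> y) 1 - single x 1 - single y 1 |x y. x \<in> carrier V \<and> y \<in> carrier V} \<union>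
      {single (q \<odot> x) 1 - single x (of_rat q) |q x. x \<in> carrier V} \<subseteq> reps_in V {\<zero>}"
      by (auto simp: reps_in_def intro!: rs)
  qed
  then show ?thesis using assms(1) by (simp add: reps_in_def)
qed

text \<open>
  One direction holds as the condition on the functionals is stable under complex scalars and satisfied
  by the defining relations; the other one is the expansion above with all coordinates zero.
\<close>

lemma relations_iff: "cx_relations V = reps_in V {\<zero>}"
proof (intro Set.set_eqI iffI)
  fix x assume "x \<in> cx_relations V"
  then show "x \<in> reps_in V {\<zero>}" using ev_relations cx_relations_reps by (auto simp: reps_in_def)
next
  fix x assume x: "x \<in> reps_in V {\<zero>}"
  then obtain B where "finite B" "x - (\<Sum>b\<in>B. single (ev V (coord b) x) b) \<in> cx_relations V"
    using ev_expand[of x] by (auto simp: reps_in_def)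
  moreover have "(\<Sum>b\<in>B. single (ev V (coord b) x) b) \<in> cx_relations V"
    using x by (intro cvs.subspace_sum[OF cx_relations_subspace]) (auto simp: reps_in_def rlin_coord rel_zero)
  ultimately show "x \<in> cx_relations V"
    using cvs.subspace_add[OF cx_relations_subspace] by fastforce
qed

lemma relations_in: "subspc V N \<Longrightarrow> cx_relations V \<subseteq> reps_in V N"
  unfolding relations_iff by (intro reps_in_mono) (auto dest: subspcD)

lemma reps_in_lift:
  assumes "subspc V N" "x \<in> reps_in V N"
  shows "\<exists>y. keys y \<subseteq> N \<and> x - y \<in> cx_relations V"
proof -
  obtain B where B: "finite B" "x - (\<Sum>b\<in>B. single (ev V (coord b) x) b) \<in> cx_relations V"
    using ev_expand[of x] assms by (auto simp: reps_in_def)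
  have "keys (\<Sum>b\<in>B. single (ev V (coord b) x) b) \<subseteq> N"
    using assms by (intro keys_sum_sub) (auto simp: reps_in_def rlin_coord split: if_splits)
  then show ?thesis using B by blast
qed

lemma reps_in_eq_span:
  assumes N: "subspc V N"
  shows "reps_in V N = cvs.span ({single v c |v c. v \<in> N} \<union> cx_relations V)" (is "_ = cvs.span ?G")
proof
  show "cvs.span ?G \<subseteq> reps_in V N"
    using relations_in[OF N] single_reps_in[OF N]
    by (intro cvs.span_minimal reps_in_subspace[OF N]) auto
  show "reps_in V N \<subseteq> cvs.span ?G"
  proof
    fix x assume "x \<in> reps_in V N"
    then obtain y where y: "keys y \<subseteq> N" "x - y \<in> cx_relations V" using reps_in_lift[OF N] by blast
    have "(\<Sum>v\<in>keys y. single v (lookup y v)) \<in> cvs.span ?G"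
      using y by (intro cvs.span_sum cvs.span_base) auto
    then have "y \<in> cvs.span ?G" using poly_expand[of "keys y" y] by simp
    moreover have "x - y \<in> cvs.span ?G" using y by (intro cvs.span_base) auto
    ultimately show "x \<in> cvs.span ?G" using cvs.span_add by fastforce
  qed
qed

end

section \<open>Multilinear maps and complexification\<close>

lemma listset_iff: "xs \<in> listset As \<longleftrightarrow> length xs = length As \<and> (\<forall>i<length As. xs ! i \<in> As ! i)"
proof (induction As arbitrary: xs)
  case (Cons A As)
  show ?case
    by (cases xs) (auto simp: set_Cons_def Cons.IH nth_Cons less_Suc_eq_0_disj split: nat.splits)
qed simp

text \<open>
  A property of tuples spreads from generators to the sets they generate by replacing one entry after
  the other.  It is used for complex spans, for graphs of operators, and for sums of weight spaces.
\<close>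

lemma slotwise_closure:
  assumes base: "\<And>zs. length zs = n \<Longrightarrow> (\<And>i. i < n \<Longrightarrow> zs ! i \<in> A i) \<Longrightarrow> P zs"
    and step: "\<And>zs j z. length zs = n \<Longrightarrow> j < n \<Longrightarrow> (\<And>i. i < n \<Longrightarrow> i \<noteq> j \<Longrightarrow> zs ! i \<in> B i) \<Longrightarrow>
      (\<And>a. a \<in> A j \<Longrightarrow> P (zs[j := a])) \<Longrightarrow> z \<in> B j \<Longrightarrow> P (zs[j := z])"
    and AB: "\<And>i. i < n \<Longrightarrow> A i \<subseteq> B i"
    and zs: "length zs = n" "\<And>i. i < n \<Longrightarrow> zs ! i \<in> B i"
  shows "P zs"
proof -
  have "k \<le> n \<Longrightarrow> length zs = n \<Longrightarrow> (\<And>i. i < k \<Longrightarrow> zs ! i \<in> B i) \<Longrightarrow>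
    (\<And>i. k \<le> i \<Longrightarrow> i < n \<Longrightarrow> zs ! i \<in> A i) \<Longrightarrow> P zs" for k zs
  proof (induction k arbitrary: zs)
    case 0 then show ?case using base by simp
  next
    case (Suc k)
    have "P (zs[k := zs ! k])"
    proof (rule step)
      show "\<And>i. i < n \<Longrightarrow> i \<noteq> k \<Longrightarrow> zs ! i \<in> B i"
        using Suc.prems AB by (metis not_less_eq not_less linorder_neqE_nat subsetD)
      show "P (zs[k := a])" if "a \<in> A k" for a
        using Suc.prems that by (intro Suc.IH) (auto simp: nth_list_update)
    qed (use Suc.prems in auto)
    then show ?case by simp
  qed
  from this[of n zs] show ?thesis using zs by simp
qed

definition lin_ext :: "('a \<Rightarrow> 'b \<Rightarrow>\<^sub>0 'k::field) \<Rightarrow> ('a \<Rightarrow>\<^sub>0 'k) \<Rightarrow> 'b \<Rightarrow>\<^sub>0 'k"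
  where "lin_ext g x = (\<Sum>v\<in>keys x. csc (lookup x v) (g v))"

lemma lin_ext_superset: "finite A \<Longrightarrow> keys x \<subseteq> A \<Longrightarrow> lin_ext g x = (\<Sum>v\<in>A. csc (lookup x v) (g v))"
  unfolding lin_ext_def by (rule sum.mono_neutral_left) (auto simp: in_keys_iff)

lemma lin_ext_add: "lin_ext g (x + y) = lin_ext g x + lin_ext g y"
proof -
  let ?A = "keys x \<union> keys y"
  have "lin_ext g (x + y) = (\<Sum>v\<in>?A. csc (lookup (x + y) v) (g v))"
    by (intro lin_ext_superset Poly_Mapping.keys_add) simp
  also have "\<dots> = lin_ext g x + lin_ext g y"
    by (simp add: lin_ext_superset[of ?A] lookup_add cvs.scale_left_distrib sum.distrib)
  finally show ?thesis .
qed

lemma lin_ext_csc: "lin_ext g (csc c x) = csc c (lin_ext g x)"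
  using lin_ext_superset[of "keys x" "csc c x" g] keys_csc[of c x]
  by (simp add: lin_ext_def cvs.scale_sum_right)

lemma lin_ext_single: "lin_ext g (single v c) = csc c (g v)"
  using lin_ext_superset[of "{v}" "single v c" g] by (simp add: lookup_single)

lemma lin_ext_zero: "lin_ext g 0 = 0" by (simp add: lin_ext_def)

lemma lin_ext_diff: "lin_ext g (x - y) = lin_ext g x - lin_ext g y"
  using lin_ext_add[of g "x - y" y] by simp

lemma lin_ext_fun_add: "lin_ext (\<lambda>v. g v + h v) x = lin_ext g x + lin_ext h x"
  by (simp add: lin_ext_def cvs.scale_right_distrib sum.distrib)

lemma lin_ext_fun_csc: "lin_ext (\<lambda>v. csc c (g v)) x = csc c (lin_ext g x)"
  by (simp add: lin_ext_def cvs.scale_sum_right mult.commute)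

lemma lin_ext_unique:
  assumes "\<And>x y. h (x + y) = h x + h y" "\<And>v c. h (single v c) = csc c (g v)"
  shows "h x = lin_ext g x"
proof -
  have h0: "h 0 = 0" using assms(1)[of 0 0] by simp
  have "h (sum s A) = (\<Sum>a\<in>A. h (s a))" for s and A :: "'a set"
    by (induction A rule: infinite_finite_induct) (auto simp: assms(1) h0)
  then have "h (\<Sum>v\<in>keys x. single v (lookup x v)) = lin_ext g x" by (simp add: assms(2) lin_ext_def)
  then show ?thesis using poly_expand[of "keys x" x] by simp
qed

text \<open>
  The representative inside \<open>cx_multi\<close>, as a map between free spaces.
\<close>

definition mpush :: "('a list \<Rightarrow> 'b) \<Rightarrow> ('a \<Rightarrow>\<^sub>0 'k::field) list \<Rightarrow> 'b \<Rightarrow>\<^sub>0 'k"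
  where "mpush f xs = (\<Sum>vs\<in>listset (map keys xs).
    single (f vs) (\<Prod>j<length xs. lookup (xs ! j) (vs ! j)))"

definition push :: "('a \<Rightarrow> 'b) \<Rightarrow> ('a \<Rightarrow>\<^sub>0 'k::field) \<Rightarrow> 'b \<Rightarrow>\<^sub>0 'k"
  where "push f x = mpush (\<lambda>vs. f (hd vs)) [x]"

lemma mpush_Nil: "mpush f [] = single (f []) 1"
  by (simp add: mpush_def)

lemma mpush_Cons: "mpush f (x # xs) = lin_ext (\<lambda>v. mpush (\<lambda>vs. f (v # vs)) xs) x"
proof -
  have "mpush f (x # xs) = (\<Sum>(v, vs)\<in>keys x \<times> listset (map keys xs).
      single (f (v # vs)) (lookup x v * (\<Prod>j<length xs. lookup (xs ! j) (vs ! j))))"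
  proof -
    have eq: "listset (map keys (x # xs)) = (\<lambda>(v, vs). v # vs) ` (keys x \<times> listset (map keys xs))"
      by (auto simp: set_Cons_def)
    have inj: "inj_on (\<lambda>(v, vs). v # vs) (keys x \<times> listset (map keys xs))" by (auto simp: inj_on_def)
    show ?thesis unfolding mpush_def eq sum.reindex[OF inj]
      by (intro sum.cong) (auto simp: prod.lessThan_Suc_shift simp del: prod.lessThan_Suc)
  qed
  also have "\<dots> = lin_ext (\<lambda>v. mpush (\<lambda>vs. f (v # vs)) xs) x"
    by (simp add: lin_ext_def mpush_def cvs.scale_sum_right sum.cartesian_product)
  finally show ?thesis .
qed

lemma mpush_slot_add: "j < length xs \<Longrightarrow>
    mpush f (xs[j := x + y]) = mpush f (xs[j := x]) + mpush f (xs[j := y])"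
proof (induction xs arbitrary: f j)
  case (Cons z zs)
  then show ?case by (cases j) (simp_all add: mpush_Cons lin_ext_add lin_ext_fun_add)
qed simp

lemma mpush_slot_csc: "j < length xs \<Longrightarrow> mpush f (xs[j := csc c x]) = csc c (mpush f (xs[j := x]))"
proof (induction xs arbitrary: f j)
  case (Cons z zs)
  then show ?case by (cases j) (simp_all add: mpush_Cons lin_ext_csc lin_ext_fun_csc)
qed simp

lemma mpush_slot_lin_ext: "j < length xs \<Longrightarrow>
    mpush f (xs[j := x]) = lin_ext (\<lambda>v. mpush f (xs[j := single v 1])) x"
proof (rule lin_ext_unique[of "\<lambda>x. mpush f (xs[j := x])"])
  show "j < length xs \<Longrightarrow> mpush f (xs[j := single v c]) = csc c (mpush f (xs[j := single v 1]))" for v c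
    using mpush_slot_csc[of j xs f c "single v 1"] by simp
qed (simp add: mpush_slot_add)

lemma mpush_singles:
  "mpush f (map (\<lambda>(v, c). single v c) ps) = single (f (map fst ps)) (prod_list (map snd ps))"
  by (induction ps arbitrary: f) (auto simp: mpush_Nil mpush_Cons lin_ext_single)

lemma push_eq: "push f x = lin_ext (\<lambda>v. single (f v) 1) x"
  by (simp add: push_def mpush_Cons mpush_Nil)

lemma push_sum: "push f x = (\<Sum>v\<in>keys x. single (f v) (lookup x v))"
  by (simp add: push_eq lin_ext_def)

lemma push_id: "push (\<lambda>x. x) x = x"
  using poly_expand[of "keys x" x] by (simp add: push_sum)

lemmas push_add = lin_ext_add[of "\<lambda>v. single (f v) 1" for f, folded push_eq]
lemmas push_diff = lin_ext_diff[of "\<lambda>v. single (f v) 1" for f, folded push_eq]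

text \<open>
  With pure tensors in all slots but one, only a linear map in the remaining slot is left.
\<close>

lemma mpush_singles_slot:
  assumes "j < length ps"
  shows "mpush f ((map (\<lambda>(v, c). single v c) ps)[j := x]) =
    csc (prod_list (map snd (ps[j := (u, 1)]))) (push (\<lambda>v. f ((map fst ps)[j := v])) x)"
proof -
  have "mpush f ((map (\<lambda>(v, c). single v c) ps)[j := single v 1]) =
      csc (prod_list (map snd (ps[j := (u, 1)]))) (single (f ((map fst ps)[j := v])) 1)" for v
    using mpush_singles[of f "ps[j := (v, 1)]"] assms by (simp add: map_update)
  note eq = this
  show ?thesis
    using mpush_slot_lin_ext[of j "map (\<lambda>(v, c). single v c) ps" f x] assms
    by (simp only: length_map eq) (simp add: push_eq flip: lin_ext_fun_csc)
qed

definition cj :: "('a \<Rightarrow>\<^sub>0 complex) \<Rightarrow> 'a \<Rightarrow>\<^sub>0 complex"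
  where "cj = Poly_Mapping.map cnj"

lemma lookup_cj [simp]: "lookup (cj x) v = cnj (lookup x v)"
  by (simp add: cj_def lookup_map0)

lemma keys_cj [simp]: "keys (cj x) = keys x"
  by (auto simp: in_keys_iff)

lemma cj_add: "cj (x + y) = cj x + cj y" and cj_diff: "cj (x - y) = cj x - cj y"
  and cj_csc: "cj (csc c x) = csc (cnj c) (cj x)" and cj_cj [simp]: "cj (cj x) = x"
  and cj_single [simp]: "cj (single v c) = single v (cnj c)" and cj_zero [simp]: "cj 0 = 0"
  by (auto intro!: poly_mapping_eqI simp: lookup_add lookup_minus lookup_single "when_def")

lemma cj_sum: "cj (sum g A) = (\<Sum>a\<in>A. cj (g a))"
  by (induction A rule: infinite_finite_induct) (auto simp: cj_add)

lemma mpush_cj: "mpush f (map cj xs) = cj (mpush f xs)"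
proof -
  have "keys \<circ> cj = (keys :: ('a \<Rightarrow>\<^sub>0 complex) \<Rightarrow> _)" by (simp add: fun_eq_iff)
  then have "map keys (map cj xs) = map keys xs" by simp
  then show ?thesis unfolding mpush_def cj_sum by (intro sum.cong) (simp_all only:, auto)
qed

lemma push_cj: "push f (cj x) = cj (push f x)"
  using mpush_cj[of "\<lambda>vs. f (hd vs)" "[x]"] by (simp add: push_def)

lemma ev_cj: "ev V \<mu> (cj x) = ev V (\<lambda>a. \<mu> (cnj a)) x"
  by (simp add: ev_def)

lemma reps_in_cj: "cj x \<in> reps_in V N \<longleftrightarrow> x \<in> reps_in V N"
proof -
  have "cj x \<in> reps_in V N" if "x \<in> reps_in V N" for x
    using that by (auto simp: reps_in_def ev_cj rlin_cnj reps_def)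
  from this[of x] this[of "cj x"] show ?thesis by auto
qed

lemma cj_subspace:
  assumes "cvs.subspace N"
  shows "cvs.subspace (cj ` N)"
  unfolding cvs.subspace_def
proof (safe, goal_cases)
  case 1 then show ?case using cvs.subspace_0[OF assms] by (intro image_eqI[of _ _ 0]) auto
next
  case (2 _ _ x y)
  then show ?case using cvs.subspace_add[OF assms] by (auto simp flip: cj_add)
next
  case (3 c _ x)
  then show ?case using cvs.subspace_scale[OF assms, of x "cnj c"]
    by (intro image_eqI[of _ _ "csc (cnj c) x"]) (auto simp: cj_csc)
qed

lemma (in qvs) ev_sum:
  assumes "rlin \<mu>" "finite A" "\<And>i. i \<in> A \<Longrightarrow> g i \<in> reps V"
  shows "ev V \<mu> (\<Sum>i\<in>A. g i) = (\<Oplus>i\<in>A. ev V \<mu> (g i))"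
  using assms(2,3)
proof (induction A rule: finite_induct)
  case (insert i A)
  have "sum g A \<in> reps V" using insert by (intro cvs.subspace_sum[OF reps_subspace]) auto
  moreover have "(\<lambda>i. ev V \<mu> (g i)) \<in> A \<rightarrow> carrier V" using insert ev_closed by auto
  ultimately show ?case using insert by (simp add: ev_add assms(1) ev_closed)
qed (simp add: ev_zero)

lemma push_reps:
  assumes "\<And>v. v \<in> carrier V \<Longrightarrow> g v \<in> carrier V'" "x \<in> reps V"
  shows "push g x \<in> reps V'"
  unfolding push_sum using assms
  by (intro cvs.subspace_sum[OF reps_subspace] single_reps) (auto simp: reps_def)

lemma ev_push:
  assumes "vs V" "vs V'" "lin V V' g" "rlin \<mu>" "x \<in> reps V"
  shows "ev V' \<mu> (push g x) = g (ev V \<mu> x)"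
proof -
  interpret V: qvs V using assms(1) by (simp add: qvs_def)
  interpret V': qvs V' using assms(2) by (simp add: qvs_def)
  interpret lin_map V V' g using assms by (intro lin_mapI)
  have k: "v \<in> carrier V" if "v \<in> keys x" for v using that assms(5) by (auto simp: reps_def)
  have "ev V' \<mu> (push g x) = (\<Oplus>\<^bsub>V'\<^esub>v\<in>keys x. ev V' \<mu> (single (g v) (lookup x v)))"
    unfolding push_sum by (rule V'.ev_sum) (use k assms in auto)
  also have "\<dots> = (\<Oplus>\<^bsub>V'\<^esub>v\<in>keys x. g (\<mu> (lookup x v) \<odot>\<^bsub>V\<^esub> v))"
    using k assms(4) by (intro V'.finsum_cong') (auto simp: V'.ev_single smult)
  also have "\<dots> = g (ev V \<mu> x)"
    unfolding ev_def using k by (subst finsum) auto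
  finally show ?thesis .
qed

lemma push_reps_in:
  assumes "vs V" "vs V'" "lin V V' g" "x \<in> reps_in V N" "g ` N \<subseteq> N'"
  shows "push g x \<in> reps_in V' N'"
proof -
  have "\<And>v. v \<in> carrier V \<Longrightarrow> g v \<in> carrier V'" using assms(3) by (auto simp: lin_def)
  then show ?thesis
    using assms push_reps[of V g V' x] by (auto simp: reps_in_def ev_push)
qed

lemma push_relations:
  assumes "vs V" "vs V'" "lin V V' g" "x \<in> cx_relations V"
  shows "push g x \<in> cx_relations V'"
proof -
  interpret V: qvs V using assms(1) by (simp add: qvs_def)
  interpret V': qvs V' using assms(2) by (simp add: qvs_def)
  interpret lin_map V V' g using assms by (intro lin_mapI)
  show ?thesis using push_reps_in[OF assms(1-3)] assms(4)
    unfolding V.relations_iff V'.relations_iff by auto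
qed

locale multilin_map =
  fixes Vs :: "(rat, 'a) module list" and V :: "(rat, 'b) module" and f :: "'a list \<Rightarrow> 'b"
  assumes vss: "\<And>i. i < length Vs \<Longrightarrow> vs (Vs ! i)" and target: "vs V" and multilin: "multilin Vs V f"
begin

sublocale T: qvs V using target by (simp add: qvs_def)

definition ok :: "'a list \<Rightarrow> bool"
  where "ok xs \<longleftrightarrow> length xs = length Vs \<and> (\<forall>i<length Vs. xs ! i \<in> carrier (Vs ! i))"

lemma ok_iff: "ok xs \<longleftrightarrow> xs \<in> listset (map carrier Vs)"
  by (auto simp: ok_def listset_iff)

lemma ok_update: "ok xs \<Longrightarrow> j < length Vs \<Longrightarrow> x \<in> carrier (Vs ! j) \<Longrightarrow> ok (xs[j := x])"
  by (auto simp: ok_def nth_list_update)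

lemma closed: "ok xs \<Longrightarrow> f xs \<in> carrier V"
  using multilin by (auto simp: multilin_def ok_iff)

lemma slot_lin: "ok xs \<Longrightarrow> j < length Vs \<Longrightarrow> lin (Vs ! j) V (\<lambda>x. f (xs[j := x]))"
  using multilin by (auto simp: multilin_def ok_iff)

lemma slot_subspace: "j < length zs \<Longrightarrow> cvs.subspace N \<Longrightarrow> cvs.subspace {z. mpush f (zs[j := z]) \<in> N}"
  unfolding cvs.subspace_def
  using mpush_slot_csc[of j zs f 0] by (auto simp: mpush_slot_add mpush_slot_csc)

lemma reps_span: "reps U = cvs.span {single v c |v c. v \<in> carrier U}"
proof
  show "cvs.span {single v c |v c. v \<in> carrier U} \<subseteq> reps U"
    by (intro cvs.span_minimal reps_subspace) auto
  show "reps U \<subseteq> cvs.span {single v c |v c. v \<in> carrier U}"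
  proof
    fix x assume x: "x \<in> reps U"
    have "(\<Sum>v\<in>keys x. single v (lookup x v)) \<in> cvs.span {single v c |v c. v \<in> carrier U}"
      by (intro cvs.span_sum cvs.span_base) (use x in \<open>auto simp: reps_def\<close>)
    then show "x \<in> cvs.span {single v c |v c. v \<in> carrier U}"
      using poly_expand[of "keys x" x] by simp
  qed
qed

lemma singles_list:
  assumes "\<And>i. i < length zs \<Longrightarrow> \<exists>v c. zs ! i = single v c \<and> Q i v"
  shows "\<exists>ps. length ps = length zs \<and> zs = map (\<lambda>(v, c). single v c) ps \<and> (\<forall>i<length zs. Q i (fst (ps ! i)))"
proof -
  obtain v c where vc: "\<And>i. i < length zs \<Longrightarrow> zs ! i = single (v i) (c i) \<and> Q i (v i)"
    using assms by metis
  show ?thesis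
    by (rule exI[of _ "map (\<lambda>i. (v i, c i)) [0..<length zs]"])
      (auto simp: vc intro!: nth_equalityI)
qed

text \<open>
  The complex multilinear extension is well defined.  Reduction to pure tensors in the slots other than
  \<open>k\<close> leaves the case of a linear map.
\<close>

lemma mpush_relations:
  assumes len: "length zs = length Vs" and reps: "\<And>i. i < length Vs \<Longrightarrow> zs ! i \<in> reps (Vs ! i)"
    and k: "k < length Vs" "zs ! k \<in> cx_relations (Vs ! k)"
  shows "mpush f zs \<in> cx_relations V"
proof (rule slotwise_closure[where n = "length Vs"
    and A = "\<lambda>i. if i = k then cx_relations (Vs ! k) else {single v c |v c. v \<in> carrier (Vs ! i)}"
    and B = "\<lambda>i. if i = k then cx_relations (Vs ! k) else reps (Vs ! i)"])
  fix zs assume zs: "length zs = length Vs"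
    "\<And>i. i < length Vs \<Longrightarrow> zs ! i \<in> (if i = k then cx_relations (Vs ! k) else {single v c |v c. v \<in> carrier (Vs ! i)})"
  let ?zs = "zs[k := single \<zero>\<^bsub>Vs ! k\<^esub> 1]"
  have z0: "\<zero>\<^bsub>Vs ! k\<^esub> \<in> carrier (Vs ! k)"
    using vs.subspc_zero[OF vss[OF k(1)]] vs.subspcD(1)[OF vss[OF k(1)]] by blast
  have "\<exists>v c. ?zs ! i = single v c \<and> v \<in> carrier (Vs ! i)" if "i < length ?zs" for i
    using zs(2)[of i] that z0 zs(1) by (cases "i = k") auto
  then obtain ps where ps: "length ps = length ?zs" "?zs = map (\<lambda>(v, c). single v c) ps"
    "\<forall>i<length ?zs. fst (ps ! i) \<in> carrier (Vs ! i)"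
    using singles_list[of ?zs "\<lambda>i v. v \<in> carrier (Vs ! i)"] by blast
  have "length ps = length Vs" using ps(1) zs(1) by simp
  then have okps: "ok (map fst ps)" using ps(1,3) by (auto simp: ok_def)
  have "mpush f (?zs[k := zs ! k]) = csc (prod_list (map snd (ps[k := (undefined, 1)])))
      (push (\<lambda>v. f ((map fst ps)[k := v])) (zs ! k))"
    by (subst ps(2), rule mpush_singles_slot) (use k \<open>length ps = length Vs\<close> in simp)
  then have "mpush f zs = csc (prod_list (map snd (ps[k := (undefined, 1)])))
      (push (\<lambda>v. f ((map fst ps)[k := v])) (zs ! k))"
    by simp
  moreover have "push (\<lambda>v. f ((map fst ps)[k := v])) (zs ! k) \<in> cx_relations V"
    using zs(2)[OF k(1)] by (intro push_relations[OF vss target slot_lin[OF okps]] k(1)) auto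
  ultimately show "mpush f zs \<in> cx_relations V"
    using cvs.subspace_scale[OF T.cx_relations_subspace] by simp
next
  fix zs j z assume h: "length zs = length Vs" "j < length Vs"
    "\<And>a. a \<in> (if j = k then cx_relations (Vs ! k) else {single v c |v c. v \<in> carrier (Vs ! j)}) \<Longrightarrow>
      mpush f (zs[j := a]) \<in> cx_relations V"
    "z \<in> (if j = k then cx_relations (Vs ! k) else reps (Vs ! j))"
  show "mpush f (zs[j := z]) \<in> cx_relations V"
  proof (cases "j = k")
    case False
    then have "z \<in> cvs.span {single v c |v c. v \<in> carrier (Vs ! j)}" using h(4) by (simp add: reps_span)
    moreover have "cvs.span {single v c |v c. v \<in> carrier (Vs ! j)} \<subseteq> {z. mpush f (zs[j := z]) \<in> cx_relations V}"
      using h(1-3) False by (intro cvs.span_minimal slot_subspace T.cx_relations_subspace) auto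
    ultimately show ?thesis by blast
  qed (use h in auto)
qed (use len reps k in auto)

lemma mpush_reps_in:
  assumes len: "length zs = length Vs" and N: "\<And>i. i < length Vs \<Longrightarrow> subspc (Vs ! i) (N i)"
    and zs: "\<And>i. i < length Vs \<Longrightarrow> zs ! i \<in> reps_in (Vs ! i) (N i)"
    and N': "subspc V N'" and f: "\<And>xs. length xs = length Vs \<Longrightarrow> (\<And>i. i < length Vs \<Longrightarrow> xs ! i \<in> N i) \<Longrightarrow> f xs \<in> N'"
  shows "mpush f zs \<in> reps_in V N'"
proof (rule slotwise_closure[where n = "length Vs"
    and A = "\<lambda>i. {single v c |v c. v \<in> N i} \<union> cx_relations (Vs ! i)" and B = "\<lambda>i. reps_in (Vs ! i) (N i)"])
  have span: "reps_in (Vs ! i) (N i) = cvs.span ({single v c |v c. v \<in> N i} \<union> cx_relations (Vs ! i))"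
    if "i < length Vs" for i
    using qvs.reps_in_eq_span[of "Vs ! i"] that vss N by (simp add: qvs_def)
  show AB: "{single v c |v c. v \<in> N i} \<union> cx_relations (Vs ! i) \<subseteq> reps_in (Vs ! i) (N i)"
    if "i < length Vs" for i
    unfolding span[OF that] by (rule cvs.span_superset)
  fix zs assume h: "length zs = length Vs"
    "\<And>i. i < length Vs \<Longrightarrow> zs ! i \<in> {single v c |v c. v \<in> N i} \<union> cx_relations (Vs ! i)"
  show "mpush f zs \<in> reps_in V N'"
  proof (cases "\<exists>k<length Vs. zs ! k \<in> cx_relations (Vs ! k)")
    case True
    then obtain k where k: "k < length Vs" "zs ! k \<in> cx_relations (Vs ! k)" by blast
    have "zs ! i \<in> reps (Vs ! i)" if "i < length Vs" for i
      using AB[OF that] h(2)[OF that] by (auto simp: reps_in_def)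
    then have "mpush f zs \<in> cx_relations V" using mpush_relations[OF h(1) _ k] by blast
    then show ?thesis using T.relations_in[OF N'] by blast
  next
    case False
    then have "\<exists>v c. zs ! i = single v c \<and> v \<in> N i" if "i < length zs" for i
    proof -
      have "zs ! i \<notin> cx_relations (Vs ! i)" "zs ! i \<in> {single v c |v c. v \<in> N i} \<union> cx_relations (Vs ! i)"
        using False h(1) h(2)[of i] that by auto
      then show ?thesis by blast
    qed
    then obtain ps where ps: "length ps = length zs" "zs = map (\<lambda>(v, c). single v c) ps"
      "\<forall>i<length zs. fst (ps ! i) \<in> N i"
      using singles_list[of zs "\<lambda>i v. v \<in> N i"] by blast
    have "f (map fst ps) \<in> N'" using ps h(1) by (intro f) auto
    then show ?thesis unfolding ps(2) mpush_singles by (rule T.single_reps_in[OF N'])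
  qed
next
  fix zs j z assume h: "length zs = length Vs" "j < length Vs"
    "\<And>a. a \<in> {single v c |v c. v \<in> N j} \<union> cx_relations (Vs ! j) \<Longrightarrow> mpush f (zs[j := a]) \<in> reps_in V N'"
    "z \<in> reps_in (Vs ! j) (N j)"
  have "z \<in> cvs.span ({single v c |v c. v \<in> N j} \<union> cx_relations (Vs ! j))"
    using h(4) qvs.reps_in_eq_span[of "Vs ! j"] h(2) vss N by (simp add: qvs_def)
  moreover have "cvs.span ({single v c |v c. v \<in> N j} \<union> cx_relations (Vs ! j)) \<subseteq> {z. mpush f (zs[j := z]) \<in> reps_in V N'}"
    using h(1-3) by (intro cvs.span_minimal slot_subspace T.reps_in_subspace N') auto
  ultimately show "mpush f (zs[j := z]) \<in> reps_in V N'" by blast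
qed (use len zs in auto)

end

section \<open>Deligne's splitting\<close>

text \<open>
  All subspaces consist of representatives, and \<open>R\<close> stands for zero.  The last two assumptions say that
  the graded piece of weight \<open>k\<close> is the direct sum of the images of \<open>F p\<close> and \<open>G q\<close> whenever
  \<open>p + q = k + 1\<close>; here \<open>G\<close> is going to be the conjugate of \<open>F\<close>.
\<close>

locale opposed_filtrations = vector_space scale
  for scale :: "'k::field \<Rightarrow> 'u::ab_group_add \<Rightarrow> 'u" (infixr "*s" 75) +
  fixes R :: "'u set" and W F G :: "int \<Rightarrow> 'u set"
  assumes sub: "subspace R" "subspace (W k)" "subspace (F p)" "subspace (G q)"
    and R_sub: "R \<subseteq> W k" "R \<subseteq> F p" "R \<subseteq> G q"
    and W_mono: "j \<le> k \<Longrightarrow> W j \<subseteq> W k"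
    and F_anti: "p \<le> q \<Longrightarrow> F q \<subseteq> F p"
    and G_anti: "p \<le> q \<Longrightarrow> G q \<subseteq> G p"
    and W_bot: "\<exists>k. W k = R"
    and F_bot: "\<exists>p. F p = R"
    and F_top: "\<exists>p. \<forall>k. W k \<subseteq> F p"
    and split: "p + q = k + 1 \<Longrightarrow> x \<in> W k \<Longrightarrow>
      \<exists>f\<in>F p \<inter> W k. \<exists>g\<in>G q \<inter> W k. x - f - g \<in> W (k - 1)"
    and inter: "p + q = k + 1 \<Longrightarrow> f \<in> F p \<inter> W k \<Longrightarrow> g \<in> G q \<inter> W k \<Longrightarrow> f - g \<in> W (k - 1) \<Longrightarrow>
      f \<in> W (k - 1)"
begin

text \<open>
  Deligne's correction term: \<open>bigr p q\<close> is his \<open>I\<^bsup>p,q\<^esup>\<close>.  A lift of a vector of type \<open>(p, q)\<close> to \<open>F p\<close> can in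
  general not be chosen in \<open>G q\<close>, and the error of weight \<open>k - j - 1\<close> is allowed to lie in \<open>G (q - j)\<close>.
\<close>

definition corr_gens :: "int \<Rightarrow> int \<Rightarrow> 'u set"
  where "corr_gens q k = (G q \<inter> W k) \<union> (\<Union>j\<in>{1..}. G (q - j) \<inter> W (k - j - 1))"

definition corr :: "int \<Rightarrow> int \<Rightarrow> 'u set"
  where "corr q k = span (corr_gens q k)"

definition bigr :: "int \<Rightarrow> int \<Rightarrow> 'u set"
  where "bigr p q = F p \<inter> W (p + q) \<inter> corr q (p + q)"

lemma corr_sub: "subspace (corr q k)"
  by (simp add: corr_def)

lemma bigr_sub: "subspace (bigr p q)"
  by (simp add: bigr_def sub corr_sub subspace_inter)

lemma R_bigr: "R \<subseteq> bigr p q"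
proof
  fix x assume "x \<in> R"
  then have "x \<in> F p" "x \<in> W (p + q)" "x \<in> G q" using R_sub by blast+
  then show "x \<in> bigr p q" by (simp add: bigr_def corr_def corr_gens_def span_base)
qed

lemmas subI = subspace_add subspace_diff subspace_0 subspace_neg subspace_scale

lemma corr_approx:
  assumes "x \<in> corr q k" "i \<ge> 1"
  shows "\<exists>g\<in>G (q - i + 1) \<inter> W k. x - g \<in> W (k - i - 1)"
  using assms(1) unfolding corr_def
proof (induction rule: span_induct)
  case base
  show ?case unfolding subspace_def
  proof (safe, goal_cases)
    case 1 then show ?case using sub subI(3) by (intro bexI[of _ 0]) auto
  next
    case (2 x y g h)
    then show ?case using sub subI(1) by (intro bexI[of _ "g + h"]) (auto simp: add_diff_add)
  next
    case (3 c x g)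
    then show ?case using sub subI(5) by (intro bexI[of _ "c *s g"]) (auto simp flip: scale_right_diff_distrib)
  qed
next
  case (step x)
  have gx: ?case if "x \<in> G (q - i + 1) \<inter> W k"
    using that sub(2) subI(3) by (intro bexI[of _ x]) auto
  from step consider "x \<in> G q \<inter> W k" | j where "j \<ge> 1" "x \<in> G (q - j) \<inter> W (k - j - 1)"
    by (auto simp: corr_gens_def)
  then show ?case
  proof cases
    case 1 then show ?thesis using gx G_anti[of "q - i + 1" q] assms(2) by auto
  next
    case 2
    show ?thesis
    proof (cases "j \<le> i - 1")
      case True
      then show ?thesis using gx G_anti[of "q - i + 1" "q - j"] W_mono[of "k - j - 1" k] 2 by auto
    next
      case False
      then have "x \<in> W (k - i - 1)" using W_mono[of "k - j - 1" "k - i - 1"] 2 by auto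
      then show ?thesis using sub subI(3) by (intro bexI[of _ 0]) auto
    qed
  qed
qed

text \<open>
  A vector of \<open>bigr p q\<close> and of weight \<open>p + q - i\<close> agrees, up to weight \<open>p + q - i - 1\<close>, with a vector of
  \<open>G (q - i + 1)\<close>.  As \<open>p + (q - i + 1) = (p + q - i) + 1\<close>, opposedness in weight \<open>p + q - i\<close> makes its
  weight drop, again and again.
\<close>

lemma bigr_inter_W:
  assumes x: "x \<in> bigr p q" and xW: "x \<in> W (p + q - 1)"
  shows "x \<in> R"
proof -
  let ?k = "p + q"
  have down: "x \<in> W (?k - 1 - int n)" for n
  proof (induction n)
    case 0 then show ?case using xW by simp
  next
    case (Suc n)
    define i where "i = int n + 1"
    have xi: "x \<in> W (?k - i)" using Suc by (simp add: i_def algebra_simps)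
    have "x \<in> corr q ?k" "x \<in> F p" using x by (auto simp: bigr_def)
    then obtain g where g: "g \<in> G (q - i + 1) \<inter> W ?k" "x - g \<in> W (?k - i - 1)"
      using corr_approx[of x q ?k i] by (auto simp: i_def)
    have "x - (x - g) \<in> W (?k - i)"
      using xi g W_mono[of "?k - i - 1" "?k - i"] by - (rule subI(2)[OF sub(2)]; auto)
    then have "g \<in> W (?k - i)" by simp
    then have "x \<in> W (?k - i - 1)"
      using inter[of p "q - i + 1" "?k - i" x g] g xi \<open>x \<in> F p\<close> by auto
    then show ?case by (simp add: i_def algebra_simps)
  qed
  obtain k0 where "W k0 = R" using W_bot by blast
  moreover have "?k - 1 - int (nat (?k - 1 - k0)) \<le> k0" by linarith
  ultimately show ?thesis using down[of "nat (?k - 1 - k0)"] W_mono by blast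
qed

text \<open>
  The error of the lift is pushed down one weight at a time: in weight \<open>k - 1 - n\<close> it splits into a part
  in \<open>F p\<close>, which is subtracted from the lift, and a part in \<open>G (q - n)\<close>, which the correction term absorbs.
\<close>

lemma bigr_lift:
  assumes k: "p + q = k" and f0: "f0 \<in> F p \<inter> W k" and g0: "g0 \<in> G q \<inter> W k"
    and fg: "f0 - g0 \<in> W (k - 1)"
  shows "\<exists>f\<in>bigr p q. f - f0 \<in> W (k - 1)"
proof -
  (* After n steps f is the current lift and w the error that is still to be absorbed. *)
  have "\<exists>f w. f \<in> F p \<inter> W k \<and> f - f0 \<in> W (k - 1) \<and> w \<in> W (k - 1 - int n) \<and> f - w \<in> corr q k" for n
  proof (induction n)
    case 0
    have "g0 \<in> corr q k" using g0 by (auto simp: corr_def corr_gens_def intro!: span_base)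
    then show ?case using f0 fg subI(3)[OF sub(2)] by (intro exI[of _ f0] exI[of _ "f0 - g0"]) auto
  next
    case (Suc n)
    let ?m = "k - 1 - int n"
    from Suc obtain f w where f: "f \<in> F p \<inter> W k" "f - f0 \<in> W (k - 1)" and w: "w \<in> W ?m"
      and fw: "f - w \<in> corr q k" by blast
    obtain f1 g1 where f1: "f1 \<in> F p \<inter> W ?m" and g1: "g1 \<in> G (q - int n) \<inter> W ?m"
      and w': "w - f1 - g1 \<in> W (?m - 1)"
      using split[of p "q - int n" ?m w] k w by (auto simp: algebra_simps)
    have m: "W ?m \<subseteq> W (k - 1)" "W ?m \<subseteq> W k" by (rule W_mono, simp)+
    have "g1 \<in> corr_gens q k"
    proof (cases "n = 0")
      case True then show ?thesis using g1 m by (auto simp: corr_gens_def)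
    next
      case False
      then have "int n \<in> {1..}" by simp
      moreover have "g1 \<in> G (q - int n) \<inter> W (k - int n - 1)" using g1 by (simp add: algebra_simps)
      ultimately show ?thesis unfolding corr_gens_def by blast
    qed
    then have "g1 \<in> corr q k" by (simp add: corr_def span_base)
    then have "(f - w) + g1 \<in> corr q k" using fw subI(1)[OF corr_sub] by blast
    moreover have "(f - w) + g1 = (f - f1) - (w - f1 - g1)" by simp
    ultimately have *: "(f - f1) - (w - f1 - g1) \<in> corr q k" by simp
    have "f - f1 \<in> F p \<inter> W k" using f f1 m by (auto intro: subI(2)[OF sub(3)] subI(2)[OF sub(2)])
    moreover have "(f - f0) - f1 \<in> W (k - 1)" using f f1 m by (auto intro: subI(2)[OF sub(2)])
    then have "(f - f1) - f0 \<in> W (k - 1)" by (simp add: algebra_simps)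
    ultimately show ?case using w' * by (intro exI[of _ "f - f1"] exI[of _ "w - f1 - g1"])
        (auto simp: algebra_simps)
  qed note * = this
  obtain k0 where k0: "W k0 = R" using W_bot by blast
  from *[of "nat (k - 1 - k0)"] obtain f w where f: "f \<in> F p \<inter> W k" "f - f0 \<in> W (k - 1)"
    and w: "w \<in> W (k - 1 - int (nat (k - 1 - k0)))" and fw: "f - w \<in> corr q k" by blast
  have "k - 1 - int (nat (k - 1 - k0)) \<le> k0" by linarith
  then have "w \<in> R" using w k0 W_mono by blast
  then have "w \<in> corr q k" using R_bigr k by (auto simp: bigr_def)
  then have "(f - w) + w \<in> corr q k" using fw subI(1)[OF corr_sub] by blast
  then show ?thesis using f k by (auto simp: bigr_def)
qed

text \<open>
  One step of the Hodge decomposition of the graded piece of weight \<open>k\<close>: opposedness splits off a vector of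
  \<open>F (p + 1)\<close> and leaves one of \<open>G (k - p)\<close>, which lies in \<open>F p\<close> as well, as the difference from \<open>x\<close>.
\<close>

lemma F_decomp:
  assumes "x \<in> F p \<inter> W k"
  shows "\<exists>f\<in>bigr p (k - p). \<exists>x'\<in>F (p + 1) \<inter> W k. x - f - x' \<in> W (k - 1)"
proof -
  obtain a b where a: "a \<in> F (p + 1) \<inter> W k" and b: "b \<in> G (k - p) \<inter> W k" and ab: "x - a - b \<in> W (k - 1)"
    using split[of "p + 1" "k - p" k x] assms by auto
  have "x - a \<in> F p \<inter> W k"
    using assms a F_anti[of p "p + 1"] by (auto intro: subI(2)[OF sub(3)] subI(2)[OF sub(2)])
  then obtain f where f: "f \<in> bigr p (k - p)" "f - (x - a) \<in> W (k - 1)"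
    using bigr_lift[of p "k - p" k "x - a" b] b ab by auto
  have "- (f - (x - a)) \<in> W (k - 1)" using f(2) subI(4)[OF sub(2)] by blast
  then have "x - f - a \<in> W (k - 1)" by (simp add: algebra_simps)
  then show ?thesis using f a by blast
qed

text \<open>
  The graph of multiplication by \<open>p + q\<close> on \<open>bigr p q\<close>, where \<open>p + q\<close> is at most \<open>m\<close>.  As a relation the
  operator is available before the sum of these subspaces is known to be direct, and its compatibility
  with products needs to be checked on generators only.
\<close>

inductive_set graph :: "int \<Rightarrow> ('u \<times> 'u) set" for m where
  base: "x \<in> bigr p q \<Longrightarrow> p + q \<le> m \<Longrightarrow> (x, of_int (p + q) *s x) \<in> graph m"
| add: "(x, y) \<in> graph m \<Longrightarrow> (x', y') \<in> graph m \<Longrightarrow> (x + x', y + y') \<in> graph m"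

lemma graph_mono: "(x, y) \<in> graph m \<Longrightarrow> m \<le> m' \<Longrightarrow> (x, y) \<in> graph m'"
proof (induction rule: graph.induct)
  case (base x p q)
  then show ?case by (intro graph.base) auto
qed (auto intro: graph.add)

lemma graph_scale: "(x, y) \<in> graph m \<Longrightarrow> (c *s x, c *s y) \<in> graph m"
proof (induction rule: graph.induct)
  case (base x p q)
  then have "(c *s x, of_int (p + q) *s c *s x) \<in> graph m"
    by (intro graph.base subI(5)[OF bigr_sub])
  then show ?case by (simp add: mult.commute)
qed (auto simp: scale_right_distrib intro: graph.add)

lemma graph_diff: "(x, y) \<in> graph m \<Longrightarrow> (x', y') \<in> graph m \<Longrightarrow> (x - x', y - y') \<in> graph m"
  using graph.add[of x y m "- 1 *s x'" "- 1 *s y'"] graph_scale[of x' y' m "- 1"] by simp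

lemma graph_R: "r \<in> R \<Longrightarrow> (r, of_int m *s r) \<in> graph m"
  using graph.base[of r m 0 m] R_bigr by auto

text \<open>
  A representative of zero has every weight, in particular both \<open>m\<close> and \<open>m - 1\<close>.
\<close>

lemma graph_zero_R:
  assumes "r \<in> R"
  shows "(0, r) \<in> graph m"
proof -
  have "(r - r, of_int m *s r - of_int (m - 1) *s r) \<in> graph m"
    using graph_R[OF assms] graph_mono[OF graph_R[OF assms, of "m - 1"]] by (intro graph_diff) auto
  then show ?thesis by (simp flip: scale_left_diff_distrib)
qed

lemma graph_W: "(x, y) \<in> graph m \<Longrightarrow> x \<in> W m \<and> y - of_int m *s x \<in> W (m - 1)"
proof (induction rule: graph.induct)
  case (base x p q)
  then have x: "x \<in> W (p + q)" by (simp add: bigr_def)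
  have "of_int (p + q) *s x - of_int m *s x = of_int (p + q - m) *s x"
    by (simp add: scale_left_diff_distrib)
  moreover have "of_int (p + q - m) *s x \<in> W (m - 1)"
  proof (cases "p + q = m")
    case True
    then have "of_int (p + q - m) *s x = 0" by (metis diff_self of_int_0 scale_zero_left)
    then show ?thesis using subI(3)[OF sub(2)] by metis
  next
    case False
    then have "x \<in> W (m - 1)" using x base W_mono[of "p + q" "m - 1"] by auto
    then show ?thesis using subI(5)[OF sub(2)] by blast
  qed
  ultimately show ?case using x W_mono[OF base(2)] by auto
next
  case (add x y x' y')
  have "(y + y') - of_int m *s (x + x') = (y - of_int m *s x) + (y' - of_int m *s x')"
    by (simp add: scale_right_distrib)
  moreover have "(y - of_int m *s x) + (y' - of_int m *s x') \<in> W (m - 1)" "x + x' \<in> W m"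
    using add.IH subI(1)[OF sub(2)] by blast+
  ultimately show ?case by metis
qed

text \<open>
  The decomposition of the graded pieces is lifted, by induction on the weight and, inside one weight,
  from the small end of the Hodge filtration.
\<close>

lemma graph_total:
  assumes "x \<in> W k"
  shows "\<exists>y. (x, y) \<in> graph k"
proof -
  obtain k0 where k0: "W k0 = R" using W_bot by blast
  obtain p0 where p0: "\<And>k. W k \<subseteq> F p0" using F_top by blast
  obtain p1 where p1: "F p1 = R" using F_bot by blast
  have "k = k0 + int n \<Longrightarrow> x \<in> W k \<Longrightarrow> \<exists>y. (x, y) \<in> graph k" for n k x
  proof (induction n arbitrary: k x)
    case 0
    then show ?case using k0 graph_R by auto
  next
    case (Suc n)
    note IH = Suc.IH and k = Suc.prems(1)
    have "p = p1 - int l \<Longrightarrow> x \<in> F p \<inter> W k \<Longrightarrow> \<exists>y. (x, y) \<in> graph k" for l p x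
    proof (induction l arbitrary: p x)
      case 0
      then show ?case using p1 graph_R by auto
    next
      case (Suc l)
      obtain f x' where f: "f \<in> bigr p (k - p)" and x': "x' \<in> F (p + 1) \<inter> W k"
        and w: "x - f - x' \<in> W (k - 1)" using F_decomp Suc.prems(2) by blast
      obtain y' where y': "(x', y') \<in> graph k" using Suc.IH[of "p + 1" x'] Suc.prems(1) x' by auto
      obtain z where "(x - f - x', z) \<in> graph (k - 1)"
        using IH[of "k - 1" "x - f - x'"] k w by auto
      then have "(x - f - x', z) \<in> graph k" using graph_mono by auto
      moreover have "(f, of_int k *s f) \<in> graph k" using graph.base[OF f, of k] by simp
      ultimately have "((x - f - x') + f + x', z + of_int k *s f + y') \<in> graph k"
        using y' by (intro graph.add)
      then show ?case by auto
    qed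
    from this[of "min p0 p1" "nat (p1 - min p0 p1)" x] show ?case
      using Suc.prems p0 F_anti[of "min p0 p1" p0] by auto
  qed note * = this
  show ?thesis
  proof (cases "k0 \<le> k")
    case True then show ?thesis using *[of k "nat (k - k0)" x] assms by auto
  next
    case False
    then have "x \<in> R" using assms k0 W_mono[of k k0] by auto
    then show ?thesis using graph_R by blast
  qed
qed

definition tail :: "int \<Rightarrow> int \<Rightarrow> 'u set"
  where "tail m p = span (\<Union>p'\<in>{p..}. bigr p' (m - p'))"

lemma tail_mono: "p \<le> p' \<Longrightarrow> tail m p' \<subseteq> tail m p"
  unfolding tail_def by (intro span_mono UN_mono) auto

lemma tail_sub: "subspace (tail m p)"
  by (simp add: tail_def)

lemma tail_F_W: "tail m p \<subseteq> F p \<inter> W m"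
  unfolding tail_def
proof (rule span_minimal)
  show "subspace (F p \<inter> W m)" by (simp add: sub subspace_inter)
  show "(\<Union>p'\<in>{p..}. bigr p' (m - p')) \<subseteq> F p \<inter> W m"
    using F_anti by (fastforce simp: bigr_def)
qed

lemma R_tail: "R \<subseteq> tail m p"
  using R_bigr[of p "m - p"] unfolding tail_def by (auto intro!: span_base)

lemma tail_split:
  assumes "x \<in> tail m p"
  shows "\<exists>i\<in>bigr p (m - p). x - i \<in> tail m (p + 1)"
  using assms unfolding tail_def[of m p]
proof (induction rule: span_induct)
  case base
  show ?case unfolding subspace_def
  proof (safe, goal_cases)
    case 1 then show ?case using bigr_sub tail_sub subI(3) by (intro bexI[of _ 0]) auto
  next
    case (2 x y g h)
    then show ?case using bigr_sub tail_sub subI(1) by (intro bexI[of _ "g + h"]) (auto simp: add_diff_add)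
  next
    case (3 c x g)
    then show ?case using bigr_sub tail_sub subI(5) by (intro bexI[of _ "c *s g"]) (auto simp flip: scale_right_diff_distrib)
  qed
next
  case (step x)
  then obtain p' where p': "p \<le> p'" "x \<in> bigr p' (m - p')" by auto
  show ?case
  proof (cases "p' = p")
    case True then show ?thesis using p' subI(3)[OF tail_sub] by (intro bexI[of _ x]) auto
  next
    case False
    then have "x \<in> tail m (p + 1)" using p' unfolding tail_def by (intro span_base) auto
    then show ?thesis using subI(3)[OF bigr_sub] by (intro bexI[of _ 0]) auto
  qed
qed

text \<open>
  The pieces of one weight are independent modulo lower weights: the summand with the smallest first
  index \<open>p\<close> lies in \<open>G (m - p)\<close> up to lower weight and the others in \<open>F (p + 1)\<close>, and these are opposed.
\<close>

lemma tail_inter_W: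
  assumes "x \<in> tail m p" "x \<in> W (m - 1)"
  shows "x \<in> R"
proof -
  obtain p1 where p1: "F p1 = R" using F_bot by blast
  have "p \<ge> p1 - int n \<Longrightarrow> x \<in> tail m p \<Longrightarrow> x \<in> W (m - 1) \<Longrightarrow> x \<in> R" for n p x
  proof (induction n arbitrary: p x)
    case 0
    then show ?case using tail_F_W[of m p] F_anti[of p1 p] p1 by auto
  next
    case (Suc n)
    obtain i where i: "i \<in> bigr p (m - p)" "x - i \<in> tail m (p + 1)" using tail_split Suc by blast
    then have "i \<in> corr (m - p) m" by (simp add: bigr_def)
    then obtain g where g: "g \<in> G (m - p) \<inter> W m" "i - g \<in> W (m - 2)"
      using corr_approx[of i "m - p" m 1] by auto
    have "x - (i - g) \<in> W (m - 1)" using Suc.prems g W_mono[of "m - 2" "m - 1"]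
      by - (rule subI(2)[OF sub(2)]; auto)
    then have "(x - i) - (- g) \<in> W (m - 1)" by (simp add: algebra_simps)
    moreover have "- g \<in> G (m - p) \<inter> W m" using g sub subI(4) by auto
    ultimately have xi: "x - i \<in> W (m - 1)"
      using inter[of "p + 1" "m - p" m "x - i" "- g"] i(2) tail_F_W[of m "p + 1"] by auto
    then have "x - (x - i) \<in> W (m - 1)" using Suc.prems(3) subI(2)[OF sub(2)] by blast
    then have "i \<in> R" using bigr_inter_W[OF i(1)] by simp
    then have "(x - i) + i \<in> tail m (p + 1)" using i(2) R_tail subI(1)[OF tail_sub] by blast
    then show ?case using Suc.IH[of "p + 1" x] Suc.prems by simp
  qed
  from this[of "nat (p1 - p)" p x] show ?thesis using assms by auto
qed

lemma graph_top:
  assumes "(x, y) \<in> graph m"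
  shows "\<exists>a p. a \<in> tail m p \<and> (x - a, y - of_int m *s a) \<in> graph (m - 1)"
  using assms
proof (induction rule: graph.induct)
  case (base x p q)
  show ?case
  proof (cases "p + q = m")
    case True
    then have "q = m - p" by simp
    then have "x \<in> tail m p" using base unfolding tail_def by (intro span_base) auto
    moreover have "(x - x, of_int (p + q) *s x - of_int m *s x) \<in> graph (m - 1)"
      using True graph_zero_R[OF subI(3)[OF sub(1)]] by simp
    ultimately show ?thesis by blast
  next
    case False
    then have "(x, of_int (p + q) *s x) \<in> graph (m - 1)" using base by (intro graph.base) auto
    then have "(x - 0, of_int (p + q) *s x - of_int m *s 0) \<in> graph (m - 1)" by simp
    moreover have "0 \<in> tail m p" using subI(3)[OF tail_sub] .
    ultimately show ?thesis by blast
  qed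
next
  case (add x y x' y')
  then obtain a p a' p' where a: "a \<in> tail m p" "(x - a, y - of_int m *s a) \<in> graph (m - 1)"
    "a' \<in> tail m p'" "(x' - a', y' - of_int m *s a') \<in> graph (m - 1)" by blast
  have "a + a' \<in> tail m (min p p')"
    using a tail_mono[of "min p p'" p m] tail_mono[of "min p p'" p' m]
    by - (rule subI(1)[OF tail_sub]; auto)
  moreover have "((x + x') - (a + a'), (y + y') - of_int m *s (a + a')) \<in> graph (m - 1)"
    using graph.add[OF a(2,4)] by (simp add: add_diff_add scale_right_distrib)
  ultimately show ?case by blast
qed

text \<open>
  If the first component has weight below \<open>m\<close>, then its summand of weight \<open>m\<close> represents zero.
\<close>

lemma graph_descend:
  assumes xy: "(x, y) \<in> graph m" and x: "x \<in> W (m - 1)"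
  shows "(x, y) \<in> graph (m - 1)"
proof -
  obtain a p where a: "a \<in> tail m p" and g: "(x - a, y - of_int m *s a) \<in> graph (m - 1)"
    using graph_top[OF xy] by blast
  have "x - (x - a) \<in> W (m - 1)" using graph_W[OF g] x subI(2)[OF sub(2)] by blast
  then have aR: "a \<in> R" using tail_inter_W[OF a] by simp
  have "(a + 0, of_int (m - 1) *s a + a) \<in> graph (m - 1)"
    by (intro graph.add graph_R graph_zero_R aR)
  moreover have "of_int (m - 1) *s a + a = of_int m *s a"
    by (simp add: scale_left_diff_distrib)
  ultimately have "(a, of_int m *s a) \<in> graph (m - 1)" by simp
  from graph.add[OF g this] show ?thesis by simp
qed

text \<open>
  Far below, \<open>W k\<close> is \<open>R\<close>, so this contains that zero is related to zero only, that is, that the relation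
  is the graph of an operator.
\<close>

theorem graph_weight:
  assumes "(x, y) \<in> graph m" "x \<in> W k"
  shows "y - of_int k *s x \<in> W (k - 1)"
proof -
  have "m \<le> k + int n \<Longrightarrow> (x, y) \<in> graph m \<Longrightarrow> (x, y) \<in> graph k" for n m
  proof (induction n arbitrary: m)
    case 0 then show ?case using graph_mono by auto
  next
    case (Suc n)
    show ?case
    proof (cases "m \<le> k")
      case True then show ?thesis using Suc.prems graph_mono by blast
    next
      case False
      then have "x \<in> W (m - 1)" using assms(2) W_mono[of k "m - 1"] by auto
      then show ?thesis using Suc.IH[of "m - 1"] graph_descend Suc.prems by auto
    qed
  qed
  from this[of m "nat (m - k)"] show ?thesis using graph_W assms(1) by auto
qed

end

section \<open>The Hodge filtrations of a mixed Hodge structure\<close>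

lemma keys_diff_sub: "keys (x :: 'a \<Rightarrow>\<^sub>0 'k::field) \<subseteq> S \<Longrightarrow> keys y \<subseteq> S \<Longrightarrow> keys (x - y) \<subseteq> S"
  using cvs.subspace_diff[OF keys_subspace[of S], of x y] by simp

lemma cx_zero: "\<zero>\<^bsub>cx S\<^esub> = cx_relations S"
  by (simp add: cx_def quot_def)

context qvs
begin

lemma cx_carrier: "carrier (cx V) = (\<lambda>x. cx_relations V +>\<^bsub>free_space (carrier V)\<^esub> x) ` reps V"
  unfolding cx_def vs.quot_carrier[OF free_space_vs] by (simp add: reps_def)

lemma cx_vs: "vs (cx V)"
  and cx_add: "x \<in> reps V \<Longrightarrow> y \<in> reps V \<Longrightarrow>
    (cx_relations V +>\<^bsub>free_space (carrier V)\<^esub> x) \<oplus>\<^bsub>cx V\<^esub> (cx_relations V +>\<^bsub>free_space (carrier V)\<^esub> y) =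
    cx_relations V +>\<^bsub>free_space (carrier V)\<^esub> (x + y)"
  and cx_smult: "x \<in> reps V \<Longrightarrow>
    c \<odot>\<^bsub>cx V\<^esub> (cx_relations V +>\<^bsub>free_space (carrier V)\<^esub> x) =
    cx_relations V +>\<^bsub>free_space (carrier V)\<^esub> csc c x"
proof -
  interpret f: vs "free_space (carrier V) :: (complex, _) module" by (rule free_space_vs)
  have R: "subspc (free_space (carrier V)) (cx_relations V)"
    using cx_relations_subspace cx_relations_reps by (auto simp: free_subspc_iff reps_def)
  show "vs (cx V)" unfolding cx_def by (rule f.quot_vs[OF R])
  show "x \<in> reps V \<Longrightarrow> y \<in> reps V \<Longrightarrow>
    (cx_relations V +>\<^bsub>free_space (carrier V)\<^esub> x) \<oplus>\<^bsub>cx V\<^esub> (cx_relations V +>\<^bsub>free_space (carrier V)\<^esub> y) =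
    cx_relations V +>\<^bsub>free_space (carrier V)\<^esub> (x + y)"
    using f.quot_add[OF R, of x y] by (simp add: cx_def reps_def)
  show "x \<in> reps V \<Longrightarrow> c \<odot>\<^bsub>cx V\<^esub> (cx_relations V +>\<^bsub>free_space (carrier V)\<^esub> x) =
    cx_relations V +>\<^bsub>free_space (carrier V)\<^esub> csc c x"
    using f.quot_smult[OF R, of x c] by (simp add: cx_def reps_def)
qed

abbreviation cls where "cls x \<equiv> cx_relations V +>\<^bsub>free_space (carrier V)\<^esub> x"

lemma cls_mem: "y \<in> cls x \<longleftrightarrow> y - x \<in> cx_relations V"
  by (rule free_rcos_mem[OF cx_relations_subspace])

lemma cls_eq: "cls x = cls y \<longleftrightarrow> x - y \<in> cx_relations V"
  by (rule free_rcos_eq[OF cx_relations_subspace])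

lemma cls_self: "x \<in> cls x"
  by (simp add: cls_mem cvs.subspace_0[OF cx_relations_subspace])

lemma Union_cls_iff:
  assumes "subspc (cx V) N"
  shows "x \<in> \<Union>N \<longleftrightarrow> x \<in> reps V \<and> cls x \<in> N"
proof
  assume "x \<in> \<Union>N"
  then obtain X where X: "X \<in> N" "x \<in> X" by blast
  then obtain y where y: "y \<in> reps V" "X = cls y"
    using vs.subspcD(1)[OF cx_vs assms] by (auto simp: cx_carrier)
  then have d: "x - y \<in> cx_relations V" using X by (simp add: cls_mem)
  then have "(x - y) + y \<in> reps V"
    using cx_relations_reps cvs.subspace_add[OF reps_subspace] y(1) by blast
  moreover have "cls x = cls y" using d cls_eq by blast
  ultimately show "x \<in> reps V \<and> cls x \<in> N" using y X by simp
qed (use cls_self in auto)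

lemma Union_cls:
  assumes N: "subspc (cx V) N"
  shows "cvs.subspace (\<Union>N)" "cx_relations V \<subseteq> \<Union>N" "\<Union>N \<subseteq> reps V"
proof -
  note N' = vs.subspcD[OF cx_vs N]
  show R: "cx_relations V \<subseteq> \<Union>N" using N'(2) by (auto simp: cx_zero)
  show "\<Union>N \<subseteq> reps V" using Union_cls_iff[OF N] by blast
  show "cvs.subspace (\<Union>N)" unfolding cvs.subspace_def
  proof (intro conjI ballI allI)
    show "0 \<in> \<Union>N" using R cvs.subspace_0[OF cx_relations_subspace] by blast
    fix x assume x: "x \<in> \<Union>N"
    then show "csc c x \<in> \<Union>N" for c
      using N'(4)[of "cls x" c] by (simp add: Union_cls_iff[OF N] cx_smult cvs.subspace_scale[OF reps_subspace] del: Union_iff)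
    fix y assume y: "y \<in> \<Union>N"
    show "x + y \<in> \<Union>N"
      using x y N'(3)[of "cls x" "cls y"]
      by (simp add: Union_cls_iff[OF N] cx_add cvs.subspace_add[OF reps_subspace] del: Union_iff)
  qed
qed

lemma cx_conj_cls: "cx_conj (cls x) = cls (cj x)"
proof -
  have eq: "cx_conj X = cj ` X" for X by (simp add: cx_conj_def cj_def)
  have rc: "cj z \<in> cx_relations V \<longleftrightarrow> z \<in> cx_relations V" for z
    unfolding relations_iff by (rule reps_in_cj)
  show ?thesis
  proof (intro Set.set_eqI iffI)
    fix z assume "z \<in> cx_conj (cls x)"
    then obtain y where "z = cj y" "y - x \<in> cx_relations V" by (auto simp: eq cls_mem)
    then show "z \<in> cls (cj x)" using rc[of "y - x"] by (simp add: cls_mem cj_diff)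
  next
    fix z assume "z \<in> cls (cj x)"
    then have "cj z - x \<in> cx_relations V" using rc[of "z - cj x"] by (simp add: cls_mem cj_diff)
    then show "z \<in> cx_conj (cls x)" unfolding eq by (intro image_eqI[of _ _ "cj z"]) (auto simp: cls_mem)
  qed
qed

end

text \<open>
  All representatives give the same coset, so that the union in \<open>cx_multi\<close> is a single coset.
\<close>

lemma cx_map_cls:
  assumes "vs V" "vs V'" "lin V V' g" "x \<in> reps V"
  shows "cx_map V' g (cx_relations V +>\<^bsub>free_space (carrier V)\<^esub> x) =
    cx_relations V' +>\<^bsub>free_space (carrier V')\<^esub> push g x"
proof -
  interpret V: qvs V using assms(1) by (simp add: qvs_def)
  interpret V': qvs V' using assms(2) by (simp add: qvs_def)
  have "cx_map V' g (V.cls x) = (\<Union>y\<in>V.cls x. V'.cls (push g y))"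
  proof -
    have "listset [V.cls x] = (\<lambda>y. [y]) ` V.cls x" by (auto simp: set_Cons_def)
    then show ?thesis by (simp add: cx_map_def cx_multi_def push_def mpush_def)
  qed
  also have "\<dots> = (\<Union>y\<in>V.cls x. V'.cls (push g x))"
  proof (rule SUP_cong[OF refl])
    fix y assume "y \<in> V.cls x"
    then have "push g (y - x) \<in> cx_relations V'"
      using push_relations[OF assms(1-3)] by (simp add: V.cls_mem)
    then show "V'.cls (push g y) = V'.cls (push g x)" by (simp add: V'.cls_eq push_diff)
  qed
  also have "\<dots> = V'.cls (push g x)" using V.cls_self by blast
  finally show ?thesis .
qed

lemma push_mem_cx_map:
  assumes "0 \<in> cx_relations V'" "x \<in> X"
  shows "push g x \<in> cx_map V' g X"
proof -
  have "[x] \<in> listset [X]" using assms(2) by (simp add: set_Cons_def)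
  moreover have "push g x \<in> cx_relations V' +>\<^bsub>free_space (carrier V')\<^esub> push g x"
    using assms(1) by (force simp: free_rcos)
  ultimately show ?thesis
    unfolding cx_map_def cx_multi_def push_def mpush_def by (rule UN_I)
qed

definition wt_reps :: "'a mhs \<Rightarrow> int \<Rightarrow> ('a \<Rightarrow>\<^sub>0 complex) set"
  where "wt_reps V k = reps_in (space V) (wt V k)"

definition hdg_reps :: "'a mhs \<Rightarrow> int \<Rightarrow> ('a \<Rightarrow>\<^sub>0 complex) set"
  where "hdg_reps V p = \<Union>(hdg V p)"

definition cj_hdg_reps :: "'a mhs \<Rightarrow> int \<Rightarrow> ('a \<Rightarrow>\<^sub>0 complex) set"
  where "cj_hdg_reps V q = cj ` hdg_reps V q"

abbreviation zero_reps :: "'a mhs \<Rightarrow> ('a \<Rightarrow>\<^sub>0 complex) set"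
  where "zero_reps V \<equiv> cx_relations (space V)"

text \<open>
  Purity of a subquotient \<open>Z / B\<close> speaks about the complexification of the quotient.  A representative with
  keys in \<open>Z\<close> becomes zero there if and only if its coordinates lie in \<open>B\<close>, and so the two halves of
  purity can be stated inside the complexification of the whole space.
\<close>

lemma pure_split:
  fixes V :: "(rat, 'a) module"
  assumes V: "vs V" and Z: "subspc V Z" and B: "subspc V B" "B \<subseteq> Z"
    and F: "\<And>p. subspc (cx V) (F p)"
    and pure: "pure_hodge_structure n (subquot V Z B) (\<lambda>p. cx_map (subquot V Z B) (\<lambda>x. B +>\<^bsub>V\<^esub> x) `
        {X \<in> carrier (cx (V\<lparr>carrier := Z\<rparr>)). cx_map V (\<lambda>x. x) X \<in> F p})"
    and pq: "p + q = n + 1"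
  shows "x \<in> reps_in V Z \<Longrightarrow> \<exists>f\<in>\<Union>(F p) \<inter> reps_in V Z. \<exists>g\<in>cj ` \<Union>(F q) \<inter> reps_in V Z.
      x - f - g \<in> reps_in V B"
    and "f \<in> \<Union>(F p) \<inter> reps_in V Z \<Longrightarrow> g \<in> cj ` \<Union>(F q) \<inter> reps_in V Z \<Longrightarrow> f - g \<in> reps_in V B \<Longrightarrow>
      f \<in> reps_in V B"
proof -
  define Q where "Q = subquot V Z B"
  define VZ where "VZ = V\<lparr>carrier := Z\<rparr>"
  define \<pi> where "\<pi> = (\<lambda>x. B +>\<^bsub>V\<^esub> x)"
  interpret V: qvs V using V by (simp add: qvs_def)
  have vZ: "vs VZ" unfolding VZ_def by (rule V.restrict_carrier[OF Z])
  interpret VZ: qvs VZ using vZ by (simp add: qvs_def)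
  note sq = subquot_simps[OF V Z B, folded Q_def]
  interpret Q: qvs Q using sq(5) by (simp add: qvs_def)
  have [simp]: "carrier VZ = Z" "add VZ = add V" "smult VZ = smult V" by (simp_all add: VZ_def)
  have ZV: "Z \<subseteq> carrier V" using V.subspcD(1)[OF Z] .
  have lin_\<pi>: "lin VZ Q \<pi>" using sq by (auto simp: lin_def \<pi>_def)
  have lin_id: "lin VZ V (\<lambda>x. x)" using ZV by (auto simp: lin_def)
  have zr: "y \<in> reps VZ \<longleftrightarrow> keys y \<subseteq> Z" for y by (simp add: reps_def)
  have rVZ: "keys y \<subseteq> Z \<Longrightarrow> y \<in> reps V" for y using ZV by (auto simp: reps_def)
  have ev: "ev VZ \<mu> y = ev V \<mu> y" if "keys y \<subseteq> Z" for y \<mu>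
    unfolding ev_def VZ_def using finsum_restrict_carrier[OF V Z, of "keys y" "\<lambda>v. \<mu> (lookup y v) \<odot>\<^bsub>V\<^esub> v"]
      that V.subspcD(4)[OF Z] by auto
  (* The kernel of the complexified projection onto the quotient. *)
  have key: "push \<pi> y \<in> cx_relations Q \<longleftrightarrow> y \<in> reps_in V B" if y: "keys y \<subseteq> Z" for y
  proof -
    have "push \<pi> y \<in> reps Q" using push_reps[of VZ \<pi> Q y] lin_\<pi> y zr by (auto simp: lin_def)
    then have "push \<pi> y \<in> cx_relations Q \<longleftrightarrow> (\<forall>\<mu>. rlin \<mu> \<longrightarrow> \<pi> (ev V \<mu> y) = B)"
      unfolding Q.relations_iff using ev_push[OF vZ sq(5) lin_\<pi>] y zr by (auto simp: reps_in_def ev sq(2))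
    also have "\<dots> \<longleftrightarrow> y \<in> reps_in V B"
      using y rVZ[OF y] V.ev_closed[OF rVZ[OF y]] V.rcos_eq_zero_iff[OF B(1)] by (auto simp: reps_in_def \<pi>_def)
    finally show ?thesis .
  qed
  let ?G = "\<lambda>p. cx_map Q \<pi> ` {X \<in> carrier (cx VZ). cx_map V (\<lambda>x. x) X \<in> F p}"
  have G: "A \<in> ?G p \<longleftrightarrow> (\<exists>a. keys a \<subseteq> Z \<and> a \<in> \<Union>(F p) \<and> A = Q.cls (push \<pi> a))" for A p
  proof -
    have m: "cx_map Q \<pi> (VZ.cls a) = Q.cls (push \<pi> a)" "cx_map V (\<lambda>x. x) (VZ.cls a) = V.cls a"
      if "keys a \<subseteq> Z" for a
      using cx_map_cls[OF vZ sq(5) lin_\<pi>, of a] cx_map_cls[OF vZ V lin_id, of a] that zr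
      by (auto simp: push_id)
    have "A \<in> ?G p \<longleftrightarrow> (\<exists>a\<in>reps VZ. cx_map V (\<lambda>x. x) (VZ.cls a) \<in> F p \<and> A = cx_map Q \<pi> (VZ.cls a))"
      unfolding VZ.cx_carrier by blast
    also have "\<dots> \<longleftrightarrow> (\<exists>a. keys a \<subseteq> Z \<and> V.cls a \<in> F p \<and> A = Q.cls (push \<pi> a))"
      unfolding Bex_def zr by (intro ex_cong1 conj_cong refl) (simp_all only: m)
    also have "\<dots> \<longleftrightarrow> (\<exists>a. keys a \<subseteq> Z \<and> a \<in> \<Union>(F p) \<and> A = Q.cls (push \<pi> a))"
      using V.Union_cls_iff[OF F] rVZ by blast
    finally show ?thesis .
  qed
  have full: "set_add (cx Q) (?G p) (cx_conj ` ?G q) = carrier (cx Q)"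
    and disj: "?G p \<inter> cx_conj ` ?G q = {\<zero>\<^bsub>cx Q\<^esub>}"
    using pure pq unfolding pure_hodge_structure_def Q_def VZ_def \<pi>_def by blast+
  have preps: "push \<pi> y \<in> reps Q" if "keys y \<subseteq> Z" for y
    using push_reps[of VZ \<pi> Q y] lin_\<pi> that zr by (auto simp: lin_def)
  note sV = V.reps_in_subspace[OF Z] V.reps_in_subspace[OF B(1)]
  have inZ: "y \<in> reps_in V Z" if "keys y \<subseteq> Z" for y
    unfolding reps_in_def using rVZ[OF that] VZ.ev_closed[of y] that zr ev by auto
  have RF: "cx_relations V \<subseteq> \<Union>(F p)" "cvs.subspace (\<Union>(F p))" for p using V.Union_cls[OF F] by auto
  have Fd: "u' \<in> \<Union>(F p)" if "u \<in> \<Union>(F p)" "u - u' \<in> cx_relations V" for u u' p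
    using cvs.subspace_diff[OF RF(2) that(1) subsetD[OF RF(1) that(2)]] by simp
  show "\<exists>f\<in>\<Union>(F p) \<inter> reps_in V Z. \<exists>g\<in>cj ` \<Union>(F q) \<inter> reps_in V Z. x - f - g \<in> reps_in V B"
    if x: "x \<in> reps_in V Z"
  proof -
    obtain x' where x': "keys x' \<subseteq> Z" "x - x' \<in> cx_relations V" using V.reps_in_lift[OF Z x] by blast
    have "Q.cls (push \<pi> x') \<in> carrier (cx Q)" using preps x' by (auto simp: Q.cx_carrier)
    then obtain A A' where A: "A \<in> ?G p" "A' \<in> ?G q" "Q.cls (push \<pi> x') = A \<oplus>\<^bsub>cx Q\<^esub> cx_conj A'"
      unfolding full[symmetric] set_add_def' by auto
    obtain a b where a: "keys a \<subseteq> Z" "a \<in> \<Union>(F p)" "A = Q.cls (push \<pi> a)"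
      and b: "keys b \<subseteq> Z" "b \<in> \<Union>(F q)" "A' = Q.cls (push \<pi> b)"
      using A(1,2) unfolding G by blast
    have cb: "keys (cj b) \<subseteq> Z" using b by simp
    have "Q.cls (push \<pi> x') = Q.cls (push \<pi> a + push \<pi> (cj b))"
      using A(3) Q.cx_add[OF preps[OF a(1)] preps[OF cb]] by (simp add: a(3) b(3) Q.cx_conj_cls push_cj)
    then have "push \<pi> (x' - a - cj b) \<in> cx_relations Q"
      by (simp add: Q.cls_eq push_diff push_add diff_diff_eq)
    moreover have "keys (x' - a - cj b) \<subseteq> Z"
      using x'(1) a(1) cb by (intro keys_diff_sub)
    ultimately have "x' - a - cj b \<in> reps_in V B" using key by blast
    then have "(x - x') + (x' - a - cj b) \<in> reps_in V B"
      using x'(2) V.relations_in[OF B(1)] cvs.subspace_add[OF sV(2)] by blast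
    moreover have "(x - x') + (x' - a - cj b) = x - a - cj b" by simp
    ultimately have "x - a - cj b \<in> reps_in V B" by (simp only:)
    then show ?thesis
      by (rule bexI[of _ "cj b", THEN bexI[of _ a]]) (use a b inZ[OF a(1)] inZ[OF cb] in blast)+
  qed
  show "f \<in> reps_in V B" if f: "f \<in> \<Union>(F p) \<inter> reps_in V Z" and g: "g \<in> cj ` \<Union>(F q) \<inter> reps_in V Z"
    and fg: "f - g \<in> reps_in V B"
  proof -
    obtain b where b: "b \<in> \<Union>(F q)" "g = cj b" using g by blast
    have bZ: "b \<in> reps_in V Z" using g b reps_in_cj by auto
    obtain f' where f': "keys f' \<subseteq> Z" "f - f' \<in> cx_relations V" using V.reps_in_lift[OF Z] f by blast
    obtain b' where b': "keys b' \<subseteq> Z" "b - b' \<in> cx_relations V" using V.reps_in_lift[OF Z bZ] by blast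
    have fF: "f' \<in> \<Union>(F p)"
      using Fd f f'(2) by blast
    have bF: "b' \<in> \<Union>(F q)"
      using Fd b(1) b'(2) by blast
    have cb: "cj (b - b') \<in> cx_relations V" using b'(2) unfolding V.relations_iff by (simp add: reps_in_cj)
    have "(f - g) - (f - f') + cj (b - b') \<in> reps_in V B"
      by (rule cvs.subspace_add[OF sV(2) cvs.subspace_diff[OF sV(2)]])
        (use fg f'(2) cb V.relations_in[OF B(1)] in blast)+
    moreover have "(f - g) - (f - f') + cj (b - b') = f' - cj b'" by (simp add: b(2) cj_diff)
    ultimately have d: "f' - cj b' \<in> reps_in V B" by (simp only:)
    have cbk: "keys (cj b') \<subseteq> Z" using b' by simp
    then have "keys (f' - cj b') \<subseteq> Z"
      using f'(1) by (intro keys_diff_sub)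
    then have "push \<pi> f' - push \<pi> (cj b') \<in> cx_relations Q" using d key by (simp flip: push_diff)
    then have "Q.cls (push \<pi> f') = cx_conj (Q.cls (push \<pi> b'))"
      by (simp add: Q.cx_conj_cls Q.cls_eq push_cj)
    moreover have "Q.cls (push \<pi> f') \<in> ?G p" "Q.cls (push \<pi> b') \<in> ?G q"
      using G fF bF f' b' by blast+
    ultimately have "Q.cls (push \<pi> f') \<in> {\<zero>\<^bsub>cx Q\<^esub>}" unfolding disj[symmetric] by blast
    then have "push \<pi> f' \<in> cx_relations Q"
      using Q.cls_self[of "push \<pi> f'"] by (simp add: cx_zero)
    then have "f' \<in> reps_in V B" using key f'(1) by blast
    then have "(f - f') + f' \<in> reps_in V B"
      using f'(2) V.relations_in[OF B(1)] cvs.subspace_add[OF sV(2)] by blast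
    then show ?thesis by simp
  qed
qed

lemma is_mhsD:
  assumes "is_mhs V"
  shows "vs (space V)" "subspc (space V) (wt V k)" "j \<le> k \<Longrightarrow> wt V j \<subseteq> wt V k"
    "\<exists>k. wt V k = {\<zero>\<^bsub>space V\<^esub>}" "\<exists>k. wt V k = carrier (space V)" "subspc (cx (space V)) (hdg V p)"
  using assms by (auto simp: is_mhs_def vs_def weight_filtration_def hodge_filtration_def)

lemma mhs_opposed:
  assumes V: "is_mhs V"
  shows "opposed_filtrations csc (zero_reps V) (wt_reps V) (hdg_reps V) (cj_hdg_reps V)"
proof -
  note D = is_mhsD[OF V]
  interpret qvs "space V" using D(1) by (simp add: qvs_def)
  note F = Union_cls[OF D(6)]
  have h: "\<And>p q. p \<le> q \<Longrightarrow> hdg V q \<subseteq> hdg V p" "\<exists>p. hdg V p = {\<zero>\<^bsub>cx (space V)\<^esub>}"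
    "\<exists>p. hdg V p = carrier (cx (space V))"
    using V by (auto simp: is_mhs_def hodge_filtration_def)
  have cjR: "cj ` zero_reps V = zero_reps V"
  proof -
    have "cj z \<in> zero_reps V \<longleftrightarrow> z \<in> zero_reps V" for z unfolding relations_iff by (rule reps_in_cj)
    then have "cj ` zero_reps V \<subseteq> zero_reps V" "\<And>z. z \<in> zero_reps V \<Longrightarrow> cj (cj z) \<in> cj ` zero_reps V" by blast+
    then show ?thesis by auto
  qed
  have pure: "pure_hodge_structure n (subquot (space V) (wt V n) (wt V (n - 1)))
     (\<lambda>p. cx_map (subquot (space V) (wt V n) (wt V (n - 1))) (\<lambda>x. wt V (n - 1) +>\<^bsub>space V\<^esub> x) `
        {X \<in> carrier (cx ((space V)\<lparr>carrier := wt V n\<rparr>)). cx_map (space V) (\<lambda>x. x) X \<in> hdg V p})" for n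
    using V by (simp add: is_mhs_def gr_wt_def subquot_mhs_def)
  have w1: "wt V (n - 1) \<subseteq> wt V n" for n using D(3) by simp
  note ps = pure_split[OF D(1) D(2) D(2) w1 D(6) pure]
  show ?thesis
  proof (unfold_locales, goal_cases)
    case 1 then show ?case by (rule cx_relations_subspace)
  next
    case (2 k) then show ?case unfolding wt_reps_def by (rule reps_in_subspace[OF D(2)])
  next
    case (3 p) then show ?case unfolding hdg_reps_def by (rule F(1))
  next
    case (4 q) then show ?case unfolding cj_hdg_reps_def hdg_reps_def by (rule cj_subspace[OF F(1)])
  next
    case (5 k) then show ?case unfolding wt_reps_def by (rule relations_in[OF D(2)])
  next
    case (6 p) then show ?case unfolding hdg_reps_def by (rule F(2))
  next
    case (7 q)
    have "cj ` zero_reps V \<subseteq> cj ` \<Union>(hdg V q)" using F(2) by (rule image_mono)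
    then show ?case by (simp add: cjR cj_hdg_reps_def hdg_reps_def)
  next
    case (8 j k) then show ?case unfolding wt_reps_def by (intro reps_in_mono D(3))
  next
    case (9 p q) then show ?case unfolding hdg_reps_def using h(1) by blast
  next
    case (10 p q) then show ?case unfolding cj_hdg_reps_def hdg_reps_def using h(1) by (intro image_mono) blast
  next
    case 11
    obtain k where "wt V k = {\<zero>\<^bsub>space V\<^esub>}" using D(4) by blast
    then have "wt_reps V k = zero_reps V" by (simp add: wt_reps_def relations_iff)
    then show ?case ..
  next
    case 12
    obtain p where "hdg V p = {\<zero>\<^bsub>cx (space V)\<^esub>}" using h(2) by blast
    then have "hdg_reps V p = zero_reps V" by (simp add: hdg_reps_def cx_zero)
    then show ?case ..
  next
    case 13
    obtain p where p: "hdg V p = carrier (cx (space V))" using h(3) by blast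
    have "reps (space V) \<subseteq> hdg_reps V p" unfolding hdg_reps_def p cx_carrier using cls_self by blast
    then have "\<forall>k. wt_reps V k \<subseteq> hdg_reps V p" by (auto simp: wt_reps_def reps_in_def)
    then show ?case ..
  next
    case (14 p q k x) then show ?case unfolding wt_reps_def hdg_reps_def cj_hdg_reps_def by (rule ps(1))
  next
    case (15 p q k f g) then show ?case unfolding wt_reps_def hdg_reps_def cj_hdg_reps_def by (rule ps(2))
  qed
qed

section \<open>The rational weight operator\<close>

definition mhs_bigr :: "'a mhs \<Rightarrow> int \<Rightarrow> int \<Rightarrow> ('a \<Rightarrow>\<^sub>0 complex) set"
  where "mhs_bigr V = opposed_filtrations.bigr csc (wt_reps V) (hdg_reps V) (cj_hdg_reps V)"

definition weight_graph :: "'a mhs \<Rightarrow> (('a \<Rightarrow>\<^sub>0 complex) \<times> ('a \<Rightarrow>\<^sub>0 complex)) set"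
  where "weight_graph V = (\<Union>m. opposed_filtrations.graph csc (wt_reps V) (hdg_reps V) (cj_hdg_reps V) m)"

text \<open>
  The image of the complex weight operator under \<open>id \<otimes> \<lambda>\<close>, where \<open>\<lambda>\<close> is the coordinate along 1.
  Two values of the operator differ by a representative of zero, so the choice does not matter.
\<close>

definition grading :: "'a mhs \<Rightarrow> 'a \<Rightarrow> 'a"
  where "grading V v = ev (space V) (coord 1) (SOME y. (single v 1, y) \<in> weight_graph V)"

locale mhs =
  fixes V :: "'a mhs"
  assumes is_mhs: "is_mhs V"
begin

sublocale S: qvs "space V" using is_mhsD(1)[OF is_mhs] by (simp add: qvs_def)

sublocale O: opposed_filtrations csc "zero_reps V" "wt_reps V" "hdg_reps V" "cj_hdg_reps V"
  by (rule mhs_opposed[OF is_mhs])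

lemma wt_sub: "subspc (space V) (wt V k)" using is_mhsD(2)[OF is_mhs] .

lemma wt_reps_reps: "wt_reps V k \<subseteq> reps (space V)"
  by (auto simp: wt_reps_def reps_in_def)

lemma weight_graph_base: "x \<in> mhs_bigr V p q \<Longrightarrow> (x, csc (of_int (p + q)) x) \<in> weight_graph V"
  unfolding weight_graph_def mhs_bigr_def by (intro UN_I[OF UNIV_I]) (rule O.graph.base[OF _ order.refl])

lemma weight_graph_common:
  assumes "(x, y) \<in> weight_graph V" "(x', y') \<in> weight_graph V"
  obtains m where "(x, y) \<in> O.graph m" "(x', y') \<in> O.graph m"
proof -
  obtain m m' where m: "(x, y) \<in> O.graph m" "(x', y') \<in> O.graph m'"
    using assms by (auto simp: weight_graph_def)
  then show ?thesis
    using that[of "max m m'"] O.graph_mono[OF m(1), of "max m m'"] O.graph_mono[OF m(2), of "max m m'"] by simp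
qed

lemma weight_graph_add: "(x, y) \<in> weight_graph V \<Longrightarrow> (x', y') \<in> weight_graph V \<Longrightarrow> (x + x', y + y') \<in> weight_graph V"
  by (erule (1) weight_graph_common) (auto simp: weight_graph_def intro: O.graph.add)

lemma weight_graph_diff: "(x, y) \<in> weight_graph V \<Longrightarrow> (x', y') \<in> weight_graph V \<Longrightarrow> (x - x', y - y') \<in> weight_graph V"
  by (erule (1) weight_graph_common) (auto simp: weight_graph_def intro: O.graph_diff)

lemma weight_graph_csc: "(x, y) \<in> weight_graph V \<Longrightarrow> (csc c x, csc c y) \<in> weight_graph V"
  by (auto simp: weight_graph_def intro: O.graph_scale)

lemma weight_graph_induct [consumes 1, case_names base add]:
  assumes "(x, y) \<in> weight_graph V"
    and "\<And>x p q. x \<in> mhs_bigr V p q \<Longrightarrow> P x (csc (of_int (p + q)) x)"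
    and "\<And>x y x' y'. P x y \<Longrightarrow> P x' y' \<Longrightarrow> P (x + x') (y + y')"
  shows "P x y"
proof -
  obtain m where "(x, y) \<in> O.graph m" using assms(1) by (auto simp: weight_graph_def)
  then show ?thesis
  proof (induction rule: O.graph.induct)
    case (base x p q)
    then show ?case using assms(2)[of x p q] by (simp only: mhs_bigr_def)
  qed (rule assms(3))
qed

lemma weight_graph_total: "x \<in> reps (space V) \<Longrightarrow> \<exists>y. (x, y) \<in> weight_graph V"
proof -
  assume x: "x \<in> reps (space V)"
  obtain k where k: "wt V k = carrier (space V)" using is_mhsD(5)[OF is_mhs] by blast
  then have "x \<in> wt_reps V k" using x by (simp add: wt_reps_def S.reps_in_carrier)
  then obtain y where "(x, y) \<in> O.graph k" using O.graph_total by blast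
  then show ?thesis by (auto simp: weight_graph_def)
qed

lemma weight_graph_weight: "(x, y) \<in> weight_graph V \<Longrightarrow> x \<in> wt_reps V k \<Longrightarrow> y - csc (of_int k) x \<in> wt_reps V (k - 1)"
  using O.graph_weight by (auto simp: weight_graph_def)

lemma weight_graph_reps:
  assumes "(x, y) \<in> weight_graph V"
  shows "x \<in> reps (space V)" "y \<in> reps (space V)"
proof -
  obtain m where m: "(x, y) \<in> O.graph m" using assms by (auto simp: weight_graph_def)
  from O.graph_W[OF m] show x: "x \<in> reps (space V)" using wt_reps_reps by blast
  have "(y - csc (of_int m) x) + csc (of_int m) x \<in> reps (space V)"
    using O.graph_W[OF m] wt_reps_reps x
    by (intro cvs.subspace_add[OF reps_subspace] cvs.subspace_scale[OF reps_subspace]) blast+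
  then show "y \<in> reps (space V)" by simp
qed

lemma weight_graph_relations:
  assumes "(x, y) \<in> weight_graph V" "x \<in> zero_reps V"
  shows "y \<in> zero_reps V"
proof -
  obtain k where k: "wt_reps V k = zero_reps V" using O.W_bot by blast
  have "y - csc (of_int k) x \<in> wt_reps V (k - 1)" using weight_graph_weight[OF assms(1)] assms(2) k by blast
  then have "y - csc (of_int k) x \<in> zero_reps V" using O.W_mono[of "k - 1" k] k by auto
  then have "(y - csc (of_int k) x) + csc (of_int k) x \<in> zero_reps V"
    using assms(2) S.cx_relations_subspace by (intro cvs.subspace_add cvs.subspace_scale)
  then show ?thesis by simp
qed

lemma grading_eq:
  assumes v: "v \<in> carrier (space V)" and xy: "(x, y) \<in> weight_graph V" and xv: "x - single v 1 \<in> zero_reps V"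
  shows "grading V v = ev (space V) (coord 1) y"
proof -
  define y0 where "y0 = (SOME y. (single v 1, y) \<in> weight_graph V)"
  have y0: "(single v 1, y0) \<in> weight_graph V"
    unfolding y0_def by (rule someI_ex[OF weight_graph_total]) (simp add: v)
  have d: "y - y0 \<in> zero_reps V" using weight_graph_relations[OF weight_graph_diff[OF xy y0] xv] .
  then have "y - y0 \<in> reps (space V)" using S.cx_relations_reps by blast
  then have "ev (space V) (coord 1) ((y - y0) + y0) =
      ev (space V) (coord 1) (y - y0) \<oplus>\<^bsub>space V\<^esub> ev (space V) (coord 1) y0"
    by (rule S.ev_add[OF rlin_coord _ weight_graph_reps(2)[OF y0]])
  then show ?thesis
    using S.ev_relations[OF rlin_coord d] S.ev_closed[OF weight_graph_reps(2)[OF y0]]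
    by (simp add: grading_def flip: y0_def)
qed

lemma grading_obtain:
  assumes "v \<in> carrier (space V)"
  obtains y where "(single v 1, y) \<in> weight_graph V" "y \<in> reps (space V)" "grading V v = ev (space V) (coord 1) y"
proof -
  obtain y where y: "(single v 1, y) \<in> weight_graph V" using weight_graph_total[of "single v 1"] assms by auto
  have "single v 1 - single v 1 \<in> zero_reps V" using cvs.subspace_0[OF S.cx_relations_subspace] by simp
  from that[OF y weight_graph_reps(2)[OF y] grading_eq[OF assms y this]] show ?thesis .
qed

lemma grading_lin: "lin (space V) (space V) (grading V)"
  unfolding lin_def
proof (intro conjI ballI allI)
  fix u assume u: "u \<in> carrier (space V)"
  obtain y where y: "(single u 1, y) \<in> weight_graph V" "y \<in> reps (space V)" "grading V u = ev (space V) (coord 1) y"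
    using grading_obtain[OF u] .
  show "grading V u \<in> carrier (space V)" using y by (simp add: S.ev_closed)
  show "grading V (q \<odot>\<^bsub>space V\<^esub> u) = q \<odot>\<^bsub>space V\<^esub> grading V u" for q
  proof -
    have "csc (of_rat q) (single u 1) - single (q \<odot>\<^bsub>space V\<^esub> u) 1 \<in> zero_reps V"
      using cvs.subspace_neg[OF S.cx_relations_subspace S.rel_smult[OF u, of q 1]] by simp
    then show ?thesis
      using grading_eq[OF _ weight_graph_csc[OF y(1), of "of_rat q"], of "q \<odot>\<^bsub>space V\<^esub> u"] u y
      by (simp add: S.ev_csc_rat rlin_coord)
  qed
  fix v assume v: "v \<in> carrier (space V)"
  obtain z where z: "(single v 1, z) \<in> weight_graph V" "z \<in> reps (space V)" "grading V v = ev (space V) (coord 1) z"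
    using grading_obtain[OF v] .
  have "(single u 1 + single v 1) - single (u \<oplus>\<^bsub>space V\<^esub> v) 1 \<in> zero_reps V"
    using cvs.subspace_neg[OF S.cx_relations_subspace S.rel_add[OF u v, of 1]] by (simp add: algebra_simps)
  then show "grading V (u \<oplus>\<^bsub>space V\<^esub> v) = grading V u \<oplus>\<^bsub>space V\<^esub> grading V v"
    using grading_eq[OF _ weight_graph_add[OF y(1) z(1)], of "u \<oplus>\<^bsub>space V\<^esub> v"] u v y z
    by (simp add: S.ev_add rlin_coord)
qed

text \<open>
  The complex operator has this property, and \<open>id \<otimes> \<lambda>\<close> fixes \<open>k \<cdot> v\<close>, as \<open>\<lambda>\<close> is rational linear with
  \<open>\<lambda> 1 = 1\<close>.
\<close>

lemma grading_weight:
  assumes v: "v \<in> wt V k"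
  shows "grading V v \<oplus>\<^bsub>space V\<^esub> (- of_int k) \<odot>\<^bsub>space V\<^esub> v \<in> wt V (k - 1)"
proof -
  have vc: "v \<in> carrier (space V)" using v S.subspcD(1)[OF wt_sub] by blast
  obtain y where y: "(single v 1, y) \<in> weight_graph V" "y \<in> reps (space V)" "grading V v = ev (space V) (coord 1) y"
    using grading_obtain[OF vc] .
  have "single v 1 \<in> wt_reps V k" unfolding wt_reps_def by (rule S.single_reps_in[OF wt_sub v])
  then have "y - csc (of_int k) (single v 1) \<in> wt_reps V (k - 1)" by (rule weight_graph_weight[OF y(1)])
  then have "ev (space V) (coord 1) (y + csc (of_rat (- of_int k)) (single v 1)) \<in> wt V (k - 1)"
    by (simp add: wt_reps_def reps_in_def rlin_coord of_rat_minus single_uminus)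
  then show ?thesis
    using y vc by (simp only: S.ev_add[OF rlin_coord] S.ev_csc_rat[OF rlin_coord] S.ev_single[OF rlin_coord]
        cvs.subspace_scale[OF reps_subspace] single_reps coord_one S.smult_one)
qed

end

text \<open>
  What is used about a multimorphism of mixed Hodge structures.  It does not mention tensor products, and
  it covers morphisms as the case of one input.
\<close>

definition mhs_compat :: "'a mhs list \<Rightarrow> 'b mhs \<Rightarrow> ('a list \<Rightarrow> 'b) \<Rightarrow> bool"
  where "mhs_compat Vs V f \<longleftrightarrow> (\<forall>U\<in>set Vs. is_mhs U) \<and> is_mhs V \<and> multilin (map space Vs) (space V) f \<and>
    (\<forall>ps xs. length ps = length Vs \<and> length xs = length Vs \<and> (\<forall>i<length Vs. xs ! i \<in> wt (Vs ! i) (ps ! i)) \<longrightarrow>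
       f xs \<in> wt V (sum_list ps)) \<and>
    (\<forall>ps zs. length ps = length Vs \<and> length zs = length Vs \<and> (\<forall>i<length Vs. zs ! i \<in> hdg_reps (Vs ! i) (ps ! i)) \<longrightarrow>
       mpush f zs \<in> hdg_reps V (sum_list ps))"

lemma mhs_compat_hom:
  assumes V: "is_mhs V" and V': "is_mhs V'" and f: "mhs_hom V V' f"
  shows "mhs_compat [V] V' (\<lambda>xs. f (hd xs))"
proof -
  interpret V': mhs V' by unfold_locales fact
  have lin: "lin (space V) (space V') f" using f by (simp add: mhs_hom_def)
  have "multilin (map space [V]) (space V') (\<lambda>xs. f (hd xs))"
    using lin by (auto simp: multilin_def set_Cons_def lin_def)
  moreover have "push f x \<in> hdg_reps V' p" if x: "x \<in> hdg_reps V p" for x p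
  proof -
    obtain X where X: "X \<in> hdg V p" "x \<in> X" using x unfolding hdg_reps_def by blast
    then have "cx_map (space V') f X \<in> hdg V' p" using f by (simp add: mhs_hom_def)
    moreover have "push f x \<in> cx_map (space V') f X"
      by (rule push_mem_cx_map[OF cvs.subspace_0[OF V'.S.cx_relations_subspace] X(2)])
    ultimately show ?thesis by (auto simp: hdg_reps_def)
  qed
  moreover have "f x \<in> wt V' p" if "x \<in> wt V p" for x p using f that by (simp add: mhs_hom_def)
  ultimately show ?thesis
    using V V' by (auto simp: mhs_compat_def push_def length_Suc_conv)
qed

lemma zero_cx_relations: "0 \<in> cx_relations T"
  by (auto simp: cx_relations_def generated_def free_subspc_iff cvs.subspace_0)

lemma mpush_mem_cx_multi:
  assumes "zs \<in> listset Xs"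
  shows "mpush f zs \<in> cx_multi T f Xs"
  unfolding cx_multi_def
proof (rule UN_I[OF assms])
  show "mpush f zs \<in> cx_relations T +>\<^bsub>free_space (carrier T)\<^esub>
    (\<Sum>vs\<in>listset (map keys zs). single (f vs) (\<Prod>j<length zs. lookup (zs ! j) (vs ! j)))"
    using zero_cx_relations[of T] by (force simp: free_rcos mpush_def)
qed

lemma push_mpush: "push g (mpush f (zs :: ('c \<Rightarrow>\<^sub>0 'k::field) list)) = mpush (\<lambda>vs. g (f vs)) zs"
proof -
  have "push g (sum h A) = (\<Sum>a\<in>A. push g (h a))" for h :: "'c list \<Rightarrow> _ \<Rightarrow>\<^sub>0 'k" and A
    by (induction A rule: infinite_finite_induct) (auto simp: lin_ext_add push_eq lin_ext_zero)
  then have "push g (mpush f zs) = (\<Sum>vs\<in>listset (map keys zs).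
      push g (single (f vs) (\<Prod>j<length zs. lookup (zs ! j) (vs ! j))))"
    unfolding mpush_def .
  then show ?thesis by (simp add: mpush_def push_eq lin_ext_single)
qed

text \<open>
  The map out of the tensor product sends the generators of the two filtrations into the filtrations of
  the target.  The image of a vector is defined as a union; as \<open>hdg V n\<close> consists of cosets, every element of
  the union represents it.
\<close>

lemma mhs_compat_multi:
  assumes Vs: "\<And>U. U \<in> set Vs \<Longrightarrow> is_mhs U" and V: "is_mhs V"
    and ml: "multilin (map space Vs) (space V) f" and f: "mhs_multi Vs V f"
  shows "mhs_compat Vs V f"
proof -
  interpret V: mhs V by unfold_locales fact
  have mhsi: "mhs (Vs ! i)" if "i < length Vs" for i using Vs that by (simp add: mhs_def)
  obtain \<phi> where \<phi>: "mhs_hom (tensor_mhs Vs) V \<phi>"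
    and f\<phi>: "\<And>xs. xs \<in> listset (map (carrier \<circ> space) Vs) \<Longrightarrow> f xs = \<phi> (pure_tensor (map space Vs) xs)"
    using f by (auto simp: mhs_multi_def)
  define T where "T = tensor_space (map space Vs)"
  define pt where "pt = pure_tensor (map space Vs)"
  have W: "f xs \<in> wt V (sum_list ps)" if h: "length ps = length Vs" "length xs = length Vs"
    "\<And>i. i < length Vs \<Longrightarrow> xs ! i \<in> wt (Vs ! i) (ps ! i)" for ps xs
  proof -
    have "xs \<in> listset (map2 wt Vs ps)" using h by (auto simp: listset_iff)
    then have "pt xs \<in> wt (tensor_mhs Vs) (sum_list ps)"
      unfolding tensor_mhs_def Let_def pt_def generated_def using h(1) by auto
    then have "\<phi> (pt xs) \<in> wt V (sum_list ps)" using \<phi> by (auto simp: mhs_hom_def)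
    moreover have "xs ! i \<in> carrier (space (Vs ! i))" if "i < length Vs" for i
    proof -
      interpret Vi: mhs "Vs ! i" by (rule mhsi[OF that])
      show ?thesis using h(3)[OF that] Vi.S.subspcD(1)[OF Vi.wt_sub] by blast
    qed
    then have "xs \<in> listset (map (carrier \<circ> space) Vs)"
      using h(2) by (simp add: listset_iff)
    ultimately show ?thesis by (simp add: f\<phi> pt_def)
  qed
  have F: "mpush f zs \<in> hdg_reps V (sum_list ps)" if h: "length ps = length Vs" "length zs = length Vs"
    "\<And>i. i < length Vs \<Longrightarrow> zs ! i \<in> hdg_reps (Vs ! i) (ps ! i)" for ps zs
  proof -
    have "\<exists>X. i < length Vs \<longrightarrow> X \<in> hdg (Vs ! i) (ps ! i) \<and> zs ! i \<in> X" for i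
      using h(3) by (auto simp: hdg_reps_def)
    then obtain X where X: "\<And>i. i < length Vs \<Longrightarrow> X i \<in> hdg (Vs ! i) (ps ! i) \<and> zs ! i \<in> X i" by metis
    define Xs where "Xs = map X [0..<length Vs]"
    have Xs: "Xs \<in> listset (map2 hdg Vs ps)" "zs \<in> listset Xs"
      using X h by (auto simp: listset_iff Xs_def)
    have "cx_multi T pt Xs \<in> hdg (tensor_mhs Vs) (sum_list ps)"
      unfolding tensor_mhs_def Let_def pt_def T_def generated_def using h(1) Xs(1) by auto
    then have "cx_map (space V) \<phi> (cx_multi T pt Xs) \<in> hdg V (sum_list ps)"
      using \<phi> by (auto simp: mhs_hom_def)
    moreover have "push \<phi> (mpush pt zs) \<in> cx_map (space V) \<phi> (cx_multi T pt Xs)"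
      by (rule push_mem_cx_map[OF zero_cx_relations mpush_mem_cx_multi[OF Xs(2)]])
    ultimately have "push \<phi> (mpush pt zs) \<in> hdg_reps V (sum_list ps)" by (auto simp: hdg_reps_def)
    moreover have "push \<phi> (mpush pt zs) = mpush f zs"
      unfolding push_mpush unfolding mpush_def
    proof (rule sum.cong[OF refl])
      fix vs assume vs: "vs \<in> listset (map keys zs)"
      have "vs \<in> listset (map (carrier \<circ> space) Vs)"
        unfolding listset_iff
      proof (intro conjI allI impI)
        show "length vs = length (map (carrier \<circ> space) Vs)" using vs h by (auto simp: listset_iff)
        fix i assume "i < length (map (carrier \<circ> space) Vs)"
        then have i: "i < length Vs" by simp
        interpret Vi: mhs "Vs ! i" by (rule mhsi[OF i])
        have "zs ! i \<in> reps (space (Vs ! i))"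
          using h(3)[OF i] Vi.S.Union_cls(3)[OF is_mhsD(6)[OF Vi.is_mhs]] by (auto simp: hdg_reps_def)
        moreover have "vs ! i \<in> keys (zs ! i)" using vs h i by (auto simp: listset_iff)
        ultimately show "vs ! i \<in> map (carrier \<circ> space) Vs ! i" using i by (auto simp: reps_def)
      qed
      then show "single (\<phi> (pt vs)) (\<Prod>j<length zs. lookup (zs ! j) (vs ! j)) =
          single (f vs) (\<Prod>j<length zs. lookup (zs ! j) (vs ! j))"
        by (simp add: f\<phi> pt_def)
    qed
    ultimately show ?thesis by simp
  qed
  show ?thesis unfolding mhs_compat_def using Vs V ml W F by blast
qed

locale compat =
  fixes Vs :: "'a mhs list" and V :: "'b mhs" and f :: "'a list \<Rightarrow> 'b"
  assumes compat: "mhs_compat Vs V f"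
begin

sublocale V: mhs V using compat by unfold_locales (simp add: mhs_compat_def)

lemma source: "i < length Vs \<Longrightarrow> mhs (Vs ! i)"
  using compat by (simp add: mhs_compat_def mhs_def)

lemma source_vs: "i < length Vs \<Longrightarrow> vs (space (Vs ! i))"
  using source is_mhsD(1) by (auto simp: mhs_def)

sublocale M: multilin_map "map space Vs" "space V" f
  by (rule multilin_map.intro) (use compat source_vs V.S.vs_axioms in \<open>auto simp: mhs_compat_def\<close>)

lemma mpush_F: "length ps = length Vs \<Longrightarrow> length zs = length Vs \<Longrightarrow>
    (\<And>i. i < length Vs \<Longrightarrow> zs ! i \<in> hdg_reps (Vs ! i) (ps ! i)) \<Longrightarrow> mpush f zs \<in> hdg_reps V (sum_list ps)"
  using compat by (simp add: mhs_compat_def)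

lemma mpush_G:
  assumes "length ps = length Vs" "length zs = length Vs"
    "\<And>i. i < length Vs \<Longrightarrow> zs ! i \<in> cj_hdg_reps (Vs ! i) (ps ! i)"
  shows "mpush f zs \<in> cj_hdg_reps V (sum_list ps)"
proof -
  have "map cj zs ! i \<in> hdg_reps (Vs ! i) (ps ! i)" if "i < length Vs" for i
    using assms(3)[OF that] assms(2) that by (auto simp: cj_hdg_reps_def)
  then have "mpush f (map cj zs) \<in> hdg_reps V (sum_list ps)" using assms by (intro mpush_F) auto
  then have "cj (mpush f zs) \<in> hdg_reps V (sum_list ps)" by (simp only: mpush_cj)
  then show ?thesis unfolding cj_hdg_reps_def by (intro image_eqI[of _ _ "cj (mpush f zs)"]) auto
qed

lemma mpush_W:
  assumes "length ps = length Vs" "length zs = length Vs"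
    "\<And>i. i < length Vs \<Longrightarrow> zs ! i \<in> wt_reps (Vs ! i) (ps ! i)"
  shows "mpush f zs \<in> wt_reps V (sum_list ps)"
  unfolding wt_reps_def
proof (rule M.mpush_reps_in[where N = "\<lambda>i. wt (Vs ! i) (ps ! i)"])
  show "subspc (map space Vs ! i) (wt (Vs ! i) (ps ! i))" if "i < length (map space Vs)" for i
    using mhs.wt_sub[OF source] that by simp
  show "f xs \<in> wt V (sum_list ps)" if "length xs = length (map space Vs)"
    "\<And>i. i < length (map space Vs) \<Longrightarrow> xs ! i \<in> wt (Vs ! i) (ps ! i)" for xs
    using compat that assms(1) by (simp add: mhs_compat_def)
qed (use assms V.wt_sub in \<open>auto simp: wt_reps_def\<close>)

text \<open>
  For generators in \<open>G (q\<^sub>i - j\<^sub>i)\<close> of weight \<open>k\<^sub>i - j\<^sub>i - e\<^sub>i\<close>, with \<open>e\<^sub>i = 0\<close> only if \<open>j\<^sub>i = 0\<close>, the drops add up;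
  if some \<open>j\<^sub>i\<close> is positive then the total drop in weight exceeds the total of the \<open>j\<^sub>i\<close> at least by one.
\<close>

lemma mpush_corr:
  assumes len: "length ks = length Vs" "length qs = length Vs" "length zs = length Vs"
    and zs: "\<And>i. i < length Vs \<Longrightarrow> zs ! i \<in> opposed_filtrations.corr csc (wt_reps (Vs ! i)) (cj_hdg_reps (Vs ! i)) (qs ! i) (ks ! i)"
  shows "mpush f zs \<in> V.O.corr (sum_list qs) (sum_list ks)"
proof (rule slotwise_closure[where n = "length Vs"
    and A = "\<lambda>i. opposed_filtrations.corr_gens (wt_reps (Vs ! i)) (cj_hdg_reps (Vs ! i)) (qs ! i) (ks ! i)"
    and B = "\<lambda>i. opposed_filtrations.corr csc (wt_reps (Vs ! i)) (cj_hdg_reps (Vs ! i)) (qs ! i) (ks ! i)"])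
  have op: "opposed_filtrations csc (zero_reps (Vs ! i)) (wt_reps (Vs ! i)) (hdg_reps (Vs ! i)) (cj_hdg_reps (Vs ! i))" if "i < length Vs" for i
    using mhs_opposed source[OF that] by (simp add: mhs_def)
  note corr_def = opposed_filtrations.corr_def[OF op]
  show "opposed_filtrations.corr_gens (wt_reps (Vs ! i)) (cj_hdg_reps (Vs ! i)) (qs ! i) (ks ! i) \<subseteq>
    opposed_filtrations.corr csc (wt_reps (Vs ! i)) (cj_hdg_reps (Vs ! i)) (qs ! i) (ks ! i)" if "i < length Vs" for i
    unfolding corr_def[OF that] by (rule cvs.span_superset)
  fix zs assume h: "length zs = length Vs"
    "\<And>i. i < length Vs \<Longrightarrow> zs ! i \<in> opposed_filtrations.corr_gens (wt_reps (Vs ! i)) (cj_hdg_reps (Vs ! i)) (qs ! i) (ks ! i)"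
  have "\<exists>j e. i < length Vs \<longrightarrow> (j = 0 \<and> e = 0 \<or> j \<ge> 1 \<and> e = 1) \<and>
      zs ! i \<in> cj_hdg_reps (Vs ! i) (qs ! i - j) \<inter> wt_reps (Vs ! i) (ks ! i - j - e)" for i
  proof (cases "i < length Vs")
    case True
    from h(2)[OF True] consider "zs ! i \<in> cj_hdg_reps (Vs ! i) (qs ! i) \<inter> wt_reps (Vs ! i) (ks ! i)"
      | j where "j \<ge> 1" "zs ! i \<in> cj_hdg_reps (Vs ! i) (qs ! i - j) \<inter> wt_reps (Vs ! i) (ks ! i - j - 1)"
      unfolding opposed_filtrations.corr_gens_def[OF op[OF True]] by auto
    then show ?thesis
    proof cases
      case 1 then show ?thesis by (intro exI[of _ "0::int"]) auto
    next
      case 2 then show ?thesis by (intro exI[of _ j] exI[of _ "1::int"]) auto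
    qed
  qed auto
  then obtain j e :: "nat \<Rightarrow> int" where je: "\<And>i. i < length Vs \<Longrightarrow> (j i = 0 \<and> e i = 0 \<or> j i \<ge> 1 \<and> e i = 1) \<and>
      zs ! i \<in> cj_hdg_reps (Vs ! i) (qs ! i - j i) \<inter> wt_reps (Vs ! i) (ks ! i - j i - e i)" by metis
  let ?I = "[0..<length Vs]"
  let ?J = "\<Sum>i\<leftarrow>?I. j i" and ?E = "\<Sum>i\<leftarrow>?I. e i"
  have sums: "(\<Sum>i\<leftarrow>?I. qs ! i) = sum_list qs" "(\<Sum>i\<leftarrow>?I. ks ! i) = sum_list ks"
    using len by (metis map_nth)+
  have "mpush f zs \<in> cj_hdg_reps V (\<Sum>i\<leftarrow>?I. qs ! i - j i)" using je h by (intro mpush_G) auto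
  then have G: "mpush f zs \<in> cj_hdg_reps V (sum_list qs - ?J)" by (simp add: sum_list_subtractf sums)
  have "mpush f zs \<in> wt_reps V (\<Sum>i\<leftarrow>?I. ks ! i - j i - e i)" using je h by (intro mpush_W) auto
  then have W: "mpush f zs \<in> wt_reps V (sum_list ks - ?J - ?E)" by (simp add: sum_list_subtractf sums)
  have "mpush f zs \<in> V.O.corr_gens (sum_list qs) (sum_list ks)"
  proof (cases "\<forall>i<length Vs. j i = 0")
    case True
    then have "map j ?I = map (\<lambda>_. 0) ?I" "map e ?I = map (\<lambda>_. 0) ?I" using je by fastforce+
    then have "?J = 0" "?E = 0" by (simp_all only: sum_list_0)
    then show ?thesis using G W by (simp add: V.O.corr_gens_def)
  next
    case False
    then obtain i where i: "i < length Vs" "j i \<noteq> 0" by blast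
    have "0 \<le> e i" "0 \<le> j i" if "i < length Vs" for i using je[OF that] by auto
    then have "e i \<le> ?E" "j i \<le> ?J" using i(1) by (auto intro!: member_le_sum_list)
    then have "?J \<ge> 1" "?E \<ge> 1" using i je[OF i(1)] by auto
    moreover have "wt_reps V (sum_list ks - ?J - ?E) \<subseteq> wt_reps V (sum_list ks - ?J - 1)"
      using \<open>?E \<ge> 1\<close> by (intro V.O.W_mono) simp
    ultimately show ?thesis using G W unfolding V.O.corr_gens_def by blast
  qed
  then show "mpush f zs \<in> V.O.corr (sum_list qs) (sum_list ks)"
    unfolding V.O.corr_def by (rule cvs.span_base)
next
  fix zs j z assume h: "length zs = length Vs" "j < length Vs"
    "\<And>a. a \<in> opposed_filtrations.corr_gens (wt_reps (Vs ! j)) (cj_hdg_reps (Vs ! j)) (qs ! j) (ks ! j) \<Longrightarrow>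
      mpush f (zs[j := a]) \<in> V.O.corr (sum_list qs) (sum_list ks)"
    "z \<in> opposed_filtrations.corr csc (wt_reps (Vs ! j)) (cj_hdg_reps (Vs ! j)) (qs ! j) (ks ! j)"
  have op: "opposed_filtrations csc (zero_reps (Vs ! j)) (wt_reps (Vs ! j)) (hdg_reps (Vs ! j)) (cj_hdg_reps (Vs ! j))"
    using mhs_opposed source[OF h(2)] by (simp add: mhs_def)
  have "cvs.span (opposed_filtrations.corr_gens (wt_reps (Vs ! j)) (cj_hdg_reps (Vs ! j)) (qs ! j) (ks ! j)) \<subseteq>
      {z. mpush f (zs[j := z]) \<in> V.O.corr (sum_list qs) (sum_list ks)}"
    using h(1-3) by (intro cvs.span_minimal M.slot_subspace V.O.corr_sub) auto
  then show "mpush f (zs[j := z]) \<in> V.O.corr (sum_list qs) (sum_list ks)"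
    using h(4) unfolding opposed_filtrations.corr_def[OF op] by blast
qed (use len zs in auto)

lemma mpush_bigr:
  assumes "length ps = length Vs" "length qs = length Vs" "length zs = length Vs"
    "\<And>i. i < length Vs \<Longrightarrow> zs ! i \<in> mhs_bigr (Vs ! i) (ps ! i) (qs ! i)"
  shows "mpush f zs \<in> mhs_bigr V (sum_list ps) (sum_list qs)"
proof -
  have op: "opposed_filtrations csc (zero_reps (Vs ! i)) (wt_reps (Vs ! i)) (hdg_reps (Vs ! i)) (cj_hdg_reps (Vs ! i))" if "i < length Vs" for i
    using mhs_opposed source[OF that] by (simp add: mhs_def)
  let ?ks = "map2 (+) ps qs"
  have zs: "zs ! i \<in> hdg_reps (Vs ! i) (ps ! i)" "zs ! i \<in> wt_reps (Vs ! i) (?ks ! i)"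
    "zs ! i \<in> opposed_filtrations.corr csc (wt_reps (Vs ! i)) (cj_hdg_reps (Vs ! i)) (qs ! i) (?ks ! i)" if "i < length Vs" for i
    using assms(4)[OF that] assms(1,2) that unfolding mhs_bigr_def opposed_filtrations.bigr_def[OF op[OF that]] by auto
  have s: "sum_list ?ks = sum_list ps + sum_list qs"
    using assms(1,2) by (simp add: sum_list_sum_nth sum.distrib)
  show ?thesis
    unfolding mhs_bigr_def V.O.bigr_def s[symmetric]
    using mpush_F[OF assms(1,3) zs(1)] mpush_W[OF _ assms(3) zs(2)] mpush_corr[OF _ assms(2,3) zs(3)] assms(1,2)
    by auto
qed

definition leibniz_sum :: "(('a \<Rightarrow>\<^sub>0 complex) \<times> ('a \<Rightarrow>\<^sub>0 complex)) list \<Rightarrow> 'b \<Rightarrow>\<^sub>0 complex"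
  where "leibniz_sum zs = (\<Sum>i<length Vs. mpush f ((map fst zs)[i := snd (zs ! i)]))"

lemma leibniz_sum_slot_add:
  assumes "length zs = length Vs" "j < length Vs"
  shows "leibniz_sum (zs[j := (x + x', y + y')]) = leibniz_sum (zs[j := (x, y)]) + leibniz_sum (zs[j := (x', y')])"
  unfolding leibniz_sum_def sum.distrib[symmetric]
proof (rule sum.cong[OF refl])
  fix i assume "i \<in> {..<length Vs}"
  then have i: "i < length Vs" by simp
  show "mpush f ((map fst (zs[j := (x + x', y + y')]))[i := snd (zs[j := (x + x', y + y')] ! i)]) =
      mpush f ((map fst (zs[j := (x, y)]))[i := snd (zs[j := (x, y)] ! i)]) +
      mpush f ((map fst (zs[j := (x', y')]))[i := snd (zs[j := (x', y')] ! i)])"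
  proof (cases "i = j")
    case True
    then show ?thesis using assms by (simp add: map_update mpush_slot_add)
  next
    case False
    then show ?thesis using assms i
      by (simp add: map_update list_update_swap[of j i] mpush_slot_add)
  qed
qed

text \<open>
  The Leibniz rule for the complex weight operator.  On Deligne's pieces it says that the weights of the
  factors add up; both sides are additive in each pair of argument and value.
\<close>

lemma mpush_weight_graph:
  assumes len: "length zs = length Vs" and zs: "\<And>i. i < length Vs \<Longrightarrow> zs ! i \<in> weight_graph (Vs ! i)"
  shows "(mpush f (map fst zs), leibniz_sum zs) \<in> weight_graph V"
proof (rule slotwise_closure[where n = "length Vs" and B = "\<lambda>i. weight_graph (Vs ! i)"
    and A = "\<lambda>i. {(x, csc (of_int (p + q)) x) |x p q. x \<in> mhs_bigr (Vs ! i) p q}"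
    and P = "\<lambda>zs. (mpush f (map fst zs), leibniz_sum zs) \<in> weight_graph V"])
  show "{(x, csc (of_int (p + q)) x) |x p q. x \<in> mhs_bigr (Vs ! i) p q} \<subseteq> weight_graph (Vs ! i)" if "i < length Vs" for i
    using mhs.weight_graph_base[OF source[OF that]] by blast
  fix zs :: "(('a \<Rightarrow>\<^sub>0 complex) \<times> ('a \<Rightarrow>\<^sub>0 complex)) list"
  assume h: "length zs = length Vs"
    "\<And>i. i < length Vs \<Longrightarrow> zs ! i \<in> {(x, csc (of_int (p + q)) x) |x p q. x \<in> mhs_bigr (Vs ! i) p q}"
  then have "\<exists>p q. i < length Vs \<longrightarrow> fst (zs ! i) \<in> mhs_bigr (Vs ! i) p q \<and> snd (zs ! i) = csc (of_int (p + q)) (fst (zs ! i))" for i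
    by fastforce
  then obtain p q where pq: "\<And>i. i < length Vs \<Longrightarrow> fst (zs ! i) \<in> mhs_bigr (Vs ! i) (p i) (q i) \<and>
      snd (zs ! i) = csc (of_int (p i + q i)) (fst (zs ! i))" by metis
  let ?I = "[0..<length Vs]"
  have mem: "mpush f (map fst zs) \<in> mhs_bigr V (sum_list (map p ?I)) (sum_list (map q ?I))"
    using pq h by (intro mpush_bigr) auto
  have "leibniz_sum zs = (\<Sum>i<length Vs. csc (of_int (p i + q i)) (mpush f (map fst zs)))"
    unfolding leibniz_sum_def
  proof (rule sum.cong[OF refl])
    fix i assume "i \<in> {..<length Vs}"
    then have i: "i < length Vs" by simp
    have "(map fst zs)[i := fst (zs ! i)] = map fst zs" using i h by (metis list_update_id nth_map)
    then show "mpush f ((map fst zs)[i := snd (zs ! i)]) = csc (of_int (p i + q i)) (mpush f (map fst zs))"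
      using pq[OF i] mpush_slot_csc[of i "map fst zs" f "of_int (p i + q i)" "fst (zs ! i)"] i h by simp
  qed
  also have "\<dots> = csc (of_int (sum_list (map p ?I) + sum_list (map q ?I))) (mpush f (map fst zs))"
    by (simp add: interv_sum_list_conv_sum_set_nat atLeast0LessThan cvs.scale_sum_left[symmetric] sum.distrib)
  finally show "(mpush f (map fst zs), leibniz_sum zs) \<in> weight_graph V" using V.weight_graph_base[OF mem] by simp
next
  fix zs j z assume h: "length zs = length Vs" "j < length Vs"
    "\<And>a. a \<in> {(x, csc (of_int (p + q)) x) |x p q. x \<in> mhs_bigr (Vs ! j) p q} \<Longrightarrow>
      (mpush f (map fst (zs[j := a])), leibniz_sum (zs[j := a])) \<in> weight_graph V"
    and z: "z \<in> weight_graph (Vs ! j)"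
  interpret Vj: mhs "Vs ! j" by (rule source[OF h(2)])
  obtain x y where xy: "z = (x, y)" by force
  have "(x, y) \<in> weight_graph (Vs ! j)" using z xy by simp
  then show "(mpush f (map fst (zs[j := z])), leibniz_sum (zs[j := z])) \<in> weight_graph V"
    unfolding xy
  proof (induction rule: Vj.weight_graph_induct)
    case (base x p q)
    then show ?case by (intro h(3)) blast
  next
    case (add x y x' y')
    then show ?case
      using V.weight_graph_add[OF add] h by (simp add: leibniz_sum_slot_add map_update mpush_slot_add)
  qed
qed (use len zs in auto)

text \<open>
  Only one slot of each summand of the complex Leibniz rule is not a rational vector, hence applying
  \<open>id \<otimes> \<lambda>\<close> to the summand amounts to applying it in this slot.
\<close>

theorem grading_leibniz:
  assumes ws: "M.ok ws"
  shows "grading V (f ws) = (\<Oplus>\<^bsub>space V\<^esub>j\<in>{..<length Vs}. f (ws[j := grading (Vs ! j) (ws ! j)]))"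
proof -
  have len: "length ws = length Vs" and car: "\<And>i. i < length Vs \<Longrightarrow> ws ! i \<in> carrier (space (Vs ! i))"
    using ws by (auto simp: M.ok_def)
  have "\<exists>y. i < length Vs \<longrightarrow> (single (ws ! i) 1, y) \<in> weight_graph (Vs ! i) \<and> y \<in> reps (space (Vs ! i)) \<and>
      grading (Vs ! i) (ws ! i) = ev (space (Vs ! i)) (coord 1) y" for i
    using mhs.grading_obtain[OF source car] by metis
  then obtain y where y: "\<And>i. i < length Vs \<Longrightarrow> (single (ws ! i) 1, y i) \<in> weight_graph (Vs ! i) \<and> y i \<in> reps (space (Vs ! i)) \<and>
      grading (Vs ! i) (ws ! i) = ev (space (Vs ! i)) (coord 1) (y i)" by metis
  define zs where "zs = map (\<lambda>i. (single (ws ! i) (1::complex), y i)) [0..<length Vs]"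
  define ps where "ps = map (\<lambda>v. (v, 1::complex)) ws"
  have fst_zs: "map fst zs = map (\<lambda>(v, c). single v c) ps"
    using len by (auto simp: zs_def ps_def intro!: nth_equalityI)
  have fst_ps: "map fst ps = ws" and ones: "prod_list (map snd (ps[j := (u, 1)])) = 1" for j u
  proof -
    show "map fst ps = ws" by (simp add: ps_def comp_def)
    have "map snd (ps[j := (u, 1)]) = replicate (length ws) 1"
      by (cases "j < length ws") (auto simp: ps_def nth_list_update list_update_beyond intro!: nth_equalityI)
    then show "prod_list (map snd (ps[j := (u, 1)])) = 1" by simp
  qed
  have snd_ps: "prod_list (map snd ps) = 1" by (simp add: ps_def comp_def map_replicate_const)
  have "(mpush f (map fst zs), leibniz_sum zs) \<in> weight_graph V"
    using y by (intro mpush_weight_graph) (auto simp: zs_def)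
  moreover have "mpush f (map fst zs) = single (f ws) 1"
    using mpush_singles[of f ps] by (simp add: fst_zs fst_ps snd_ps)
  ultimately have g: "(single (f ws) 1, leibniz_sum zs) \<in> weight_graph V" by simp
  have slot: "mpush f ((map fst zs)[j := snd (zs ! j)]) = push (\<lambda>v. f (ws[j := v])) (y j)" if "j < length Vs" for j
    using mpush_singles_slot[of j ps f "y j"] that len
    by (simp add: fst_zs fst_ps ones) (simp add: zs_def ps_def)
  have sl: "lin (space (Vs ! j)) (space V) (\<lambda>v. f (ws[j := v]))" if "j < length Vs" for j
    using M.slot_lin[OF ws] that by simp
  have "single (f ws) 1 - single (f ws) 1 \<in> zero_reps V" using zero_cx_relations by simp
  then have "grading V (f ws) = ev (space V) (coord 1) (leibniz_sum zs)"
    by (rule V.grading_eq[OF M.closed[OF ws] g])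
  also have "\<dots> = (\<Oplus>\<^bsub>space V\<^esub>j\<in>{..<length Vs}. ev (space V) (coord 1) (push (\<lambda>v. f (ws[j := v])) (y j)))"
  proof -
    have "leibniz_sum zs = (\<Sum>j<length Vs. push (\<lambda>v. f (ws[j := v])) (y j))"
      unfolding leibniz_sum_def using slot by (intro sum.cong) auto
    then show ?thesis
      using V.S.ev_sum[OF rlin_coord, of "{..<length Vs}" "\<lambda>j. push (\<lambda>v. f (ws[j := v])) (y j)" 1]
        push_reps[of "space (Vs ! j)" "\<lambda>v. f (ws[j := v])" "space V" "y j" for j] sl y
      by (auto simp: lin_def)
  qed
  also have "\<dots> = (\<Oplus>\<^bsub>space V\<^esub>j\<in>{..<length Vs}. f (ws[j := grading (Vs ! j) (ws ! j)]))"
  proof (rule V.S.finsum_cong')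
    show "(\<lambda>j. f (ws[j := grading (Vs ! j) (ws ! j)])) \<in> {..<length Vs} \<rightarrow> carrier (space V)"
    proof
      fix j assume "j \<in> {..<length Vs}"
      then have j: "j < length Vs" by simp
      have "grading (Vs ! j) (ws ! j) \<in> carrier (space (Vs ! j))"
        using mhs.grading_lin[OF source[OF j]] car[OF j] by (simp add: lin_def)
      then show "f (ws[j := grading (Vs ! j) (ws ! j)]) \<in> carrier (space V)"
        using sl[OF j] by (simp add: lin_def)
    qed
    fix j assume "j \<in> {..<length Vs}"
    then show "ev (space V) (coord 1) (push (\<lambda>v. f (ws[j := v])) (y j)) = f (ws[j := grading (Vs ! j) (ws ! j)])"
      using ev_push[OF source_vs V.S.vs_axioms sl rlin_coord] y by auto
  qed simp
  finally show ?thesis .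
qed

end

section \<open>Decomposition into weight vectors\<close>

text \<open>
  An operator that acts as \<open>k\<close> on the graded piece of weight \<open>k\<close>.  Different weights give different
  eigenvalues, so the operator is diagonalizable and its eigenspaces split the filtration.
\<close>

locale weighted = vs V for V :: "(rat, 'a) module" (structure) +
  fixes W :: "int \<Rightarrow> 'a set" and Y :: "'a \<Rightarrow> 'a"
  assumes Y_lin: "lin V V Y"
    and W_sub: "subspc V (W k)"
    and W_bot: "\<exists>k. W k = {\<zero>}"
    and W_top: "\<exists>k. W k = carrier V"
    and Y_W: "x \<in> W k \<Longrightarrow> Y x \<oplus> (- of_int k) \<odot> x \<in> W (k - 1)"
    and W_mono: "j \<le> k \<Longrightarrow> W j \<subseteq> W k"
begin

sublocale Y: lin_map V V Y
  using Y_lin by unfold_locales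

definition shift :: "int \<Rightarrow> 'a \<Rightarrow> 'a"
  where "shift k x = Y x \<oplus> (- of_int k) \<odot> x"

definition wvec :: "int \<Rightarrow> 'a set"
  where "wvec p = {x \<in> carrier V. Y x = of_int p \<odot> x}"

definition parts :: "int set \<Rightarrow> 'a set"
  where "parts S = generated V (\<Union>p\<in>S. wvec p)"

lemma shift_lin: "lin V V (shift k)"
  by (auto simp: lin_def shift_def Y.add Y.smult smult_r_distr a_ac mult.commute simp flip: smult_assoc)

sublocale shift: lin_map V V "shift k" for k
  using shift_lin by unfold_locales

lemma shift_wvec: "x \<in> wvec q \<Longrightarrow> shift k x = of_int (q - k) \<odot> x"
  by (auto simp: shift_def wvec_def simp flip: smult_l_distr)

lemma shift_W: "x \<in> W k \<Longrightarrow> shift k x \<in> W (k - 1)"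
  by (simp add: shift_def Y_W)

lemma shift_zero_wvec:
  assumes "x \<in> carrier V" "shift k x = \<zero>"
  shows "x \<in> wvec k"
proof -
  have "Y x \<ominus> of_int k \<odot> x = \<zero>" using assms by (simp add: shift_def a_minus_def smult_uminus)
  then show ?thesis using assms by (simp add: wvec_def diff_eq_zero_iff)
qed

lemma wvec_carrier: "wvec p \<subseteq> carrier V"
  by (auto simp: wvec_def)

lemma W_carrier: "W k \<subseteq> carrier V"
  using subspcD(1)[OF W_sub] .

lemma parts_sub: "subspc V (parts S)"
  unfolding parts_def by (rule generated_subspc) (use wvec_carrier in auto)

lemma parts_carrier: "parts S \<subseteq> carrier V"
  using subspcD(1)[OF parts_sub] .

lemma parts_mono: "S \<subseteq> S' \<Longrightarrow> parts S \<subseteq> parts S'"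
  unfolding parts_def by (rule generated_mono) auto

lemma wvec_parts: "p \<in> S \<Longrightarrow> wvec p \<subseteq> parts S"
  unfolding parts_def using generated_incl by fastforce

lemma parts_least: "subspc V N \<Longrightarrow> (\<And>p. p \<in> S \<Longrightarrow> wvec p \<subseteq> N) \<Longrightarrow> parts S \<subseteq> N"
  unfolding parts_def by (rule generated_least) auto

lemma foldr_shift_wvec:
  "v \<in> wvec q \<Longrightarrow> foldr shift rs v = (\<Prod>r\<leftarrow>rs. of_int (q - r)) \<odot> v"
proof (induction rs)
  case Nil then show ?case using wvec_carrier[of q] by auto
next
  case (Cons r rs)
  have v: "v \<in> carrier V" using Cons wvec_carrier by auto
  show ?case using Cons v shift_wvec[OF Cons.prems, of r]
    by (simp add: shift.smult mult.commute flip: smult_assoc)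
qed

lemma foldr_shift_lin: "lin V V (foldr shift rs)"
  by (induction rs) (auto simp: lin_def shift.add shift.smult)

text \<open>
  Each factor lowers the weight by one.
\<close>

lemma annihilator: "\<exists>a b :: int. \<forall>x\<in>carrier V. foldr shift [a + 1..b] x = \<zero>"
proof -
  obtain a where a: "W a = {\<zero>}" using W_bot by blast
  obtain b where b: "W b = carrier V" using W_top by blast
  have "x \<in> W (a + int n) \<Longrightarrow> foldr shift [a + 1..a + int n] x = \<zero>" for n x
  proof (induction n arbitrary: x)
    case 0 then show ?case using a by simp
  next
    case (Suc n)
    have "[a + 1..a + int (Suc n)] = [a + 1..a + int n] @ [a + int (Suc n)]"
      using upto_rec2[of "a + 1" "a + int (Suc n)"] by (simp add: algebra_simps)
    then show ?case using Suc.IH shift_W[OF Suc.prems] by (simp add: algebra_simps)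
  qed
  note down = this
  have "foldr shift [a + 1..a + int (nat (b - a))] x = \<zero>" if "x \<in> carrier V" for x
  proof (rule down)
    have "W b \<subseteq> W (a + int (nat (b - a)))" by (rule W_mono) simp
    then show "x \<in> W (a + int (nat (b - a)))" using that b by blast
  qed
  then show ?thesis by blast
qed

text \<open>
  The product of the shifts by the weights in \<open>S\<close> kills \<open>parts S\<close>, and multiplies a vector of weight \<open>p\<close> by a
  non-zero number if \<open>p\<close> is not in \<open>S\<close>.  To have a finite product, only weights that occur are used.
\<close>

lemma wvec_inter_parts:
  assumes x: "x \<in> wvec p" "x \<in> parts S" and p: "p \<notin> S"
  shows "x = \<zero>"
proof -
  obtain a b where ab: "\<And>x. x \<in> carrier V \<Longrightarrow> foldr shift [a + 1..b] x = \<zero>" using annihilator by blast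
  (* The weights that occur lie in the interval; outside of it weight vectors vanish. *)
  define rs where "rs = filter (\<lambda>r. r \<in> S) [a + 1..b]"
  interpret L: lin_map V V "foldr shift rs" using foldr_shift_lin by unfold_locales
  have "parts S \<subseteq> {x \<in> carrier V. foldr shift rs x \<in> {\<zero>}}"
  proof (rule parts_least[OF L.vimage_subspc[OF subspc_zero]])
    fix q assume q: "q \<in> S"
    show "wvec q \<subseteq> {x \<in> carrier V. foldr shift rs x \<in> {\<zero>}}"
    proof
      fix v assume v: "v \<in> wvec q"
      then have vc: "v \<in> carrier V" using wvec_carrier by auto
      have "foldr shift rs v = \<zero>"
      proof (cases "q \<in> set rs")
        case True
        then have "(\<Prod>r\<leftarrow>rs. of_int (q - r)) = (0::rat)" by (simp add: prod_list_zero_iff)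
        then show ?thesis using foldr_shift_wvec[OF v, of rs] vc by simp
      next
        case False
        then have "q \<notin> set [a + 1..b]" using q by (simp add: rs_def)
        then have "(\<Prod>r\<leftarrow>[a + 1..b]. of_int (q - r)) \<noteq> (0::rat)" by (auto simp: prod_list_zero_iff)
        then have "v = \<zero>" using foldr_shift_wvec[OF v, of "[a + 1..b]"] ab[OF vc] smult_eq_zeroD vc by metis
        then show ?thesis by simp
      qed
      then show "v \<in> {x \<in> carrier V. foldr shift rs x \<in> {\<zero>}}" using vc by simp
    qed
  qed
  then have "foldr shift rs x = \<zero>" using x by blast
  moreover have "(\<Prod>r\<leftarrow>rs. of_int (p - r)) \<noteq> (0::rat)" using p by (auto simp: prod_list_zero_iff rs_def)
  ultimately show ?thesis using foldr_shift_wvec[OF x(1), of rs] smult_eq_zeroD x(1) wvec_carrier by (metis subsetD)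
qed

lemma wvec_W:
  assumes "v \<in> wvec q"
  shows "v \<in> W q"
proof -
  have vc: "v \<in> carrier V" using assms wvec_carrier by auto
  obtain b where b: "W b = carrier V" using W_top by blast
  have "m \<le> q + int n \<Longrightarrow> v \<in> W m \<Longrightarrow> v \<in> W q" for n m
  proof (induction n arbitrary: m)
    case 0 then show ?case using W_mono[of m q] by auto
  next
    case (Suc n)
    show ?case
    proof (cases "m \<le> q")
      case True then show ?thesis using Suc W_mono[of m q] by auto
    next
      case False
      have "inverse (of_int (q - m)) \<odot> shift m v \<in> W (m - 1)"
        using shift_W[OF Suc.prems(2)] subspcD(4)[OF W_sub] by blast
      then have "v \<in> W (m - 1)"
        using False vc by (simp add: shift_wvec[OF assms] flip: smult_assoc del: of_int_diff)
      then show ?thesis using Suc.IH[of "m - 1"] Suc.prems(1) by simp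
    qed
  qed
  from this[of b "nat (b - q)"] show ?thesis using vc b by auto
qed

text \<open>
  Induction on the weight \<open>k\<close>: the shift by \<open>k\<close> moves a vector to lower weight, where the shift is
  invertible on sums of weight vectors; subtracting the preimage leaves a vector of weight \<open>k\<close>.
\<close>

lemma stable_split:
  assumes N: "subspc V N" and stable: "\<And>x. x \<in> N \<Longrightarrow> Y x \<in> N"
  shows "N \<subseteq> generated V (\<Union>p. N \<inter> wvec p)"
proof -
  have NV: "N \<subseteq> carrier V" using subspcD(1)[OF N] .
  let ?E = "\<lambda>k. generated V (\<Union>p\<in>{..k}. N \<inter> wvec p)"
  have E_sub: "subspc V (?E k)" for k by (rule generated_subspc) (use NV in auto)
  have E_N: "?E k \<subseteq> N" for k by (rule generated_least[OF N]) auto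
  have shN: "shift k x \<in> N" if "x \<in> N" for k x
    unfolding shift_def using stable[OF that] that subspcD(3,4)[OF N] by blast
  obtain a where a: "W a = {\<zero>}" using W_bot by blast
  obtain b where b: "W b = carrier V" using W_top by blast
  have "x \<in> N \<Longrightarrow> x \<in> W (a + int n) \<Longrightarrow> x \<in> ?E (a + int n)" for n x
  proof (induction n arbitrary: x)
    case 0 then show ?case using a subspcD(2)[OF E_sub] by simp
  next
    case (Suc n)
    let ?k = "a + int (Suc n)"
    have k1: "?k - 1 = a + int n" by simp
    have "shift ?k x \<in> W (?k - 1)" by (rule shift_W[OF Suc.prems(2)])
    then have "shift ?k x \<in> ?E (?k - 1)" unfolding k1 by (rule Suc.IH[OF shN[OF Suc.prems(1)]])
    (* On a vector of weight p < k the shift by k is multiplication by p - k, which is invertible. *)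
    moreover have "?E (?k - 1) \<subseteq> shift ?k ` ?E (?k - 1)"
    proof (rule generated_least[OF shift.image_subspc[OF E_sub]], safe)
      fix p v assume p: "p \<le> ?k - 1" and v: "v \<in> N" "v \<in> wvec p"
      have vc: "v \<in> carrier V" using v NV by auto
      have "v \<in> ?E (?k - 1)" by (rule subsetD[OF generated_incl]) (use p v in auto)
      then have "inverse (of_int (p - ?k)) \<odot> v \<in> ?E (?k - 1)" by (rule subspcD(4)[OF E_sub])
      moreover have "shift ?k (inverse (of_int (p - ?k)) \<odot> v) = v"
      proof -
        have "of_int (p - ?k) \<noteq> (0::rat)" using p by simp
        then show ?thesis using vc
          by (simp add: shift.smult shift_wvec[OF v(2)] del: of_int_diff flip: smult_assoc)
      qed
      ultimately show "v \<in> shift ?k ` ?E (?k - 1)" by (metis imageI)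
    qed
    ultimately obtain t where t: "t \<in> ?E (?k - 1)" "shift ?k x = shift ?k t" by auto
    have xc: "x \<in> carrier V" "t \<in> carrier V" using t E_N Suc.prems NV by auto
    have "?E (?k - 1) \<subseteq> ?E ?k" by (intro generated_mono UN_mono) auto
    then have tk: "t \<in> ?E ?k" using t(1) by blast
    have "shift ?k (x \<ominus> t) = \<zero>" using t(2) xc by (simp add: shift.diff diff_eq_zero_iff)
    then have "x \<ominus> t \<in> wvec ?k" using xc by (intro shift_zero_wvec) auto
    moreover have "x \<ominus> t \<in> N" using Suc.prems t E_N subspcD(5)[OF N] by blast
    ultimately have "x \<ominus> t \<in> ?E ?k" by (intro subsetD[OF generated_incl]) auto
    then have "(x \<ominus> t) \<oplus> t \<in> ?E ?k" using tk subspcD(3)[OF E_sub] by blast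
    then show ?case using xc by (simp add: a_minus_def a_assoc l_neg)
  qed note * = this
  show ?thesis
  proof
    fix x assume x: "x \<in> N"
    have "W b \<subseteq> W (a + int (nat (b - a)))" by (rule W_mono) simp
    then have "x \<in> W (a + int (nat (b - a)))" using x NV b by blast
    then have "x \<in> ?E (a + int (nat (b - a)))" by (rule *[OF x])
    then show "x \<in> generated V (\<Union>p. N \<inter> wvec p)"
      by (rule subsetD[OF generated_mono, rotated]) auto
  qed
qed

lemma stable_induct:
  assumes N: "subspc V N" and stable: "\<And>x. x \<in> N \<Longrightarrow> Y x \<in> N"
    and M: "subspc V M" and mem: "\<And>p v. v \<in> N \<Longrightarrow> v \<in> wvec p \<Longrightarrow> v \<in> M"
  shows "N \<subseteq> M"
  using stable_split[OF N stable] generated_least[OF M, of "\<Union>p. N \<inter> wvec p"] mem by blast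

lemma parts_stable: "x \<in> parts S \<Longrightarrow> Y x \<in> parts S"
proof -
  have "parts S \<subseteq> {x \<in> carrier V. Y x \<in> parts S}"
  proof (rule parts_least[OF Y.vimage_subspc[OF parts_sub]])
    fix p assume "p \<in> S"
    then have "wvec p \<subseteq> parts S" by (rule wvec_parts)
    then show "wvec p \<subseteq> {x \<in> carrier V. Y x \<in> parts S}"
      using subspcD(4)[OF parts_sub] by (auto simp: wvec_def)
  qed
  then show "x \<in> parts S \<Longrightarrow> Y x \<in> parts S" by blast
qed

lemma parts_disjoint:
  assumes "S \<inter> S' = {}" "x \<in> parts S" "x \<in> parts S'"
  shows "x = \<zero>"
proof -
  have "parts S \<inter> parts S' \<subseteq> {\<zero>}"
  proof (rule stable_induct[OF subspc_inter[OF parts_sub parts_sub] _ subspc_zero])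
    fix p v assume "v \<in> parts S \<inter> parts S'" "v \<in> wvec p"
    then show "v \<in> {\<zero>}" using wvec_inter_parts[of v p S] wvec_inter_parts[of v p S'] assms(1) by auto
  qed (auto intro: parts_stable)
  then show ?thesis using assms by blast
qed

lemma sum_subspc:
  assumes "subspc V N" "subspc V M"
  shows "subspc V {x \<oplus> y |x y. x \<in> N \<and> y \<in> M}"
proof -
  note N = subspcD[OF assms(1)] and M = subspcD[OF assms(2)]
  have c: "\<And>x. x \<in> N \<Longrightarrow> x \<in> carrier V" "\<And>x. x \<in> M \<Longrightarrow> x \<in> carrier V" using N(1) M(1) by auto
  show ?thesis
  proof (rule subspcI, safe)
    show "\<exists>x y. \<zero> = x \<oplus> y \<and> x \<in> N \<and> y \<in> M" using N(2) M(2) by (intro exI[of _ "\<zero>"]) simp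
    fix x y x' y' assume h: "x \<in> N" "y \<in> M" "x' \<in> N" "y' \<in> M"
    then have "x \<oplus> y \<oplus> (x' \<oplus> y') = (x \<oplus> x') \<oplus> (y \<oplus> y')" using c by (simp add: a_ac)
    then show "\<exists>u v. x \<oplus> y \<oplus> (x' \<oplus> y') = u \<oplus> v \<and> u \<in> N \<and> v \<in> M" using h N(3) M(3) by blast
  next
    fix q x y assume h: "x \<in> N" "y \<in> M"
    then have "q \<odot> (x \<oplus> y) = q \<odot> x \<oplus> q \<odot> y" using c by (simp add: smult_r_distr)
    then show "\<exists>u v. q \<odot> (x \<oplus> y) = u \<oplus> v \<and> u \<in> N \<and> v \<in> M" using h N(4) M(4) by blast
  qed (use c in auto)
qed

lemma parts_union:
  assumes "x \<in> parts (S \<union> S')"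
  obtains u e where "x = u \<oplus> e" "u \<in> parts S" "e \<in> parts S'"
proof -
  let ?M = "{x \<oplus> y |x y. x \<in> parts S \<and> y \<in> parts S'}"
  have "parts (S \<union> S') \<subseteq> ?M"
  proof (rule parts_least[OF sum_subspc[OF parts_sub parts_sub]])
    fix p assume p: "p \<in> S \<union> S'"
    show "wvec p \<subseteq> ?M"
    proof
      fix v assume v: "v \<in> wvec p"
      have vc: "v \<in> carrier V" using v wvec_carrier by blast
      have z: "\<zero> \<in> parts S" "\<zero> \<in> parts S'" using subspcD(2)[OF parts_sub] by auto
      show "v \<in> ?M"
      proof (cases "p \<in> S")
        case True
        then have "v \<in> parts S" using v wvec_parts by blast
        then have "v = v \<oplus> \<zero> \<and> v \<in> parts S \<and> \<zero> \<in> parts S'" using z vc by simp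
        then show ?thesis by blast
      next
        case False
        then have "v \<in> parts S'" using v p wvec_parts by blast
        then have "v = \<zero> \<oplus> v \<and> \<zero> \<in> parts S \<and> v \<in> parts S'" using z vc by simp
        then show ?thesis by blast
      qed
    qed
  qed
  then show ?thesis using assms that by blast
qed

end

section \<open>Truncation of a pure complex by slopes\<close>

locale chain_complex =
  fixes K :: "'a ch"
  assumes is_ch: "is_ch K"
begin

sublocale vs "obj K n" for n
  using is_ch by (simp add: is_ch_def vs_def)

lemma d_lin: "lin (obj K n) (obj K (n - 1)) (dif K n)"
  using is_ch by (simp add: is_ch_def)

sublocale d: lin_map "obj K n" "obj K (n - 1)" "dif K n" for n
  using d_lin by unfold_locales

lemma d_d: "x \<in> carrier (obj K n) \<Longrightarrow> dif K (n - 1) (dif K n x) = \<zero>\<^bsub>obj K (n - 2)\<^esub>"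
  using is_ch by (simp add: is_ch_def)

lemma d_closed: "x \<in> carrier (obj K (n + 1)) \<Longrightarrow> dif K (n + 1) x \<in> carrier (obj K n)"
  using d.closed[of x "n + 1"] by simp

lemma cycles_sub: "subspc (obj K n) (cycles K n)"
  using d.vimage_subspc[OF subspc_zero] by (simp add: cycles_def)

lemma boundaries_sub: "subspc (obj K n) (boundaries K n)"
  using d.image_subspc[of "n + 1", OF subspc_carrier] by (simp add: boundaries_def)

lemma cycles_carrier: "cycles K n \<subseteq> carrier (obj K n)"
  by (auto simp: cycles_def)

lemma boundaries_cycles: "boundaries K n \<subseteq> cycles K n"
proof
  fix x assume "x \<in> boundaries K n"
  then obtain y where y: "y \<in> carrier (obj K (n + 1))" "x = dif K (n + 1) y" by (auto simp: boundaries_def)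
  then show "x \<in> cycles K n" using d_d[OF y(1)] d_closed[OF y(1)] by (simp add: cycles_def)
qed

lemmas homology_simps = subquot_simps[OF vs_axioms cycles_sub boundaries_sub boundaries_cycles, folded homology_def]

abbreviation hcls :: "int \<Rightarrow> 'a \<Rightarrow> 'a set"
  where "hcls n z \<equiv> boundaries K n +>\<^bsub>obj K n\<^esub> z"

end

lemma homology_map_hcls:
  fixes K :: "'a ch" and L :: "'b ch" and n :: int and z :: 'a
  assumes K: "is_ch K" and L: "is_ch L" and h: "chain_map K L h" and z: "z \<in> cycles K n"
  shows "homology_map L h n (boundaries K n +>\<^bsub>obj K n\<^esub> z) = boundaries L n +>\<^bsub>obj L n\<^esub> h n z"
    and "h n z \<in> cycles L n"
proof -
  have zc: "z \<in> carrier (obj K n)" using z by (simp add: cycles_def)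
  interpret K: chain_complex K by unfold_locales fact
  interpret L: chain_complex L by unfold_locales fact
  interpret h: lin_map "obj K m" "obj L m" "h m" for m
    using h by unfold_locales (simp add: chain_map_def)
  have hd: "\<And>n x. x \<in> carrier (obj K n) \<Longrightarrow> dif L n (h n x) = h (n - 1) (dif K n x)"
    using h by (simp add: chain_map_def)
  show "h n z \<in> cycles L n" using z hd[OF zc] zc by (auto simp: cycles_def)
  have "boundaries L n +>\<^bsub>obj L n\<^esub> h n x = boundaries L n +>\<^bsub>obj L n\<^esub> h n z"
    if x: "x \<in> boundaries K n +>\<^bsub>obj K n\<^esub> z" for x
  proof -
    have xc: "x \<in> carrier (obj K n)" and "x \<ominus>\<^bsub>obj K n\<^esub> z \<in> boundaries K n"
      using x K.rcos_mem_iff[OF K.boundaries_sub zc] by auto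
    then obtain y where y: "y \<in> carrier (obj K (n + 1))" "x \<ominus>\<^bsub>obj K n\<^esub> z = dif K (n + 1) y"
      by (auto simp: boundaries_def)
    have "h n x \<ominus>\<^bsub>obj L n\<^esub> h n z = dif L (n + 1) (h (n + 1) y)"
      using hd[OF y(1)] by (simp add: y(2)[symmetric] h.diff xc zc)
    then have "h n x \<ominus>\<^bsub>obj L n\<^esub> h n z \<in> boundaries L n" using y(1) by (auto simp: boundaries_def)
    then show ?thesis using L.rcos_eq_iff[OF L.boundaries_sub] xc zc by simp
  qed
  moreover have "z \<in> boundaries K n +>\<^bsub>obj K n\<^esub> z" using K.rcos_self[OF K.boundaries_sub zc] .
  ultimately show "homology_map L h n (boundaries K n +>\<^bsub>obj K n\<^esub> z) = boundaries L n +>\<^bsub>obj L n\<^esub> h n z"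
    unfolding homology_map_def by blast
qed

lemma quasi_isoI:
  assumes K: "is_ch K" and L: "is_ch L" and h: "chain_map K L h"
    and inj: "\<And>n z. z \<in> cycles K n \<Longrightarrow> h n z \<in> boundaries L n \<Longrightarrow> z \<in> boundaries K n"
    and surj: "\<And>n w. w \<in> cycles L n \<Longrightarrow> \<exists>z\<in>cycles K n. w \<ominus>\<^bsub>obj L n\<^esub> h n z \<in> boundaries L n"
  shows "quasi_iso K L h"
  unfolding quasi_iso_def
proof (intro conjI allI h)
  fix n
  interpret K: chain_complex K by unfold_locales fact
  interpret L: chain_complex L by unfold_locales fact
  interpret h: lin_map "obj K m" "obj L m" "h m" for m
    using h by unfold_locales (simp add: chain_map_def)
  note hm = homology_map_hcls[OF K L h]
  have kc: "\<And>z. z \<in> cycles K n \<Longrightarrow> z \<in> carrier (obj K n)" and lc: "\<And>z. z \<in> cycles L n \<Longrightarrow> z \<in> carrier (obj L n)"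
    using K.cycles_carrier L.cycles_carrier by blast+
  show "bij_betw (homology_map L h n) (carrier (homology K n)) (carrier (homology L n))"
    unfolding K.homology_simps(1) L.homology_simps(1)
  proof (rule bij_betwI')
    fix X Y assume "X \<in> (+>\<^bsub>obj K n\<^esub>) (boundaries K n) ` cycles K n" "Y \<in> (+>\<^bsub>obj K n\<^esub>) (boundaries K n) ` cycles K n"
    then obtain x y where xy: "x \<in> cycles K n" "X = K.hcls n x" "y \<in> cycles K n" "Y = K.hcls n y" by auto
    have "homology_map L h n X = homology_map L h n Y \<longleftrightarrow> h n x \<ominus>\<^bsub>obj L n\<^esub> h n y \<in> boundaries L n"
      unfolding xy hm(1)[OF xy(1)] hm(1)[OF xy(3)]
      using L.rcos_eq_iff[OF L.boundaries_sub] kc xy by simp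
    also have "\<dots> \<longleftrightarrow> x \<ominus>\<^bsub>obj K n\<^esub> y \<in> boundaries K n"
    proof
      assume "h n x \<ominus>\<^bsub>obj L n\<^esub> h n y \<in> boundaries L n"
      moreover have "x \<ominus>\<^bsub>obj K n\<^esub> y \<in> cycles K n" using K.subspcD(5)[OF K.cycles_sub] xy by blast
      ultimately show "x \<ominus>\<^bsub>obj K n\<^esub> y \<in> boundaries K n" using inj h.diff kc xy by simp
    next
      assume "x \<ominus>\<^bsub>obj K n\<^esub> y \<in> boundaries K n"
      then have "K.hcls n x = K.hcls n y" using K.rcos_eq_iff[OF K.boundaries_sub] kc xy by simp
      then have "L.hcls n (h n x) = L.hcls n (h n y)" using hm(1)[OF xy(1)] hm(1)[OF xy(3)] by simp
      then show "h n x \<ominus>\<^bsub>obj L n\<^esub> h n y \<in> boundaries L n"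
        using L.rcos_eq_iff[OF L.boundaries_sub] kc xy by simp
    qed
    also have "\<dots> \<longleftrightarrow> X = Y" using K.rcos_eq_iff[OF K.boundaries_sub] kc xy by simp
    finally show "(homology_map L h n X = homology_map L h n Y) = (X = Y)" .
    show "homology_map L h n X \<in> (+>\<^bsub>obj L n\<^esub>) (boundaries L n) ` cycles L n"
      unfolding xy hm(1)[OF xy(1)] using hm(2)[OF xy(1)] by blast
  next
    fix X assume "X \<in> (+>\<^bsub>obj L n\<^esub>) (boundaries L n) ` cycles L n"
    then obtain w where w: "w \<in> cycles L n" "X = L.hcls n w" by auto
    obtain z where z: "z \<in> cycles K n" "w \<ominus>\<^bsub>obj L n\<^esub> h n z \<in> boundaries L n" using surj[OF w(1)] by blast
    then have "X = L.hcls n (h n z)" using w L.rcos_eq_iff[OF L.boundaries_sub] lc kc by simp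
    then show "\<exists>Z\<in>(+>\<^bsub>obj K n\<^esub>) (boundaries K n) ` cycles K n. X = homology_map L h n Z"
      using hm(1)[OF z(1)] z(1) by blast
  qed
qed

locale pure_complex = chain_complex K
  for K :: "'a ch" +
  fixes W :: "int \<Rightarrow> int \<Rightarrow> 'a set" and Y :: "int \<Rightarrow> 'a \<Rightarrow> 'a" and \<alpha> :: rat
  assumes weighted: "\<And>n. weighted (obj K n) (W n) (Y n)"
    and Y_dif: "\<And>n x. x \<in> carrier (obj K n) \<Longrightarrow> Y (n - 1) (dif K n x) = dif K n (Y n x)"
    and alpha: "\<alpha> \<noteq> 0"
    and pure: "\<And>n p x. of_int p \<noteq> \<alpha> * of_int n \<Longrightarrow> x \<in> cycles K n \<Longrightarrow> x \<in> W n p \<Longrightarrow>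
      \<exists>y\<in>cycles K n \<inter> W n (p - 1). x \<ominus>\<^bsub>obj K n\<^esub> y \<in> boundaries K n"
begin

sublocale weighted "obj K n" "W n" "Y n" for n
  by (rule weighted)

lemma cycles_stable: "x \<in> cycles K n \<Longrightarrow> Y n x \<in> cycles K n"
  using Y_dif[of x n, symmetric] by (simp add: cycles_def)

lemma boundaries_stable:
  assumes "x \<in> boundaries K n"
  shows "Y n x \<in> boundaries K n"
proof -
  obtain y where y: "y \<in> carrier (obj K (n + 1))" "x = dif K (n + 1) y" using assms by (auto simp: boundaries_def)
  then have "Y n x = dif K (n + 1) (Y (n + 1) y)" using Y_dif[of y "n + 1"] by simp
  then show ?thesis using y(1) by (auto simp: boundaries_def)
qed

lemma d_wvec: "x \<in> wvec n p \<Longrightarrow> dif K n x \<in> wvec (n - 1) p"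
  using Y_dif[of x n] by (auto simp: wvec_def d.smult)

lemma d_parts: "x \<in> parts n S \<Longrightarrow> dif K n x \<in> parts (n - 1) S"
proof -
  have "parts n S \<subseteq> {x \<in> carrier (obj K n). dif K n x \<in> parts (n - 1) S}"
    by (rule parts_least[OF d.vimage_subspc[OF parts_sub]])
      (use d_wvec wvec_parts wvec_carrier in blast)
  then show "x \<in> parts n S \<Longrightarrow> dif K n x \<in> parts (n - 1) S" by blast
qed

text \<open>
  By purity \<open>z\<close> is a boundary up to a vector \<open>w\<close> of lower weight \<open>m\<close>.  The shift by \<open>m\<close>, divided by \<open>p - m\<close>,
  fixes \<open>z\<close>, preserves boundaries, and lowers the weight of \<open>w\<close>; so \<open>w\<close> can be made zero.
\<close>

lemma wvec_cycle_boundary: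
  assumes z: "z \<in> cycles K n" "z \<in> wvec n p" and p: "of_int p \<noteq> \<alpha> * of_int n"
  shows "z \<in> boundaries K n"
proof -
  have zc: "z \<in> carrier (obj K n)" using z wvec_carrier by blast
  obtain a where a: "W n a = {\<zero>\<^bsub>obj K n\<^esub>}" using W_bot by blast
  have down: "\<exists>w\<in>W n (p - 1 - int k). z \<ominus>\<^bsub>obj K n\<^esub> w \<in> boundaries K n" for k
  proof (induction k)
    case 0
    show ?case using pure[OF p z(1) wvec_W[OF z(2)]] by auto
  next
    case (Suc k)
    let ?m = "p - 1 - int k"
    obtain w where w: "w \<in> W n ?m" "z \<ominus>\<^bsub>obj K n\<^esub> w \<in> boundaries K n" using Suc by blast
    have wc: "w \<in> carrier (obj K n)" using w W_carrier by blast
    let ?q = "inverse (of_int (p - ?m)) :: rat"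
    have "shift n ?m (z \<ominus>\<^bsub>obj K n\<^esub> w) \<in> boundaries K n"
      using boundaries_stable[OF w(2)] w(2) subspcD(3,4)[OF boundaries_sub] by (simp add: shift_def)
    then have "?q \<odot>\<^bsub>obj K n\<^esub> shift n ?m (z \<ominus>\<^bsub>obj K n\<^esub> w) \<in> boundaries K n"
      by (rule subspcD(4)[OF boundaries_sub])
    moreover have "?q \<odot>\<^bsub>obj K n\<^esub> shift n ?m (z \<ominus>\<^bsub>obj K n\<^esub> w) =
        z \<ominus>\<^bsub>obj K n\<^esub> ?q \<odot>\<^bsub>obj K n\<^esub> shift n ?m w"
    proof -
      interpret q: lin_map "obj K n" "obj K n" "\<lambda>x. ?q \<odot>\<^bsub>obj K n\<^esub> x"
        by unfold_locales (auto simp: lin_def smult_r_distr mult.commute simp flip: smult_assoc)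
      have nz: "of_int (p - ?m) \<noteq> (0::rat)" by simp
      have "?q \<odot>\<^bsub>obj K n\<^esub> shift n ?m z = z"
        unfolding shift_wvec[OF z(2)] smult_assoc[OF zc, symmetric] using nz zc by (simp del: of_int_diff)
      then show ?thesis
        by (simp only: shift.diff[OF zc wc] q.diff[OF shift.closed[OF zc] shift.closed[OF wc]])
    qed
    moreover have "?q \<odot>\<^bsub>obj K n\<^esub> shift n ?m w \<in> W n (p - 1 - int (Suc k))"
      using subspcD(4)[OF W_sub shift_W[OF w(1)]] by (simp add: algebra_simps)
    ultimately show ?case by (metis (no_types, lifting))
  qed
  obtain w where w: "w \<in> W n (p - 1 - int (nat (p - 1 - a)))" "z \<ominus>\<^bsub>obj K n\<^esub> w \<in> boundaries K n"
    using down by blast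
  have "W n (p - 1 - int (nat (p - 1 - a))) \<subseteq> W n a" by (rule W_mono) simp
  then have "w = \<zero>\<^bsub>obj K n\<^esub>" using w a by auto
  then have "z \<ominus>\<^bsub>obj K n\<^esub> w = z" using zc by (simp add: a_minus_def a_inv_eq)
  then show ?thesis using w(2) by simp
qed

definition Le :: "int \<Rightarrow> int set" where "Le n = {p. of_int p / \<alpha> \<le> of_int n}"
definition Lt :: "int \<Rightarrow> int set" where "Lt n = {p. of_int p / \<alpha> < of_int n}"
definition Eq :: "int \<Rightarrow> int set" where "Eq n = {p. of_int p / \<alpha> = of_int n}"

lemma Eq_iff: "p \<in> Eq n \<longleftrightarrow> of_int p = \<alpha> * of_int n"
  using alpha by (auto simp: Eq_def field_simps)

lemma Le_union: "Le n = Eq n \<union> Lt n" and Eq_Lt: "Eq n \<inter> Lt n = {}"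
  by (auto simp: Le_def Eq_def Lt_def)

lemma Le_Lt: "Le (n - 1) \<subseteq> Lt n" and Lt_Le: "Lt n \<subseteq> Le n" and Le_Le: "m \<le> n \<Longrightarrow> Le m \<subseteq> Le n"
  by (auto simp: Le_def Lt_def)

lemma cycle_parts_boundary:
  assumes z: "z \<in> cycles K n" "z \<in> parts n S" and S: "S \<inter> Eq n = {}"
  shows "z \<in> boundaries K n"
proof -
  have "cycles K n \<inter> parts n S \<subseteq> boundaries K n"
  proof (rule stable_induct[OF subspc_inter[OF cycles_sub parts_sub] _ boundaries_sub])
    fix p v assume v: "v \<in> cycles K n \<inter> parts n S" "v \<in> wvec n p"
    show "v \<in> boundaries K n"
    proof (cases "p \<in> S")
      case True
      then have "p \<notin> Eq n" using S by blast
      then show ?thesis using wvec_cycle_boundary[of v n p] v by (auto simp: Eq_iff)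
    next
      case False
      then have "v = \<zero>\<^bsub>obj K n\<^esub>" using wvec_inter_parts v by blast
      then show ?thesis using subspcD(2)[OF boundaries_sub] by simp
    qed
  qed (auto intro: cycles_stable parts_stable)
  then show ?thesis using z by blast
qed

lemma cycle_split:
  assumes z: "z \<in> cycles K n"
  obtains u where "u \<in> cycles K n" "u \<in> parts n (Eq n)" "z \<ominus>\<^bsub>obj K n\<^esub> u \<in> boundaries K n"
proof -
  let ?M = "{x \<oplus>\<^bsub>obj K n\<^esub> y |x y. x \<in> cycles K n \<inter> parts n (Eq n) \<and> y \<in> boundaries K n}"
  have zero: "\<zero>\<^bsub>obj K n\<^esub> \<in> cycles K n \<inter> parts n (Eq n)" "\<zero>\<^bsub>obj K n\<^esub> \<in> boundaries K n"
    using subspcD(2) cycles_sub parts_sub boundaries_sub by auto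
  have "cycles K n \<subseteq> ?M"
  proof (rule stable_induct[OF cycles_sub cycles_stable
        sum_subspc[OF subspc_inter[OF cycles_sub parts_sub] boundaries_sub]])
    fix p v assume v: "v \<in> cycles K n" "v \<in> wvec n p"
    then have vc: "v \<in> carrier (obj K n)" using cycles_carrier by blast
    show "v \<in> ?M"
    proof (cases "p \<in> Eq n")
      case True
      then have "v = v \<oplus>\<^bsub>obj K n\<^esub> \<zero>\<^bsub>obj K n\<^esub>" "v \<in> cycles K n \<inter> parts n (Eq n)"
        using v wvec_parts[of p "Eq n" n] vc by auto
      then show ?thesis using zero by blast
    next
      case False
      then have "v = \<zero>\<^bsub>obj K n\<^esub> \<oplus>\<^bsub>obj K n\<^esub> v" "v \<in> boundaries K n"
        using wvec_cycle_boundary[OF v] vc by (auto simp: Eq_iff)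
      then show ?thesis using zero by blast
    qed
  qed
  then obtain u b where ub: "z = u \<oplus>\<^bsub>obj K n\<^esub> b" "u \<in> cycles K n" "u \<in> parts n (Eq n)" "b \<in> boundaries K n"
    using z by blast
  have c: "u \<in> carrier (obj K n)" "b \<in> carrier (obj K n)"
    using ub cycles_carrier boundaries_cycles by blast+
  then have "z \<ominus>\<^bsub>obj K n\<^esub> u = b"
    unfolding ub(1) by (simp add: a_comm[of u n b]) (simp add: a_minus_def a_assoc r_neg)
  then show ?thesis using that ub by simp
qed

text \<open>
  Strictness of the differential: components of \<open>y\<close> with weights outside \<open>S\<close> are cycles and may be dropped.
\<close>

lemma boundary_parts:
  assumes y: "y \<in> carrier (obj K (n + 1))" "dif K (n + 1) y \<in> parts n S"
  obtains y' where "y' \<in> parts (n + 1) S" "dif K (n + 1) y' = dif K (n + 1) y"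
proof -
  let ?N = "{y \<in> carrier (obj K (n + 1)). dif K (n + 1) y \<in> parts n S}"
  let ?M = "{y \<in> carrier (obj K (n + 1)). dif K (n + 1) y \<in> dif K (n + 1) ` parts (n + 1) S}"
  have N: "subspc (obj K (n + 1)) ?N" using d.vimage_subspc[of "n + 1" "parts n S"] parts_sub by simp
  have M: "subspc (obj K (n + 1)) ?M"
    using d.vimage_subspc[OF d.image_subspc[OF parts_sub]] .
  have "?N \<subseteq> ?M"
  proof (rule stable_induct[OF N _ M])
    fix x assume x: "x \<in> ?N"
    have "dif K (n + 1) (Y (n + 1) x) = Y n (dif K (n + 1) x)" using Y_dif[of x "n + 1"] x by simp
    then show "Y (n + 1) x \<in> ?N" using x parts_stable by auto
  next
    fix p v assume v: "v \<in> ?N" "v \<in> wvec (n + 1) p"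
    show "v \<in> ?M"
    proof (cases "p \<in> S")
      case True
      then show ?thesis using v wvec_parts[of p S "n + 1"] by blast
    next
      case False
      have "dif K (n + 1) v \<in> wvec n p" using d_wvec[OF v(2)] by simp
      then have "dif K (n + 1) v = \<zero>\<^bsub>obj K n\<^esub>" using wvec_inter_parts False v(1) by blast
      then have "dif K (n + 1) v = dif K (n + 1) \<zero>\<^bsub>obj K (n + 1)\<^esub>" using d.zero[of "n + 1"] by simp
      then show ?thesis using v(1) subspcD(2)[OF parts_sub] by blast
    qed
  qed
  then have "dif K (n + 1) y \<in> dif K (n + 1) ` parts (n + 1) S" using y by blast
  then obtain y' where "dif K (n + 1) y = dif K (n + 1) y'" "y' \<in> parts (n + 1) S" by (rule imageE)
  then show ?thesis by (intro that[of y']) simp_all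
qed

definition trunc :: "int \<Rightarrow> 'a set"
  where "trunc n = {x \<in> parts n (Le n). dif K n x \<in> parts (n - 1) (Le (n - 1))}"

lemma trunc_sub: "subspc (obj K n) (trunc n)"
proof -
  have "trunc n = parts n (Le n) \<inter> {x \<in> carrier (obj K n). dif K n x \<in> parts (n - 1) (Le (n - 1))}"
    using parts_carrier by (auto simp: trunc_def)
  then show ?thesis using subspc_inter[OF parts_sub d.vimage_subspc[OF parts_sub]] by simp
qed

lemma trunc_carrier: "trunc n \<subseteq> carrier (obj K n)"
  using subspcD(1)[OF trunc_sub] .

lemma cycle_trunc: "z \<in> cycles K n \<Longrightarrow> z \<in> parts n (Le n) \<Longrightarrow> z \<in> trunc n"
  using subspcD(2)[OF parts_sub] by (auto simp: trunc_def cycles_def)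

lemma d_trunc: "x \<in> trunc n \<Longrightarrow> dif K n x \<in> trunc (n - 1)"
proof -
  assume x: "x \<in> trunc n"
  have "dif K (n - 1) (dif K n x) = \<zero>\<^bsub>obj K (n - 1 - 1)\<^esub>" using d_d[of x n] x trunc_carrier by auto
  then show ?thesis using x subspcD(2)[OF parts_sub[of "n - 1 - 1"]] unfolding trunc_def by simp
qed

text \<open>
  A representative of the component of slope exactly \<open>n\<close> of \<open>x\<close>, determined up to boundaries of smaller slope.
\<close>

definition symbol :: "int \<Rightarrow> 'a \<Rightarrow> 'a \<Rightarrow> bool"
  where "symbol n x z \<longleftrightarrow> z \<in> cycles K n \<and> z \<in> parts n (Le n) \<and> x \<ominus>\<^bsub>obj K n\<^esub> z \<in> parts n (Lt n)"

text \<open>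
  The component of slope \<open>n\<close> is a cycle, as its differential has slope \<open>n\<close> while the differential of \<open>x\<close>
  has slopes at most \<open>n - 1\<close>.
\<close>

lemma symbol_exists:
  assumes x: "x \<in> trunc n"
  shows "\<exists>z. symbol n x z"
proof -
  have "x \<in> parts n (Eq n \<union> Lt n)" using x Le_union[of n] by (simp add: trunc_def)
  then obtain u e where ue: "x = u \<oplus>\<^bsub>obj K n\<^esub> e" "u \<in> parts n (Eq n)" "e \<in> parts n (Lt n)"
    by (rule parts_union)
  have c: "u \<in> carrier (obj K n)" "e \<in> carrier (obj K n)" using ue parts_carrier by blast+
  have "dif K n x \<ominus>\<^bsub>obj K (n - 1)\<^esub> dif K n e \<in> parts (n - 1) (Lt n)"
  proof (rule subspcD(5)[OF parts_sub])
    show "dif K n x \<in> parts (n - 1) (Lt n)" using x parts_mono[OF Le_Lt] by (auto simp: trunc_def)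
    show "dif K n e \<in> parts (n - 1) (Lt n)" using d_parts ue by blast
  qed
  moreover have "dif K n x \<ominus>\<^bsub>obj K (n - 1)\<^esub> dif K n e = dif K n u"
    using c by (simp add: ue(1) d.add a_minus_def a_assoc r_neg)
  ultimately have "dif K n u \<in> parts (n - 1) (Lt n)" by simp
  then have "dif K n u = \<zero>\<^bsub>obj K (n - 1)\<^esub>"
    using parts_disjoint[OF Eq_Lt] d_parts[OF ue(2)] by blast
  then have "u \<in> cycles K n" using c by (simp add: cycles_def)
  moreover have "x \<ominus>\<^bsub>obj K n\<^esub> u = e"
    unfolding ue(1) using c by (simp add: a_comm[of u n e]) (simp add: a_minus_def a_assoc r_neg)
  moreover have "u \<in> parts n (Le n)" using ue(2) parts_mono[of "Eq n" "Le n" n] Le_union by blast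
  ultimately show ?thesis using ue(3) by (auto simp: symbol_def)
qed

definition to_homology :: "int \<Rightarrow> 'a \<Rightarrow> 'a set"
  where "to_homology n x = hcls n (SOME z. symbol n x z)"

text \<open>
  Two candidates differ by a cycle of slopes smaller than \<open>n\<close>, which is a boundary.
\<close>

lemma to_homology_eq:
  assumes x: "x \<in> carrier (obj K n)" and z: "z \<in> cycles K n" "x \<ominus>\<^bsub>obj K n\<^esub> z \<in> parts n (Lt n)"
    and ex: "symbol n x z'"
  shows "to_homology n x = hcls n z"
proof -
  define z0 where "z0 = (SOME z. symbol n x z)"
  have z0: "symbol n x z0" unfolding z0_def using ex by (rule someI)
  then have z0': "z0 \<in> cycles K n" "x \<ominus>\<^bsub>obj K n\<^esub> z0 \<in> parts n (Lt n)" by (auto simp: symbol_def)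
  have c: "z \<in> carrier (obj K n)" "z0 \<in> carrier (obj K n)" using z z0' cycles_carrier by blast+
  have "(x \<ominus>\<^bsub>obj K n\<^esub> z) \<ominus>\<^bsub>obj K n\<^esub> (x \<ominus>\<^bsub>obj K n\<^esub> z0) \<in> parts n (Lt n)"
    using z z0' subspcD(5)[OF parts_sub] by blast
  moreover have "(x \<ominus>\<^bsub>obj K n\<^esub> z) \<ominus>\<^bsub>obj K n\<^esub> (x \<ominus>\<^bsub>obj K n\<^esub> z0) = z0 \<ominus>\<^bsub>obj K n\<^esub> z"
  proof -
    have "z0 \<oplus>\<^bsub>obj K n\<^esub> \<ominus>\<^bsub>obj K n\<^esub> z = (x \<oplus>\<^bsub>obj K n\<^esub> \<ominus>\<^bsub>obj K n\<^esub> x) \<oplus>\<^bsub>obj K n\<^esub> (\<ominus>\<^bsub>obj K n\<^esub> z \<oplus>\<^bsub>obj K n\<^esub> z0)"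
      using x c by (simp add: r_neg a_comm)
    also have "\<dots> = (x \<oplus>\<^bsub>obj K n\<^esub> \<ominus>\<^bsub>obj K n\<^esub> z) \<oplus>\<^bsub>obj K n\<^esub> (\<ominus>\<^bsub>obj K n\<^esub> x \<oplus>\<^bsub>obj K n\<^esub> z0)"
      using x c by (simp add: a_assoc a_lcomm)
    finally show ?thesis using x c by (simp add: a_minus_def minus_add)
  qed
  ultimately have "z0 \<ominus>\<^bsub>obj K n\<^esub> z \<in> parts n (Lt n)" by simp
  moreover have "z0 \<ominus>\<^bsub>obj K n\<^esub> z \<in> cycles K n" using z z0' subspcD(5)[OF cycles_sub] by blast
  ultimately have "z0 \<ominus>\<^bsub>obj K n\<^esub> z \<in> boundaries K n"
    using cycle_parts_boundary Eq_Lt by (metis Int_commute)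
  then show ?thesis
    unfolding to_homology_def z0_def[symmetric] using rcos_eq_iff[OF boundaries_sub c(2,1)] by simp
qed

lemma to_homology_symbol: "x \<in> carrier (obj K n) \<Longrightarrow> symbol n x z \<Longrightarrow> to_homology n x = hcls n z"
  using to_homology_eq by (auto simp: symbol_def)

lemma symbol_zero: "x \<in> cycles K n \<Longrightarrow> x \<in> parts n (Le n) \<Longrightarrow> symbol n x x"
  using subspcD(2)[OF parts_sub, of n "Lt n"] cycles_carrier[of n] diff_eq_zero_iff[of x n x]
  by (auto simp: symbol_def)

lemma symbol_add:
  assumes "symbol n x z" "symbol n x' z'" "x \<in> carrier (obj K n)" "x' \<in> carrier (obj K n)"
  shows "symbol n (x \<oplus>\<^bsub>obj K n\<^esub> x') (z \<oplus>\<^bsub>obj K n\<^esub> z')"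
proof -
  have c: "z \<in> carrier (obj K n)" "z' \<in> carrier (obj K n)"
    using assms cycles_carrier by (auto simp: symbol_def)
  have "(x \<oplus>\<^bsub>obj K n\<^esub> x') \<ominus>\<^bsub>obj K n\<^esub> (z \<oplus>\<^bsub>obj K n\<^esub> z') =
      (x \<ominus>\<^bsub>obj K n\<^esub> z) \<oplus>\<^bsub>obj K n\<^esub> (x' \<ominus>\<^bsub>obj K n\<^esub> z')"
    using c assms(3,4) by (simp add: a_minus_def minus_add a_assoc a_lcomm)
  then show ?thesis
    using assms(1,2) subspcD(3)[OF parts_sub] subspcD(3)[OF cycles_sub] by (auto simp: symbol_def)
qed

lemma symbol_smult:
  assumes "symbol n x z" "x \<in> carrier (obj K n)"
  shows "symbol n (q \<odot>\<^bsub>obj K n\<^esub> x) (q \<odot>\<^bsub>obj K n\<^esub> z)"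
proof -
  have c: "z \<in> carrier (obj K n)" using assms cycles_carrier by (auto simp: symbol_def)
  have "q \<odot>\<^bsub>obj K n\<^esub> x \<ominus>\<^bsub>obj K n\<^esub> q \<odot>\<^bsub>obj K n\<^esub> z = q \<odot>\<^bsub>obj K n\<^esub> (x \<ominus>\<^bsub>obj K n\<^esub> z)"
    using c assms(2) by (simp add: a_minus_def a_inv_eq smult_r_distr mult.commute flip: smult_assoc)
  then show ?thesis
    using assms(1) subspcD(4)[OF parts_sub] subspcD(4)[OF cycles_sub] by (auto simp: symbol_def)
qed

end

section \<open>Weights of products\<close>

lemma (in mhs) mhs_weighted: "weighted (space V) (wt V) (grading V)"
  using is_mhsD[OF is_mhs] grading_lin grading_weight by unfold_locales (auto simp: vs_def)

text \<open>
  The differential commutes with \<open>grading\<close> by the Leibniz rule for one input; the hypothesis on the graded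
  pieces of homology says that, unless \<open>p = \<alpha> n\<close>, a cycle of weight at most \<open>p\<close> in degree \<open>n\<close> is homologous to
  one of weight at most \<open>p - 1\<close>.
\<close>

lemma pure_complexI:
  assumes \<alpha>: "\<alpha> \<noteq> 0" and K: "is_mhs_complex K" and p: "alpha_pure \<alpha> K"
  shows "pure_complex (underlying K) (\<lambda>n. wt (obj K n)) (\<lambda>n. grading (obj K n)) \<alpha>"
proof -
  have ch: "is_ch (underlying K)" and mhs: "is_mhs (obj K n)"
    and hom: "mhs_hom (obj K n) (obj K (n - 1)) (dif K n)" for n
    using K by (auto simp: is_mhs_complex_def)
  interpret M: mhs "obj K n" for n by unfold_locales (rule mhs)
  have [simp]: "obj (underlying K) n = space (obj K n)" "dif (underlying K) n = dif K n" for n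
    by (simp_all add: underlying_def)
  have lin: "lin (space (obj K n)) (space (obj K (n - 1))) (dif K n)" for n
    using ch by (simp add: is_ch_def underlying_def)
  interpret d: lin_map "space (obj K n)" "space (obj K (n - 1))" "dif K n" for n
    using lin by unfold_locales
  show ?thesis
  proof (intro pure_complex.intro chain_complex.intro pure_complex_axioms.intro, goal_cases)
    case 1 show ?case by (rule ch)
  next
    case (2 n) show ?case using M.mhs_weighted by simp
  next
    case (3 n x)
    then have x: "x \<in> carrier (space (obj K n))" by simp
    (* The differential is a multilinear map with one input. *)
    interpret C: compat "[obj K n]" "obj K (n - 1)" "\<lambda>xs. dif K n (hd xs)"
      by unfold_locales (rule mhs_compat_hom[OF mhs mhs hom])
    have "C.M.ok [x]" unfolding C.M.ok_def using x by simp
    have "dif K n (grading (obj K n) x) \<in> carrier (space (obj K (n - 1)))"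
      using M.grading_lin x by (intro d.closed) (simp add: lin_def)
    then show ?case
      using C.grading_leibniz[OF \<open>C.M.ok [x]\<close>] by (simp add: lessThan_Suc)
  next
    case 4 show ?case by (rule \<alpha>)
  next
    case (5 n p' x)
    let ?V = "space (obj K n)" and ?Z = "cycles (underlying K) n" and ?B = "boundaries (underlying K) n"
    let ?H = "homology_mhs K n"
    have Z: "subspc ?V ?Z" using d.vimage_subspc[OF M.S.subspc_zero, of n]
      by (simp add: cycles_def)
    have B: "subspc ?V ?B" using d.image_subspc[of "n + 1", OF M.S.subspc_carrier] by (simp add: boundaries_def)
    have dd: "\<And>x. x \<in> carrier (space (obj K (n + 1))) \<Longrightarrow> dif K n (dif K (n + 1) x) = \<zero>\<^bsub>space (obj K (n - 1))\<^esub>"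
    proof -
      have "\<forall>x\<in>carrier (obj (underlying K) (n + 1)). dif (underlying K) (n + 1 - 1) (dif (underlying K) (n + 1) x) =
          \<zero>\<^bsub>obj (underlying K) (n + 1 - 2)\<^esub>"
        using ch unfolding is_ch_def by blast
      then show "\<And>x. x \<in> carrier (space (obj K (n + 1))) \<Longrightarrow> dif K n (dif K (n + 1) x) = \<zero>\<^bsub>space (obj K (n - 1))\<^esub>"
        by simp
    qed
    have dcl: "dif K (n + 1) y \<in> carrier ?V" if "y \<in> carrier (space (obj K (n + 1)))" for y
      using d.closed[OF that] by simp
    have BZ: "?B \<subseteq> ?Z" using dd dcl by (auto simp: boundaries_def cycles_def)
    note sq = subquot_simps[OF M.S.vs_axioms Z B BZ]
    have H: "space ?H = subquot ?V ?Z ?B" "wt ?H q = (\<lambda>x. ?B +>\<^bsub>?V\<^esub> x) ` (?Z \<inter> wt (obj K n) q)" for q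
      by (simp_all add: homology_mhs_def subquot_mhs_def)
    have vH: "vs (space ?H)" using sq(5) by (simp add: H)
    have linH: "lin (?V\<lparr>carrier := ?Z\<rparr>) (space ?H) (\<lambda>x. ?B +>\<^bsub>?V\<^esub> x)"
      using sq(1,3,4) by (auto simp: lin_def H)
    have wsub: "subspc (space ?H) (wt ?H q)" for q
    proof -
      interpret l: lin_map "?V\<lparr>carrier := ?Z\<rparr>" "space ?H" "\<lambda>x. ?B +>\<^bsub>?V\<^esub> x"
        using linH vH M.S.restrict_carrier[OF Z] by (intro lin_mapI)
      have "subspc (?V\<lparr>carrier := ?Z\<rparr>) (?Z \<inter> wt (obj K n) q)"
        using M.S.subspc_inter[OF Z M.wt_sub[of n q]] by (auto simp: l.V.subspc_iff M.S.subspc_iff)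
      from l.image_subspc[OF this] show ?thesis by (simp add: H)
    qed
    have wmono: "wt ?H (p' - 1) \<subseteq> wt ?H p'"
      using is_mhsD(3)[OF mhs, of "p' - 1" p' n] by (auto simp: H)
    let ?G = "space (gr_wt ?H p')"
    have Gs: "?G = subquot (space ?H) (wt ?H p') (wt ?H (p' - 1))" by (simp add: gr_wt_def subquot_mhs_def)
    have "carrier ?G = {\<zero>\<^bsub>?G\<^esub>}" using p 5(1) by (auto simp: alpha_pure_def Let_def)
    then have G0: "(\<lambda>X. wt ?H (p' - 1) +>\<^bsub>space ?H\<^esub> X) ` wt ?H p' = {wt ?H (p' - 1)}"
      unfolding Gs subquot_simps(1,2)[OF vH wsub wsub wmono] .
    have X: "?B +>\<^bsub>?V\<^esub> x \<in> wt ?H p'" using 5 by (auto simp: H)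
    then have "wt ?H (p' - 1) +>\<^bsub>space ?H\<^esub> (?B +>\<^bsub>?V\<^esub> x) = wt ?H (p' - 1)"
      using imageI[OF X, of "\<lambda>X. wt ?H (p' - 1) +>\<^bsub>space ?H\<^esub> X"] unfolding G0 by simp
    moreover have "?B +>\<^bsub>?V\<^esub> x \<in> carrier (space ?H)" using X vs.subspcD(1)[OF vH wsub] by blast
    ultimately have "?B +>\<^bsub>?V\<^esub> x \<in> wt ?H (p' - 1)"
      using vs.rcos_eq_zero_iff[OF vH wsub] by blast
    then obtain y where y: "y \<in> ?Z \<inter> wt (obj K n) (p' - 1)" "?B +>\<^bsub>?V\<^esub> x = ?B +>\<^bsub>?V\<^esub> y" by (auto simp: H)
    then have "x \<ominus>\<^bsub>?V\<^esub> y \<in> ?B"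
      using M.S.rcos_eq_iff[OF B, of x y] 5(2) M.S.subspcD(1)[OF Z] by auto
    then show ?case using y by auto
  qed
qed

text \<open>
  The difference of the values telescopes by changing one argument at a time.
\<close>

lemma (in multilin_map) ok_diff_telescope:
  assumes xs: "ok xs" and zs: "ok zs" and N: "subspc V N"
    and step: "\<And>k ws. k < length Vs \<Longrightarrow> ok ws \<Longrightarrow> (\<And>i. i < length Vs \<Longrightarrow> ws ! i = xs ! i \<or> ws ! i = zs ! i) \<Longrightarrow>
      f (ws[k := xs ! k \<ominus>\<^bsub>Vs ! k\<^esub> zs ! k]) \<in> N"
  shows "f xs \<ominus>\<^bsub>V\<^esub> f zs \<in> N"
proof -
  have len: "length xs = length Vs" "length zs = length Vs" using xs zs by (auto simp: ok_def)
  have "k \<le> length Vs \<Longrightarrow> f (take k xs @ drop k zs) \<ominus>\<^bsub>V\<^esub> f zs \<in> N" for k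
  proof (induction k)
    case 0
    then show ?case using T.subspcD(2)[OF N] closed[OF zs] by (simp add: T.r_neg a_minus_def)
  next
    case (Suc k)
    then have k: "k < length Vs" by simp
    let ?m = "take k xs @ drop k zs"
    have okm: "ok ?m" using xs zs k by (auto simp: ok_def nth_append)
    have mix: "?m ! i = xs ! i \<or> ?m ! i = zs ! i" if "i < length Vs" for i
      using that len by (auto simp: nth_append)
    have m0: "?m = ?m[k := zs ! k]" and m1: "take (Suc k) xs @ drop (Suc k) zs = ?m[k := xs ! k]"
      using k len by (auto intro!: nth_equalityI simp: nth_append nth_list_update)
    interpret l: lin_map "Vs ! k" V "\<lambda>x. f (?m[k := x])"
      by (intro lin_mapI vss target slot_lin okm k)
    have c: "xs ! k \<in> carrier (Vs ! k)" "zs ! k \<in> carrier (Vs ! k)" using xs zs k by (auto simp: ok_def)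
    have "f (?m[k := xs ! k]) \<ominus>\<^bsub>V\<^esub> f (?m[k := zs ! k]) \<in> N"
      using step[OF k okm mix] l.diff[OF c] by simp
    then have a: "f (?m[k := xs ! k]) \<ominus>\<^bsub>V\<^esub> f ?m \<in> N" by (simp flip: m0)
    have b: "f ?m \<ominus>\<^bsub>V\<^esub> f zs \<in> N" using Suc by simp
    have cc: "f (?m[k := xs ! k]) \<in> carrier V" "f ?m \<in> carrier V" "f zs \<in> carrier V"
      using closed okm zs ok_update[OF okm k c(1)] by auto
    have "(f (?m[k := xs ! k]) \<ominus>\<^bsub>V\<^esub> f ?m) \<oplus>\<^bsub>V\<^esub> (f ?m \<ominus>\<^bsub>V\<^esub> f zs) = f (?m[k := xs ! k]) \<ominus>\<^bsub>V\<^esub> f zs"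
      using cc by (simp add: a_minus_def T.a_assoc) (simp add: T.l_neg flip: T.a_assoc)
    then show ?case using T.subspcD(3)[OF N a b] m1 by simp
  qed
  from this[of "length Vs"] show ?thesis using len by simp
qed

abbreviation mhs_parts :: "'a mhs \<Rightarrow> int set \<Rightarrow> 'a set"
  where "mhs_parts V S \<equiv> weighted.parts (space V) (grading V) S"

abbreviation mhs_wvec :: "'a mhs \<Rightarrow> int \<Rightarrow> 'a set"
  where "mhs_wvec V p \<equiv> weighted.wvec (space V) (grading V) p"

context compat
begin

text \<open>
  By the Leibniz rule the eigenvalues of the factors add up.
\<close>

lemma wvec_product:
  assumes len: "length xs = length Vs" "length ps = length Vs"
    and xs: "\<And>i. i < length Vs \<Longrightarrow> xs ! i \<in> mhs_wvec (Vs ! i) (ps ! i)"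
  shows "f xs \<in> mhs_wvec V (sum_list ps)"
proof -
  interpret Vw: weighted "space V" "wt V" "grading V" by (rule V.mhs_weighted)
  have x: "xs ! i \<in> carrier (space (Vs ! i))"
    "grading (Vs ! i) (xs ! i) = of_int (ps ! i) \<odot>\<^bsub>space (Vs ! i)\<^esub> (xs ! i)" if "i < length Vs" for i
    using xs[OF that] weighted.wvec_def[OF mhs.mhs_weighted[OF source[OF that]]] by auto
  have ok: "M.ok xs" using len x by (simp add: M.ok_def)
  have c: "f xs \<in> carrier (space V)" by (rule M.closed[OF ok])
  have slot: "f (xs[j := grading (Vs ! j) (xs ! j)]) = of_int (ps ! j) \<odot>\<^bsub>space V\<^esub> f xs" if "j < length Vs" for j
    using M.slot_lin[OF ok, of j] x[OF that] that by (simp add: lin_def)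
  have "grading V (f xs) = (\<Oplus>\<^bsub>space V\<^esub>j\<in>{..<length Vs}. of_int (ps ! j) \<odot>\<^bsub>space V\<^esub> f xs)"
    unfolding grading_leibniz[OF ok] using c slot by (intro V.S.finsum_cong') auto
  also have "\<dots> = of_int (\<Sum>j<length Vs. ps ! j) \<odot>\<^bsub>space V\<^esub> f xs"
  proof (induction "length Vs")
    case 0 then show ?case using c by simp
  next
    case (Suc n)
    have "(\<lambda>j. of_int (ps ! j) \<odot>\<^bsub>space V\<^esub> f xs) \<in> {..<n} \<rightarrow> carrier (space V)" using c by auto
    moreover have "(\<Oplus>\<^bsub>space V\<^esub>j\<in>{..<n}. of_int (ps ! j) \<odot>\<^bsub>space V\<^esub> f xs) = of_int (\<Sum>j<n. ps ! j) \<odot>\<^bsub>space V\<^esub> f xs" for n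
    proof (induction n)
      case 0 then show ?case using c by simp
    next
      case (Suc n)
      have "(\<lambda>j. of_int (ps ! j) \<odot>\<^bsub>space V\<^esub> f xs) \<in> {..<n} \<rightarrow> carrier (space V)" using c by auto
      then show ?case using Suc c by (simp add: lessThan_Suc V.S.smult_l_distr V.S.a_comm)
    qed
    ultimately show ?case by metis
  qed
  also have "(\<Sum>j<length Vs. ps ! j) = sum_list ps"
    using len by (simp add: sum_list_sum_nth atLeast0LessThan)
  finally show ?thesis using c by (simp add: Vw.wvec_def)
qed

lemma parts_product:
  assumes len: "length xs = length Vs" and xs: "\<And>i. i < length Vs \<Longrightarrow> xs ! i \<in> mhs_parts (Vs ! i) (S i)"
    and S': "\<And>ps. length ps = length Vs \<Longrightarrow> (\<And>i. i < length Vs \<Longrightarrow> ps ! i \<in> S i) \<Longrightarrow> sum_list ps \<in> S'"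
  shows "f xs \<in> mhs_parts V S'"
proof -
  interpret Vw: weighted "space V" "wt V" "grading V" by (rule V.mhs_weighted)
  have w: "weighted (space (Vs ! i)) (wt (Vs ! i)) (grading (Vs ! i))" if "i < length Vs" for i
    using mhs.mhs_weighted[OF source[OF that]] .
  show ?thesis
  proof (rule slotwise_closure[where n = "length Vs" and B = "\<lambda>i. mhs_parts (Vs ! i) (S i)"
      and A = "\<lambda>i. \<Union>p\<in>S i. mhs_wvec (Vs ! i) p" and P = "\<lambda>xs. f xs \<in> mhs_parts V S'"])
    show "(\<Union>p\<in>S i. mhs_wvec (Vs ! i) p) \<subseteq> mhs_parts (Vs ! i) (S i)" if "i < length Vs" for i
      using weighted.wvec_parts[OF w[OF that]] by blast
    fix zs assume h: "length zs = length Vs" "\<And>i. i < length Vs \<Longrightarrow> zs ! i \<in> (\<Union>p\<in>S i. mhs_wvec (Vs ! i) p)"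
    then have "\<exists>p. i < length Vs \<longrightarrow> p \<in> S i \<and> zs ! i \<in> mhs_wvec (Vs ! i) p" for i by auto
    then obtain p where p: "\<And>i. i < length Vs \<Longrightarrow> p i \<in> S i \<and> zs ! i \<in> mhs_wvec (Vs ! i) (p i)" by metis
    let ?ps = "map p [0..<length Vs]"
    have "f zs \<in> mhs_wvec V (sum_list ?ps)" using h(1) p by (intro wvec_product) auto
    moreover have "sum_list ?ps \<in> S'" using p by (intro S') auto
    ultimately show "f zs \<in> mhs_parts V S'" using Vw.wvec_parts by blast
  next
    fix zs j z assume h: "length zs = length Vs" "j < length Vs"
      "\<And>i. i < length Vs \<Longrightarrow> i \<noteq> j \<Longrightarrow> zs ! i \<in> mhs_parts (Vs ! i) (S i)"
      "\<And>a. a \<in> (\<Union>p\<in>S j. mhs_wvec (Vs ! j) p) \<Longrightarrow> f (zs[j := a]) \<in> mhs_parts V S'"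
      and z: "z \<in> mhs_parts (Vs ! j) (S j)"
    interpret Vj: weighted "space (Vs ! j)" "wt (Vs ! j)" "grading (Vs ! j)" by (rule w[OF h(2)])
    let ?zs = "zs[j := \<zero>\<^bsub>space (Vs ! j)\<^esub>]"
    have ok: "M.ok ?zs"
      using h(1-3) weighted.parts_carrier[OF w] by (auto simp: M.ok_def nth_list_update)
    interpret l: lin_map "space (Vs ! j)" "space V" "\<lambda>x. f (?zs[j := x])"
      using M.slot_lin[OF ok, of j] h(2) by (intro lin_mapI Vj.vs_axioms V.S.vs_axioms) simp
    have "mhs_parts (Vs ! j) (S j) \<subseteq> {x \<in> carrier (space (Vs ! j)). f (?zs[j := x]) \<in> mhs_parts V S'}"
      by (rule Vj.parts_least[OF l.vimage_subspc[OF Vw.parts_sub]]) (use h(4) Vj.wvec_carrier in auto)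
    then show "f (zs[j := z]) \<in> mhs_parts V S'" using z by auto
  qed (use len xs in auto)
qed

end

section \<open>The truncation of a complex of mixed Hodge structures\<close>

abbreviation weight_op :: "'a mhs_complex \<Rightarrow> int \<Rightarrow> 'a \<Rightarrow> 'a"
  where "weight_op K \<equiv> \<lambda>n. grading (obj K n)"

definition trunc_part :: "rat \<Rightarrow> 'a mhs_complex \<Rightarrow> int \<Rightarrow> 'a set"
  where "trunc_part \<alpha> K = pure_complex.trunc (underlying K) (weight_op K) \<alpha>"

definition has_symbol :: "rat \<Rightarrow> 'a mhs_complex \<Rightarrow> int \<Rightarrow> 'a \<Rightarrow> 'a \<Rightarrow> bool"
  where "has_symbol \<alpha> K = pure_complex.symbol (underlying K) (weight_op K) \<alpha>"

definition symbol_class :: "rat \<Rightarrow> 'a mhs_complex \<Rightarrow> int \<Rightarrow> 'a \<Rightarrow> 'a set"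
  where "symbol_class \<alpha> K = pure_complex.to_homology (underlying K) (weight_op K) \<alpha>"

definition trunc_ch :: "rat \<Rightarrow> 'a mhs_complex \<Rightarrow> 'a ch"
  where "trunc_ch \<alpha> K = \<lparr>obj = (\<lambda>n. (space (obj K n))\<lparr>carrier := trunc_part \<alpha> K n\<rparr>),
    dif = (\<lambda>n. restrict (dif K n) (trunc_part \<alpha> K n))\<rparr>"

definition trunc_functor :: "rat \<Rightarrow> ('a mhs_complex, 'a multimor, 'a) ch_functor"
  where "trunc_functor \<alpha> = \<lparr>on_col = trunc_ch \<alpha>, on_op = (\<lambda>Ks L f. restr (map (trunc_ch \<alpha>) Ks) f)\<rparr>"

lemma underlying_simps [simp]: "obj (underlying K) n = space (obj K n)" "dif (underlying K) = dif K"
  by (simp_all add: underlying_def)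

lemma trunc_ch_simps [simp]:
  "carrier (obj (trunc_ch \<alpha> K) n) = trunc_part \<alpha> K n" "zero (obj (trunc_ch \<alpha> K) n) = \<zero>\<^bsub>space (obj K n)\<^esub>"
  "add (obj (trunc_ch \<alpha> K) n) = add (space (obj K n))" "smult (obj (trunc_ch \<alpha> K) n) = smult (space (obj K n))"
  "dif (trunc_ch \<alpha> K) n = restrict (dif K n) (trunc_part \<alpha> K n)"
  by (simp_all add: trunc_ch_def)

lemma homology_ch_simps [simp]:
  "obj (homology_ch K) n = homology K n"
  "dif (homology_ch K) n = restrict (\<lambda>X. \<zero>\<^bsub>homology K (n - 1)\<^esub>) (carrier (homology K n))"
  by (simp_all add: homology_ch_def)

locale pure_mhs_complex =
  fixes \<alpha> :: rat and K :: "'a mhs_complex"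
  assumes alpha_nz: "\<alpha> \<noteq> 0" and mhs_complex: "is_mhs_complex K" and alpha_pure: "alpha_pure \<alpha> K"
begin

sublocale P: pure_complex "underlying K" "\<lambda>n. wt (obj K n)" "weight_op K" \<alpha>
  by (rule pure_complexI[OF alpha_nz mhs_complex alpha_pure])

lemma trunc_part_sub: "subspc (space (obj K n)) (trunc_part \<alpha> K n)"
  using P.trunc_sub[of n] by (simp add: trunc_part_def)

lemma trunc_part_carrier: "trunc_part \<alpha> K n \<subseteq> carrier (space (obj K n))"
  using P.trunc_carrier[of n] by (simp add: trunc_part_def)

lemma d_trunc_part: "x \<in> trunc_part \<alpha> K n \<Longrightarrow> dif K n x \<in> trunc_part \<alpha> K (n - 1)"
  using P.d_trunc[of x n] by (simp add: trunc_part_def)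

lemma trunc_is_ch: "is_ch (trunc_ch \<alpha> K)"
  unfolding is_ch_def
proof (intro allI conjI ballI)
  fix n
  show "vspace (obj (trunc_ch \<alpha> K) n)"
    using vs.restrict_carrier[OF P.vs_axioms[of n], of "trunc_part \<alpha> K n"] trunc_part_sub by (simp add: vs_def trunc_ch_def)
  show "lin (obj (trunc_ch \<alpha> K) n) (obj (trunc_ch \<alpha> K) (n - 1)) (dif (trunc_ch \<alpha> K) n)"
    using P.d_lin[of n] trunc_part_sub[of n] d_trunc_part[of _ n] trunc_part_carrier[of n] P.subspcD(3,4)[of n "trunc_part \<alpha> K n"]
    unfolding lin_def by (auto simp: subset_iff)
  show "dif (trunc_ch \<alpha> K) n \<in> extensional (carrier (obj (trunc_ch \<alpha> K) n))" by simp
  fix x assume x: "x \<in> carrier (obj (trunc_ch \<alpha> K) n)"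
  then show "dif (trunc_ch \<alpha> K) (n - 1) (dif (trunc_ch \<alpha> K) n x) = \<zero>\<^bsub>obj (trunc_ch \<alpha> K) (n - 2)\<^esub>"
    using P.d_d[of x n] trunc_part_carrier[of n] d_trunc_part by auto
qed

lemma trunc_cycles: "cycles (trunc_ch \<alpha> K) n = cycles (underlying K) n \<inter> trunc_part \<alpha> K n"
  using trunc_part_carrier by (auto simp: cycles_def)

text \<open>
  By strictness a boundary in the truncation bounds an element of the truncation, which makes the
  inclusion injective on homology.
\<close>

lemma trunc_boundaries: "boundaries (trunc_ch \<alpha> K) n = cycles (underlying K) n \<inter> trunc_part \<alpha> K n \<inter> boundaries (underlying K) n"
proof
  show "boundaries (trunc_ch \<alpha> K) n \<subseteq> cycles (underlying K) n \<inter> trunc_part \<alpha> K n \<inter> boundaries (underlying K) n"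
  proof
    fix x assume "x \<in> boundaries (trunc_ch \<alpha> K) n"
    then obtain y where y: "y \<in> trunc_part \<alpha> K (n + 1)" "x = dif K (n + 1) y" by (auto simp: boundaries_def)
    then have "x \<in> boundaries (underlying K) n" using trunc_part_carrier by (auto simp: boundaries_def)
    then show "x \<in> cycles (underlying K) n \<inter> trunc_part \<alpha> K n \<inter> boundaries (underlying K) n"
      using P.boundaries_cycles d_trunc_part[OF y(1)] y(2) by auto
  qed
  show "cycles (underlying K) n \<inter> trunc_part \<alpha> K n \<inter> boundaries (underlying K) n \<subseteq> boundaries (trunc_ch \<alpha> K) n"
  proof
    fix x assume x: "x \<in> cycles (underlying K) n \<inter> trunc_part \<alpha> K n \<inter> boundaries (underlying K) n"
    then obtain y where y: "y \<in> carrier (space (obj K (n + 1)))" "x = dif K (n + 1) y" by (auto simp: boundaries_def)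
    have xp: "dif K (n + 1) y \<in> P.parts n (P.Le n)" using x y unfolding trunc_part_def P.trunc_def by auto
    obtain y' where y': "y' \<in> P.parts (n + 1) (P.Le n)" "dif K (n + 1) y' = dif K (n + 1) y"
      using P.boundary_parts[of y n "P.Le n"] y(1) xp by auto
    have "y' \<in> P.parts (n + 1) (P.Le (n + 1))" using P.parts_mono[OF P.Le_Le[of n "n + 1"]] y'(1) by auto
    then have "y' \<in> trunc_part \<alpha> K (n + 1)" unfolding trunc_part_def P.trunc_def using y' xp by simp
    then have "x = dif (trunc_ch \<alpha> K) (n + 1) y'" "y' \<in> carrier (obj (trunc_ch \<alpha> K) (n + 1))"
      using y y' by simp_all
    then show "x \<in> boundaries (trunc_ch \<alpha> K) n" unfolding boundaries_def by (rule image_eqI)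
  qed
qed

lemma symbol_class_symbol: "x \<in> carrier (space (obj K n)) \<Longrightarrow> has_symbol \<alpha> K n x z \<Longrightarrow>
    symbol_class \<alpha> K n x = boundaries (underlying K) n +>\<^bsub>space (obj K n)\<^esub> z"
  using P.to_homology_symbol[of x n z] by (simp add: symbol_class_def has_symbol_def)

lemma has_symbol_exists: "x \<in> trunc_part \<alpha> K n \<Longrightarrow> \<exists>z. has_symbol \<alpha> K n x z"
  using P.symbol_exists[of x n] by (simp add: has_symbol_def trunc_part_def)

lemma has_symbol_cycle: "has_symbol \<alpha> K n x z \<Longrightarrow> z \<in> cycles (underlying K) n"
  by (simp add: has_symbol_def P.symbol_def)

lemma cycle_has_symbol: "x \<in> cycles (underlying K) n \<Longrightarrow> x \<in> trunc_part \<alpha> K n \<Longrightarrow> has_symbol \<alpha> K n x x"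
  unfolding has_symbol_def by (rule P.symbol_zero) (auto simp: trunc_part_def P.trunc_def)

lemma inclusion_chain_map: "chain_map (trunc_ch \<alpha> K) (underlying K) (\<lambda>n x. x)"
  using trunc_part_carrier by (auto simp: chain_map_def lin_def)

lemma inclusion_quasi_iso: "quasi_iso (trunc_ch \<alpha> K) (underlying K) (\<lambda>n x. x)"
proof (rule quasi_isoI[OF trunc_is_ch P.is_ch inclusion_chain_map])
  show "z \<in> cycles (trunc_ch \<alpha> K) n \<Longrightarrow> z \<in> boundaries (underlying K) n \<Longrightarrow> z \<in> boundaries (trunc_ch \<alpha> K) n" for n z
    by (simp add: trunc_cycles trunc_boundaries)
  show "\<exists>z\<in>cycles (trunc_ch \<alpha> K) n. w \<ominus>\<^bsub>obj (underlying K) n\<^esub> z \<in> boundaries (underlying K) n"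
    if w: "w \<in> cycles (underlying K) n" for n w
  proof -
    obtain u where u: "u \<in> cycles (underlying K) n" "u \<in> P.parts n (P.Eq n)"
      "w \<ominus>\<^bsub>obj (underlying K) n\<^esub> u \<in> boundaries (underlying K) n"
      using P.cycle_split[OF w] .
    have "u \<in> P.parts n (P.Le n)" using u(2) P.parts_mono[of "P.Eq n" "P.Le n" n] P.Le_union[of n] by auto
    then have "u \<in> trunc_part \<alpha> K n" using P.cycle_trunc u(1) by (simp add: trunc_part_def)
    then show ?thesis using u by (auto simp: trunc_cycles)
  qed
qed

lemma homology_is_ch: "is_ch (homology_ch (underlying K))"
  unfolding is_ch_def
proof (intro allI conjI ballI)
  fix n
  interpret H: vs "homology (underlying K) m" for m by (rule P.homology_simps(5))
  show "vspace (obj (homology_ch (underlying K)) n)" using H.vspace by simp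
  show "lin (obj (homology_ch (underlying K)) n) (obj (homology_ch (underlying K)) (n - 1))
      (dif (homology_ch (underlying K)) n)"
    by (auto simp: lin_def)
  show "dif (homology_ch (underlying K)) n \<in> extensional (carrier (obj (homology_ch (underlying K)) n))"
    by simp
  fix X assume "X \<in> carrier (obj (homology_ch (underlying K)) n)"
  then show "dif (homology_ch (underlying K)) (n - 1) (dif (homology_ch (underlying K)) n X) =
      \<zero>\<^bsub>obj (homology_ch (underlying K)) (n - 2)\<^esub>"
    by simp
qed

text \<open>
  In the truncation a boundary \<open>dif K n x\<close> has slopes at most \<open>n - 1\<close> and is its own symbol, so its class is zero,
  as the zero differential of homology demands.
\<close>

lemma symbol_class_chain_map: "chain_map (trunc_ch \<alpha> K) (homology_ch (underlying K)) (symbol_class \<alpha> K)"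
  unfolding chain_map_def
proof (intro allI conjI ballI)
  fix n
  have car: "symbol_class \<alpha> K n x \<in> carrier (homology (underlying K) n)" if x: "x \<in> trunc_part \<alpha> K n" for x n
  proof -
    obtain z where z: "has_symbol \<alpha> K n x z" using has_symbol_exists[OF x] by blast
    have "x \<in> carrier (space (obj K n))" using x trunc_part_carrier by blast
    then show ?thesis using symbol_class_symbol[OF _ z] has_symbol_cycle[OF z] P.homology_simps(1)[of n] by simp
  qed
  show "lin (obj (trunc_ch \<alpha> K) n) (obj (homology_ch (underlying K)) n) (symbol_class \<alpha> K n)"
    unfolding lin_def homology_ch_simps trunc_ch_simps
  proof (intro conjI ballI allI)
    fix x assume x: "x \<in> trunc_part \<alpha> K n"
    then have xc: "x \<in> carrier (space (obj K n))" using trunc_part_carrier by blast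
    obtain z where z: "has_symbol \<alpha> K n x z" using has_symbol_exists[OF x] by blast
    show "symbol_class \<alpha> K n x \<in> carrier (homology (underlying K) n)" by (rule car[OF x])
    show "symbol_class \<alpha> K n (q \<odot>\<^bsub>space (obj K n)\<^esub> x) = q \<odot>\<^bsub>homology (underlying K) n\<^esub> symbol_class \<alpha> K n x" for q
    proof -
      have "has_symbol \<alpha> K n (q \<odot>\<^bsub>space (obj K n)\<^esub> x) (q \<odot>\<^bsub>space (obj K n)\<^esub> z)"
        using P.symbol_smult[of n x z q] z xc by (simp add: has_symbol_def)
      then show ?thesis
        using symbol_class_symbol[OF xc z] symbol_class_symbol[of "q \<odot>\<^bsub>space (obj K n)\<^esub> x" n "q \<odot>\<^bsub>space (obj K n)\<^esub> z"]
          P.smult_closed[of x n q] xc P.homology_simps(4)[OF has_symbol_cycle[OF z]] by simp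
    qed
    fix y assume y: "y \<in> trunc_part \<alpha> K n"
    then have yc: "y \<in> carrier (space (obj K n))" using trunc_part_carrier by blast
    obtain w where w: "has_symbol \<alpha> K n y w" using has_symbol_exists[OF y] by blast
    have "has_symbol \<alpha> K n (x \<oplus>\<^bsub>space (obj K n)\<^esub> y) (z \<oplus>\<^bsub>space (obj K n)\<^esub> w)"
      using P.symbol_add[of n x z y w] z w xc yc by (simp add: has_symbol_def)
    then show "symbol_class \<alpha> K n (x \<oplus>\<^bsub>space (obj K n)\<^esub> y) = symbol_class \<alpha> K n x \<oplus>\<^bsub>homology (underlying K) n\<^esub> symbol_class \<alpha> K n y"
      using symbol_class_symbol[OF xc z] symbol_class_symbol[OF yc w]
        symbol_class_symbol[of "x \<oplus>\<^bsub>space (obj K n)\<^esub> y" n "z \<oplus>\<^bsub>space (obj K n)\<^esub> w"]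
        P.add.m_closed[of x n y] xc yc P.homology_simps(3)[OF has_symbol_cycle[OF z] has_symbol_cycle[OF w]] by simp
  qed
  fix x assume "x \<in> carrier (obj (trunc_ch \<alpha> K) n)"
  then have x: "x \<in> trunc_part \<alpha> K n" by simp
  then have xc: "x \<in> carrier (space (obj K n))" using trunc_part_carrier by blast
  have dx: "dif K n x \<in> boundaries (underlying K) (n - 1)"
    using xc by (auto simp: boundaries_def)
  then have dz: "dif K n x \<in> cycles (underlying K) (n - 1)" using P.boundaries_cycles by blast
  have "symbol_class \<alpha> K (n - 1) (dif K n x) = boundaries (underlying K) (n - 1) +>\<^bsub>space (obj K (n - 1))\<^esub> dif K n x"
    using dz P.cycles_carrier by (intro symbol_class_symbol cycle_has_symbol d_trunc_part x) auto
  also have "\<dots> = boundaries (underlying K) (n - 1)"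
    using P.rcos_eq_zero_iff[OF P.boundaries_sub, of "dif K n x" "n - 1"] dx dz P.cycles_carrier by auto
  finally show "dif (homology_ch (underlying K)) n (symbol_class \<alpha> K n x) = symbol_class \<alpha> K (n - 1) (dif (trunc_ch \<alpha> K) n x)"
    using x car[OF x] P.homology_simps(2)[of "n - 1"] by (simp add: homology_ch_def)
qed

lemma symbol_class_quasi_iso: "quasi_iso (trunc_ch \<alpha> K) (homology_ch (underlying K)) (symbol_class \<alpha> K)"
proof (rule quasi_isoI[OF trunc_is_ch homology_is_ch symbol_class_chain_map])
  let ?H = "homology_ch (underlying K)"
  have H: "obj ?H n = homology (underlying K) n" for n by (simp add: homology_ch_def)
  have vH: "vs (homology (underlying K) n)" for n by (rule P.homology_simps(5))
  have bH: "boundaries ?H n = {\<zero>\<^bsub>homology (underlying K) n\<^esub>}" for n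
  proof -
    have "\<zero>\<^bsub>homology (underlying K) (n + 1)\<^esub> \<in> carrier (homology (underlying K) (n + 1))"
      using vs.subspcD(2)[OF vH vs.subspc_carrier[OF vH]] .
    then show ?thesis by (auto simp: boundaries_def homology_ch_def)
  qed
  have cH: "cycles ?H n \<subseteq> carrier (homology (underlying K) n)" for n
    by (auto simp: cycles_def H)
  have cl: "symbol_class \<alpha> K n z = boundaries (underlying K) n +>\<^bsub>space (obj K n)\<^esub> z"
    if "z \<in> cycles (underlying K) n" "z \<in> trunc_part \<alpha> K n" for n z
    using that trunc_part_carrier by (intro symbol_class_symbol cycle_has_symbol) auto
  show "z \<in> boundaries (trunc_ch \<alpha> K) n"
    if z: "z \<in> cycles (trunc_ch \<alpha> K) n" and b: "symbol_class \<alpha> K n z \<in> boundaries ?H n" for n z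
  proof -
    have z': "z \<in> cycles (underlying K) n" "z \<in> trunc_part \<alpha> K n" using z by (auto simp: trunc_cycles)
    then have "boundaries (underlying K) n +>\<^bsub>space (obj K n)\<^esub> z = boundaries (underlying K) n"
      using b cl[OF z'] P.homology_simps(2)[of n] by (simp add: bH)
    moreover have "z \<in> carrier (space (obj K n))" using z'(2) trunc_part_carrier by blast
    ultimately have "z \<in> boundaries (underlying K) n"
      using P.rcos_eq_zero_iff[OF P.boundaries_sub[of n], of z] by simp
    then show ?thesis using z' by (simp add: trunc_boundaries)
  qed
  show "\<exists>z\<in>cycles (trunc_ch \<alpha> K) n. X \<ominus>\<^bsub>obj ?H n\<^esub> symbol_class \<alpha> K n z \<in> boundaries ?H n"
    if X: "X \<in> cycles ?H n" for n X
  proof -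
    have Xc: "X \<in> carrier (homology (underlying K) n)" using X cH by blast
    then obtain w where w: "w \<in> cycles (underlying K) n" "X = boundaries (underlying K) n +>\<^bsub>space (obj K n)\<^esub> w"
      using P.homology_simps(1)[of n] by auto
    obtain u where u: "u \<in> cycles (underlying K) n" "u \<in> P.parts n (P.Eq n)"
      "w \<ominus>\<^bsub>obj (underlying K) n\<^esub> u \<in> boundaries (underlying K) n"
      using P.cycle_split[OF w(1)] .
    have "u \<in> P.parts n (P.Le n)" using u(2) P.parts_mono[of "P.Eq n" "P.Le n" n] P.Le_union[of n] by auto
    then have uT: "u \<in> trunc_part \<alpha> K n" using P.cycle_trunc u(1) by (simp add: trunc_part_def)
    have "w \<in> carrier (space (obj K n))" "u \<in> carrier (space (obj K n))"
      using w(1) u(1) P.cycles_carrier[of n] by auto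
    then have "symbol_class \<alpha> K n u = X"
      using cl[OF u(1) uT] P.rcos_eq_iff[OF P.boundaries_sub[of n], of w u] u(3) w(2) by simp
    then have "X \<ominus>\<^bsub>obj ?H n\<^esub> symbol_class \<alpha> K n u = \<zero>\<^bsub>homology (underlying K) n\<^esub>"
      using vs.diff_eq_zero_iff[OF vH Xc Xc] by (simp add: H)
    then show ?thesis using u(1) uT by (auto simp: trunc_cycles bH)
  qed
qed

end

lemma inputs_iff:
  "length is = length Ks \<Longrightarrow> xs \<in> inputs Ks is \<longleftrightarrow>
    length xs = length Ks \<and> (\<forall>i<length Ks. xs ! i \<in> carrier (obj (Ks ! i) (is ! i)))"
  by (auto simp: inputs_def listset_iff)

lemma Le_sum:
  assumes "length ps = length ns" "\<And>i. i < length ns \<Longrightarrow> of_int (ps ! i) / \<alpha> \<le> (of_int (ns ! i) :: rat)"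
  shows "of_int (sum_list ps) / \<alpha> \<le> of_int (sum_list ns)"
    and "k < length ns \<Longrightarrow> of_int (ps ! k) / \<alpha> < of_int (ns ! k) \<Longrightarrow>
      of_int (sum_list ps) / \<alpha> < of_int (sum_list ns)"
proof -
  have s: "of_int (sum_list ps) / \<alpha> = (\<Sum>i<length ns. of_int (ps ! i) / \<alpha>)"
    "of_int (sum_list ns) = (\<Sum>i<length ns. of_int (ns ! i) :: rat)"
    using assms(1) by (simp_all add: sum_list_sum_nth atLeast0LessThan sum_divide_distrib)
  show "of_int (sum_list ps) / \<alpha> \<le> of_int (sum_list ns)"
    unfolding s using assms(2) by (intro sum_mono) auto
  show "k < length ns \<Longrightarrow> of_int (ps ! k) / \<alpha> < of_int (ns ! k) \<Longrightarrow>
      of_int (sum_list ps) / \<alpha> < of_int (sum_list ns)"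
    unfolding s using assms(2) by (intro sum_strict_mono_ex1) auto
qed

lemma sum_list_update_int:
  "k < length xs \<Longrightarrow> sum_list (xs[k := y]) = sum_list xs - xs ! k + (y :: int)"
  by (induction xs arbitrary: k) (auto split: nat.splits)

section \<open>Multimorphisms between pure complexes\<close>

locale pure_operation =
  fixes \<alpha> :: rat and Ks :: "'a mhs_complex list" and L :: "'a mhs_complex" and f :: "'a multimor"
  assumes alpha_nz: "\<alpha> \<noteq> 0"
    and sources: "\<And>i. i < length Ks \<Longrightarrow> pure_mhs_complex \<alpha> (Ks ! i)"
    and target: "pure_mhs_complex \<alpha> L"
    and op: "f \<in> ops Ch_MHS Ks L"
begin

sublocale L: pure_mhs_complex \<alpha> L by (rule target)

lemma ch_op: "f \<in> ch_ops (map underlying Ks) (underlying L)"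
  using op by (simp add: Ch_MHS_def)

lemma f_multilin: "length is = length Ks \<Longrightarrow>
    multilin (map space (map2 obj Ks is)) (space (obj L (sum_list is))) (f is)"
proof -
  assume len: "length is = length Ks"
  have "multilin (map2 obj (map underlying Ks) is) (obj (underlying L) (sum_list is)) (f is)"
    using ch_op len unfolding ch_ops_def by auto
  moreover have "map2 obj (map underlying Ks) is = map space (map2 obj Ks is)"
    using len by (auto intro!: nth_equalityI)
  ultimately show ?thesis by simp
qed

lemma f_compat: "length is = length Ks \<Longrightarrow> compat (map2 obj Ks is) (obj L (sum_list is)) (f is)"
proof -
  assume len: "length is = length Ks"
  have mm: "mhs_multi (map2 obj Ks is) (obj L (sum_list is)) (f is)"
    using op len by (simp add: Ch_MHS_def)
  have "is_mhs U" if "U \<in> set (map2 obj Ks is)" for U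
  proof -
    from that obtain i where i: "i < length Ks" "U = obj (Ks ! i) (is ! i)"
      using len by (auto simp: in_set_conv_nth)
    then show ?thesis
      using pure_mhs_complex.mhs_complex[OF sources[OF i(1)]] by (simp add: is_mhs_complex_def)
  qed
  moreover have "is_mhs (obj L n)" for n using L.mhs_complex by (simp add: is_mhs_complex_def)
  ultimately show ?thesis
    using mhs_compat_multi[OF _ _ f_multilin[OF len] mm] by (simp add: compat_def)
qed

lemma f_leibniz:
  assumes "length is = length Ks" "xs \<in> inputs (map underlying Ks) is"
  shows "dif L (sum_list is) (f is xs) =
      (\<Oplus>\<^bsub>space (obj L (sum_list is - 1))\<^esub>j\<in>{..<length Ks}.
         parity_sign (sum_list (take j is)) \<odot>\<^bsub>space (obj L (sum_list is - 1))\<^esub>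
           f (is[j := is ! j - 1]) (xs[j := dif (Ks ! j) (is ! j) (xs ! j)]))"
proof -
  have "leibniz (map underlying Ks) (underlying L) f" using ch_op by (simp add: ch_ops_def)
  then have "dif (underlying L) (sum_list is) (f is xs) =
      (\<Oplus>\<^bsub>obj (underlying L) (sum_list is - 1)\<^esub>j\<in>{..<length is}.
         parity_sign (sum_list (take j is)) \<odot>\<^bsub>obj (underlying L) (sum_list is - 1)\<^esub>
           f (is[j := is ! j - 1]) (xs[j := dif (map underlying Ks ! j) (is ! j) (xs ! j)]))"
    using assms unfolding leibniz_def by simp
  also have "\<dots> = (\<Oplus>\<^bsub>space (obj L (sum_list is - 1))\<^esub>j\<in>{..<length Ks}.
         parity_sign (sum_list (take j is)) \<odot>\<^bsub>space (obj L (sum_list is - 1))\<^esub>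
           f (is[j := is ! j - 1]) (xs[j := dif (Ks ! j) (is ! j) (xs ! j)]))"
  proof -
    have cong: "(\<Oplus>\<^bsub>G\<^esub>j\<in>A. g j) = (\<Oplus>\<^bsub>G\<^esub>j\<in>A. h j)"
      if "abelian_monoid G" "\<And>j. j \<in> A \<Longrightarrow> g j = h j" "\<And>j. j \<in> A \<Longrightarrow> h j \<in> carrier G"
      for A and g h :: "nat \<Rightarrow> 'a" and G :: "(rat, 'a) module"
      using that by (intro abelian_monoid.finsum_cong') auto
    have "dif (map underlying Ks ! j) (is ! j) (xs ! j) = dif (Ks ! j) (is ! j) (xs ! j)" if "j < length Ks" for j
      using that by simp
    moreover have "f (is[j := is ! j - 1]) (xs[j := dif (Ks ! j) (is ! j) (xs ! j)]) \<in>
        carrier (space (obj L (sum_list is - 1)))" if j: "j < length Ks" for j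
    proof -
      interpret Kj: pure_mhs_complex \<alpha> "Ks ! j" by (rule sources[OF j])
      let ?is = "is[j := is ! j - 1]"
      have len: "length ?is = length Ks" using assms(1) by simp
      have s: "sum_list ?is = sum_list is - 1" using j assms(1) by (simp add: sum_list_update_int)
      interpret C: compat "map2 obj Ks ?is" "obj L (sum_list ?is)" "f ?is" by (rule f_compat[OF len])
      have x: "length xs = length Ks" "\<And>i. i < length Ks \<Longrightarrow> xs ! i \<in> carrier (space (obj (Ks ! i) (is ! i)))"
        using assms by (auto simp: inputs_iff)
      have "C.M.ok (xs[j := dif (Ks ! j) (is ! j) (xs ! j)])"
        unfolding C.M.ok_def using x assms(1) j Kj.P.d.closed[of "xs ! j" "is ! j"]
        by (auto simp: nth_list_update)
      then show ?thesis using C.M.closed s by simp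
    qed
    moreover have "abelian_monoid (space (obj L (sum_list is - 1)))"
      and "\<And>q x. x \<in> carrier (space (obj L (sum_list is - 1))) \<Longrightarrow>
        q \<odot>\<^bsub>space (obj L (sum_list is - 1))\<^esub> x \<in> carrier (space (obj L (sum_list is - 1)))"
      using L.P.abelian_monoid_axioms[of "sum_list is - 1"] L.P.smult_closed[of _ "sum_list is - 1"] by auto
    ultimately show ?thesis
      unfolding assms(1) underlying_simps by (intro cong) auto
  qed
  finally show ?thesis by simp
qed

definition underlying_ok :: "int list \<Rightarrow> 'a list \<Rightarrow> bool"
  where "underlying_ok is xs \<longleftrightarrow> length is = length Ks \<and> length xs = length Ks \<and>
    (\<forall>i<length Ks. xs ! i \<in> carrier (space (obj (Ks ! i) (is ! i))))"

lemma underlying_ok_inputs: "underlying_ok is xs \<longleftrightarrow> length is = length Ks \<and> xs \<in> inputs (map underlying Ks) is"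
  by (auto simp: underlying_ok_def inputs_iff)

lemma compat_ok:
  "length is = length Ks \<Longrightarrow> multilin_map.ok (map space (map2 obj Ks is)) xs \<longleftrightarrow> underlying_ok is xs"
proof -
  assume len: "length is = length Ks"
  interpret C: compat "map2 obj Ks is" "obj L (sum_list is)" "f is" by (rule f_compat[OF len])
  show ?thesis unfolding C.M.ok_def underlying_ok_def using len by auto
qed

lemma f_closed: "underlying_ok is xs \<Longrightarrow> f is xs \<in> carrier (space (obj L (sum_list is)))"
proof -
  assume h: "underlying_ok is xs"
  then interpret C: compat "map2 obj Ks is" "obj L (sum_list is)" "f is"
    by (intro f_compat) (simp add: underlying_ok_def)
  show ?thesis using h compat_ok by (intro C.M.closed) (simp add: underlying_ok_def)
qed

lemma f_slot_lin: "underlying_ok is xs \<Longrightarrow> j < length Ks \<Longrightarrow>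
    lin (space (obj (Ks ! j) (is ! j))) (space (obj L (sum_list is))) (\<lambda>x. f is (xs[j := x]))"
proof -
  assume h: "underlying_ok is xs" and j: "j < length Ks"
  then interpret C: compat "map2 obj Ks is" "obj L (sum_list is)" "f is"
    by (intro f_compat) (simp add: underlying_ok_def)
  have "C.M.ok xs" using h compat_ok by (simp add: underlying_ok_def)
  from C.M.slot_lin[OF this, of j] show ?thesis using h j by (simp add: underlying_ok_def)
qed

lemma f_parts:
  assumes ok: "length is = length Ks" "length xs = length Ks"
    and xs: "\<And>i. i < length Ks \<Longrightarrow> xs ! i \<in> mhs_parts (obj (Ks ! i) (is ! i)) (L.P.Le (is ! i))"
  shows "f is xs \<in> mhs_parts (obj L (sum_list is)) (L.P.Le (sum_list is))"
    and "k < length Ks \<Longrightarrow> xs ! k \<in> mhs_parts (obj (Ks ! k) (is ! k)) (L.P.Lt (is ! k)) \<Longrightarrow>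
      f is xs \<in> mhs_parts (obj L (sum_list is)) (L.P.Lt (sum_list is))"
proof -
  interpret C: compat "map2 obj Ks is" "obj L (sum_list is)" "f is" by (rule f_compat[OF ok(1)])
  show "f is xs \<in> mhs_parts (obj L (sum_list is)) (L.P.Le (sum_list is))"
    by (rule C.parts_product[where S = "\<lambda>i. L.P.Le (is ! i)"])
      (use ok xs Le_sum(1) in \<open>auto simp: L.P.Le_def\<close>)
  assume k: "k < length Ks" "xs ! k \<in> mhs_parts (obj (Ks ! k) (is ! k)) (L.P.Lt (is ! k))"
  show "f is xs \<in> mhs_parts (obj L (sum_list is)) (L.P.Lt (sum_list is))"
  proof (rule C.parts_product[where S = "\<lambda>i. if i = k then L.P.Lt (is ! i) else L.P.Le (is ! i)"])
    show "length xs = length (map2 obj Ks is)" using ok by simp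
    show "xs ! i \<in> mhs_parts (map2 obj Ks is ! i) (if i = k then L.P.Lt (is ! i) else L.P.Le (is ! i))"
      if "i < length (map2 obj Ks is)" for i using that ok xs k by auto
    fix ps assume ps: "length ps = length (map2 obj Ks is)"
      "\<And>i. i < length (map2 obj Ks is) \<Longrightarrow> ps ! i \<in> (if i = k then L.P.Lt (is ! i) else L.P.Le (is ! i))"
    have "of_int (ps ! i) / \<alpha> \<le> of_int (is ! i)" if "i < length is" for i
      using ps(2)[of i] that ok by (auto simp: L.P.Le_def L.P.Lt_def split: if_splits)
    moreover have "of_int (ps ! k) / \<alpha> < of_int (is ! k)" using ps(2)[of k] k ok by (simp add: L.P.Lt_def)
    ultimately show "sum_list ps \<in> L.P.Lt (sum_list is)"
      using Le_sum(2)[of ps "is" \<alpha> k] ps(1) ok k by (simp add: L.P.Lt_def)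
  qed
qed

lemma trunc_part_iff: "i < length Ks \<Longrightarrow> x \<in> trunc_part \<alpha> (Ks ! i) n \<longleftrightarrow>
    x \<in> mhs_parts (obj (Ks ! i) n) (L.P.Le n) \<and> dif (Ks ! i) n x \<in> mhs_parts (obj (Ks ! i) (n - 1)) (L.P.Le (n - 1))"
proof -
  assume "i < length Ks"
  then interpret Ki: pure_mhs_complex \<alpha> "Ks ! i" by (rule sources)
  show ?thesis by (simp add: trunc_part_def Ki.P.trunc_def Ki.P.Le_def L.P.Le_def)
qed

lemma trunc_part_L_iff: "x \<in> trunc_part \<alpha> L n \<longleftrightarrow>
    x \<in> mhs_parts (obj L n) (L.P.Le n) \<and> dif L n x \<in> mhs_parts (obj L (n - 1)) (L.P.Le (n - 1))"
  by (simp add: trunc_part_def L.P.trunc_def)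

lemma trunc_part_underlying_ok:
  assumes "length is = length Ks" "length xs = length Ks" "\<And>i. i < length Ks \<Longrightarrow> xs ! i \<in> trunc_part \<alpha> (Ks ! i) (is ! i)"
  shows "underlying_ok is xs"
  using assms pure_mhs_complex.trunc_part_carrier[OF sources] by (auto simp: underlying_ok_def subset_iff)

lemma parts_sub_L: "subspc (space (obj L n)) (mhs_parts (obj L n) S)"
  using L.P.parts_sub[of n S] by simp

text \<open>
  Slopes add up, and by the Leibniz rule every summand of the differential of a product contains exactly
  one differential, which lowers the bound on its slope by one.
\<close>

lemma f_trunc_part:
  assumes len: "length is = length Ks" "length xs = length Ks"
    and xs: "\<And>i. i < length Ks \<Longrightarrow> xs ! i \<in> trunc_part \<alpha> (Ks ! i) (is ! i)"
  shows "f is xs \<in> trunc_part \<alpha> L (sum_list is)"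
proof -
  have ok: "underlying_ok is xs" by (rule trunc_part_underlying_ok[OF assms])
  have p: "xs ! i \<in> mhs_parts (obj (Ks ! i) (is ! i)) (L.P.Le (is ! i))" if "i < length Ks" for i
    using xs[OF that] trunc_part_iff[OF that] by blast
  have "f is xs \<in> mhs_parts (obj L (sum_list is)) (L.P.Le (sum_list is))" by (rule f_parts(1)[OF len p])
  moreover have "dif L (sum_list is) (f is xs) \<in> mhs_parts (obj L (sum_list is - 1)) (L.P.Le (sum_list is - 1))"
    unfolding f_leibniz[OF ok[unfolded underlying_ok_inputs, THEN conjunct1] ok[unfolded underlying_ok_inputs, THEN conjunct2]]
  proof (rule vs.finsum_in_subspc)
    show "vs (space (obj L (sum_list is - 1)))" using L.P.vs_axioms[of "sum_list is - 1"] by simp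
    show "subspc (space (obj L (sum_list is - 1))) (mhs_parts (obj L (sum_list is - 1)) (L.P.Le (sum_list is - 1)))"
      by (rule parts_sub_L)
    fix j assume "j \<in> {..<length Ks}"
    then have j: "j < length Ks" by simp
    let ?is = "is[j := is ! j - 1]" and ?xs = "xs[j := dif (Ks ! j) (is ! j) (xs ! j)]"
    have s: "sum_list ?is = sum_list is - 1" using j len by (simp add: sum_list_update_int)
    have "f ?is ?xs \<in> mhs_parts (obj L (sum_list ?is)) (L.P.Le (sum_list ?is))"
    proof (rule f_parts(1))
      fix i assume i: "i < length Ks"
      show "?xs ! i \<in> mhs_parts (obj (Ks ! i) (?is ! i)) (L.P.Le (?is ! i))"
        using p[OF i] xs[OF j] trunc_part_iff[OF j] i j len by (cases "i = j") auto
    qed (use len in auto)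
    then show "parity_sign (sum_list (take j is)) \<odot>\<^bsub>space (obj L (sum_list is - 1))\<^esub> f ?is ?xs
        \<in> mhs_parts (obj L (sum_list is - 1)) (L.P.Le (sum_list is - 1))"
      using L.P.subspcD(4)[OF L.P.parts_sub] unfolding s by simp
  qed simp
  ultimately show ?thesis by (simp add: trunc_part_L_iff)
qed

lemma f_cycles:
  assumes len: "length is = length Ks" "length xs = length Ks"
    and xs: "\<And>i. i < length Ks \<Longrightarrow> xs ! i \<in> cycles (underlying (Ks ! i)) (is ! i)"
  shows "f is xs \<in> cycles (underlying L) (sum_list is)"
proof -
  have ok: "underlying_ok is xs" using xs len by (auto simp: underlying_ok_def cycles_def)
  have "dif L (sum_list is) (f is xs) \<in> {\<zero>\<^bsub>space (obj L (sum_list is - 1))\<^esub>}"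
    unfolding f_leibniz[OF ok[unfolded underlying_ok_inputs, THEN conjunct1] ok[unfolded underlying_ok_inputs, THEN conjunct2]]
  proof (rule vs.finsum_in_subspc)
    show v: "vs (space (obj L (sum_list is - 1)))" using L.P.vs_axioms[of "sum_list is - 1"] by simp
    show "subspc (space (obj L (sum_list is - 1))) {\<zero>\<^bsub>space (obj L (sum_list is - 1))\<^esub>}"
      by (rule vs.subspc_zero[OF v])
    fix j assume "j \<in> {..<length Ks}"
    then have j: "j < length Ks" by simp
    interpret Kj: pure_mhs_complex \<alpha> "Ks ! j" by (rule sources[OF j])
    let ?is = "is[j := is ! j - 1]" and ?z = "\<zero>\<^bsub>space (obj (Ks ! j) (is ! j - 1))\<^esub>"
    have s: "sum_list ?is = sum_list is - 1" using j len by (simp add: sum_list_update_int)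
    have z: "dif (Ks ! j) (is ! j) (xs ! j) = ?z" using xs[OF j] by (simp add: cycles_def)
    have "underlying_ok ?is (xs[j := ?z])"
      using ok j Kj.P.zero_closed[of "is ! j - 1"] by (auto simp: underlying_ok_def nth_list_update)
    from f_slot_lin[OF this j] have "lin (space (obj (Ks ! j) (is ! j - 1))) (space (obj L (sum_list is - 1))) (\<lambda>x. f ?is (xs[j := x]))"
      using j len s by simp
    then interpret l: lin_map "space (obj (Ks ! j) (is ! j - 1))" "space (obj L (sum_list is - 1))" "\<lambda>x. f ?is (xs[j := x])"
      using v Kj.P.vs_axioms[of "is ! j - 1"] by (intro lin_mapI) auto
    show "parity_sign (sum_list (take j is)) \<odot>\<^bsub>space (obj L (sum_list is - 1))\<^esub>
        f ?is (xs[j := dif (Ks ! j) (is ! j) (xs ! j)]) \<in> {\<zero>\<^bsub>space (obj L (sum_list is - 1))\<^esub>}"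
      unfolding z using l.zero l.V'.smult_zero_right by simp
  qed simp
  then show ?thesis using f_closed[OF ok] by (simp add: cycles_def)
qed

text \<open>
  Raise the degree of input \<open>k\<close> by inserting a preimage \<open>y\<close> of \<open>b\<close>.  As the other inputs are cycles, the
  Leibniz rule leaves only the term with the differential of \<open>y\<close>, up to sign.
\<close>

lemma f_boundary:
  assumes len: "length is = length Ks" "length xs = length Ks"
    and xs: "\<And>i. i < length Ks \<Longrightarrow> xs ! i \<in> cycles (underlying (Ks ! i)) (is ! i)"
    and k: "k < length Ks" and b: "b \<in> boundaries (underlying (Ks ! k)) (is ! k)"
  shows "f is (xs[k := b]) \<in> boundaries (underlying L) (sum_list is)"
proof -
  interpret Kk: pure_mhs_complex \<alpha> "Ks ! k" by (rule sources[OF k])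
  obtain y where y: "y \<in> carrier (space (obj (Ks ! k) (is ! k + 1)))" "b = dif (Ks ! k) (is ! k + 1) y"
    using b by (auto simp: boundaries_def)
  (* The inputs whose product has a differential equal to the given product up to sign. *)
  let ?is = "is[k := is ! k + 1]" and ?xs = "xs[k := y]"
  have xc: "xs ! i \<in> carrier (space (obj (Ks ! i) (is ! i)))" if "i < length Ks" for i
    using xs[OF that] by (auto simp: cycles_def)
  have ok: "underlying_ok ?is ?xs"
    using len xc k y(1) by (auto simp: underlying_ok_def nth_list_update)
  have s: "sum_list ?is = sum_list is + 1" using k len by (simp add: sum_list_update_int)
  let ?S = "space (obj L (sum_list is))"
  interpret S: vs ?S using L.P.vs_axioms[of "sum_list is"] by simp
  define e where "e = parity_sign (sum_list (take k ?is))"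
  have bc: "b \<in> carrier (space (obj (Ks ! k) (is ! k)))"
    using Kk.P.d.closed[of y "is ! k + 1"] y by simp
  have okb: "underlying_ok is (xs[k := b])" using len xc k bc by (auto simp: underlying_ok_def nth_list_update)
  have "dif L (sum_list ?is) (f ?is ?xs) = (\<Oplus>\<^bsub>?S\<^esub>j\<in>{..<length Ks}.
         parity_sign (sum_list (take j ?is)) \<odot>\<^bsub>?S\<^esub>
           f (?is[j := ?is ! j - 1]) (?xs[j := dif (Ks ! j) (?is ! j) (?xs ! j)]))"
    using f_leibniz[OF ok[unfolded underlying_ok_inputs, THEN conjunct1] ok[unfolded underlying_ok_inputs, THEN conjunct2]]
    by (simp add: s)
  also have "\<dots> = (\<Oplus>\<^bsub>?S\<^esub>j\<in>{..<length Ks}. if k = j then e \<odot>\<^bsub>?S\<^esub> f is (xs[k := b]) else \<zero>\<^bsub>?S\<^esub>)"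
  proof (rule S.finsum_cong')
    show "(\<lambda>j. if k = j then e \<odot>\<^bsub>?S\<^esub> f is (xs[k := b]) else \<zero>\<^bsub>?S\<^esub>) \<in> {..<length Ks} \<rightarrow> carrier ?S"
      using f_closed[OF okb] by auto
    fix j assume "j \<in> {..<length Ks}"
    then have j: "j < length Ks" by simp
    show "parity_sign (sum_list (take j ?is)) \<odot>\<^bsub>?S\<^esub>
        f (?is[j := ?is ! j - 1]) (?xs[j := dif (Ks ! j) (?is ! j) (?xs ! j)]) =
      (if k = j then e \<odot>\<^bsub>?S\<^esub> f is (xs[k := b]) else \<zero>\<^bsub>?S\<^esub>)"
    proof (cases "k = j")
      case True
      then show ?thesis using j len y(2) by (simp add: e_def)
    next
      case False
      interpret Kj: pure_mhs_complex \<alpha> "Ks ! j" by (rule sources[OF j])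
      let ?is' = "?is[j := is ! j - 1]" and ?z = "\<zero>\<^bsub>space (obj (Ks ! j) (is ! j - 1))\<^esub>"
      have s': "sum_list ?is' = sum_list is" using j k len False by (simp add: sum_list_update_int s)
      have z: "dif (Ks ! j) (?is ! j) (?xs ! j) = ?z" using xs[OF j] False by (simp add: cycles_def)
      have "underlying_ok ?is' (?xs[j := ?z])"
        using ok j Kj.P.zero_closed[of "is ! j - 1"] by (auto simp: underlying_ok_def nth_list_update)
      from f_slot_lin[OF this j] have "lin (space (obj (Ks ! j) (is ! j - 1))) ?S (\<lambda>x. f ?is' (?xs[j := x]))"
        using j len s' by simp
      then interpret l: lin_map "space (obj (Ks ! j) (is ! j - 1))" ?S "\<lambda>x. f ?is' (?xs[j := x])"
        using S.vs_axioms Kj.P.vs_axioms[of "is ! j - 1"] by (intro lin_mapI) auto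
      have "f ?is' (?xs[j := ?z]) = \<zero>\<^bsub>?S\<^esub>" by (rule l.zero)
      then show ?thesis unfolding z using False by simp
    qed
  qed simp
  also have "\<dots> = e \<odot>\<^bsub>?S\<^esub> f is (xs[k := b])"
    using S.finsum_singleton[of k "{..<length Ks}" "\<lambda>_. e \<odot>\<^bsub>?S\<^esub> f is (xs[k := b])"] k f_closed[OF okb] by auto
  finally have "e \<odot>\<^bsub>?S\<^esub> f is (xs[k := b]) = dif L (sum_list is + 1) (f ?is ?xs)" by (simp add: s)
  then have eb: "e \<odot>\<^bsub>?S\<^esub> f is (xs[k := b]) \<in> boundaries (underlying L) (sum_list is)"
    using f_closed[OF ok] unfolding s by (auto simp: boundaries_def)
  have "e \<odot>\<^bsub>?S\<^esub> (e \<odot>\<^bsub>?S\<^esub> f is (xs[k := b])) \<in> boundaries (underlying L) (sum_list is)"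
    using L.P.subspcD(4)[OF L.P.boundaries_sub eb, of e] by simp
  moreover have "e * e = 1" by (simp add: e_def parity_sign_def)
  ultimately show ?thesis using f_closed[OF okb] by (simp flip: S.smult_assoc)
qed

lemma f_homologous:
  assumes len: "length is = length Ks" "length xs = length Ks" "length zs = length Ks"
    and xs: "\<And>i. i < length Ks \<Longrightarrow> xs ! i \<in> cycles (underlying (Ks ! i)) (is ! i)"
    and zs: "\<And>i. i < length Ks \<Longrightarrow> zs ! i \<in> cycles (underlying (Ks ! i)) (is ! i)"
    and xz: "\<And>i. i < length Ks \<Longrightarrow> xs ! i \<ominus>\<^bsub>space (obj (Ks ! i) (is ! i))\<^esub> zs ! i \<in> boundaries (underlying (Ks ! i)) (is ! i)"
  shows "f is xs \<ominus>\<^bsub>space (obj L (sum_list is))\<^esub> f is zs \<in> boundaries (underlying L) (sum_list is)"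
proof -
  interpret C: compat "map2 obj Ks is" "obj L (sum_list is)" "f is" by (rule f_compat[OF len(1)])
  have okx: "C.M.ok xs" and okz: "C.M.ok zs"
    unfolding compat_ok[OF len(1)] using len xs zs by (auto simp: underlying_ok_def cycles_def)
  show ?thesis
  proof (rule C.M.ok_diff_telescope[OF okx okz])
    show "subspc (space (obj L (sum_list is))) (boundaries (underlying L) (sum_list is))"
      using L.P.boundaries_sub[of "sum_list is"] by simp
    fix k ws assume k: "k < length (map space (map2 obj Ks is))" and ws: "C.M.ok ws"
      "\<And>i. i < length (map space (map2 obj Ks is)) \<Longrightarrow> ws ! i = xs ! i \<or> ws ! i = zs ! i"
    have k': "k < length Ks" using k len by simp
    have "ws ! i \<in> cycles (underlying (Ks ! i)) (is ! i)" if "i < length Ks" for i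
      using ws(2)[of i] xs[OF that] zs[OF that] that len by auto
    moreover have "length ws = length Ks" using ws(1) unfolding compat_ok[OF len(1)] underlying_ok_def by simp
    ultimately have "f is (ws[k := xs ! k \<ominus>\<^bsub>space (obj (Ks ! k) (is ! k))\<^esub> zs ! k]) \<in> boundaries (underlying L) (sum_list is)"
      using f_boundary[OF len(1) _ _ k' xz[OF k']] by blast
    then show "f is (ws[k := xs ! k \<ominus>\<^bsub>map space (map2 obj Ks is) ! k\<^esub> zs ! k]) \<in> boundaries (underlying L) (sum_list is)"
      using k' len by simp
  qed
qed

text \<open>
  Multiplicativity of symbols: replacing one input by its symbol changes the product by an element
  of smaller slope than its degree.
\<close>

lemma f_has_symbol:
  assumes len: "length is = length Ks" "length xs = length Ks" "length zs = length Ks"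
    and xs: "\<And>i. i < length Ks \<Longrightarrow> xs ! i \<in> trunc_part \<alpha> (Ks ! i) (is ! i)"
    and sy: "\<And>i. i < length Ks \<Longrightarrow> has_symbol \<alpha> (Ks ! i) (is ! i) (xs ! i) (zs ! i)"
  shows "has_symbol \<alpha> L (sum_list is) (f is xs) (f is zs)"
proof -
  interpret C: compat "map2 obj Ks is" "obj L (sum_list is)" "f is" by (rule f_compat[OF len(1)])
  have sym: "zs ! i \<in> cycles (underlying (Ks ! i)) (is ! i)"
    "zs ! i \<in> mhs_parts (obj (Ks ! i) (is ! i)) (L.P.Le (is ! i))"
    "xs ! i \<ominus>\<^bsub>space (obj (Ks ! i) (is ! i))\<^esub> zs ! i \<in> mhs_parts (obj (Ks ! i) (is ! i)) (L.P.Lt (is ! i))"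
    if i: "i < length Ks" for i
  proof -
    interpret Ki: pure_mhs_complex \<alpha> "Ks ! i" by (rule sources[OF i])
    show "zs ! i \<in> cycles (underlying (Ks ! i)) (is ! i)"
      "zs ! i \<in> mhs_parts (obj (Ks ! i) (is ! i)) (L.P.Le (is ! i))"
      "xs ! i \<ominus>\<^bsub>space (obj (Ks ! i) (is ! i))\<^esub> zs ! i \<in> mhs_parts (obj (Ks ! i) (is ! i)) (L.P.Lt (is ! i))"
      using sy[OF i] by (auto simp: has_symbol_def Ki.P.symbol_def Ki.P.Le_def L.P.Le_def Ki.P.Lt_def L.P.Lt_def)
  qed
  have px: "xs ! i \<in> mhs_parts (obj (Ks ! i) (is ! i)) (L.P.Le (is ! i))" if "i < length Ks" for i
    using xs[OF that] trunc_part_iff[OF that] by blast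
  have okx: "C.M.ok xs" and okz: "C.M.ok zs"
    unfolding compat_ok[OF len(1)] using len sym(1) trunc_part_underlying_ok[OF len(1,2) xs]
    by (auto simp: cycles_def underlying_ok_def)
  have "f is xs \<ominus>\<^bsub>space (obj L (sum_list is))\<^esub> f is zs \<in> mhs_parts (obj L (sum_list is)) (L.P.Lt (sum_list is))"
  proof (rule C.M.ok_diff_telescope[OF okx okz parts_sub_L])
    fix k ws assume k: "k < length (map space (map2 obj Ks is))" and ws: "C.M.ok ws"
      "\<And>i. i < length (map space (map2 obj Ks is)) \<Longrightarrow> ws ! i = xs ! i \<or> ws ! i = zs ! i"
    have k': "k < length Ks" using k len by simp
    have wl: "length ws = length Ks" using ws(1) unfolding compat_ok[OF len(1)] underlying_ok_def by simp
    have pw: "ws ! i \<in> mhs_parts (obj (Ks ! i) (is ! i)) (L.P.Le (is ! i))" if "i < length Ks" for i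
      using ws(2)[of i] px[OF that] sym(2)[OF that] that len by auto
    interpret Kk: pure_mhs_complex \<alpha> "Ks ! k" by (rule sources[OF k'])
    let ?d = "xs ! k \<ominus>\<^bsub>space (obj (Ks ! k) (is ! k))\<^esub> zs ! k"
    have dle: "?d \<in> mhs_parts (obj (Ks ! k) (is ! k)) (L.P.Le (is ! k))"
      using sym(3)[OF k'] Kk.P.parts_mono[OF L.P.Lt_Le, of "is ! k" "is ! k"] by auto
    have "f is (ws[k := ?d]) \<in> mhs_parts (obj L (sum_list is)) (L.P.Lt (sum_list is))"
    proof (rule f_parts(2)[OF len(1) _ _ k'])
      show "(ws[k := ?d]) ! i \<in> mhs_parts (obj (Ks ! i) (is ! i)) (L.P.Le (is ! i))" if "i < length Ks" for i
        using pw[OF that] dle wl that by (cases "i = k") auto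
      show "(ws[k := ?d]) ! k \<in> mhs_parts (obj (Ks ! k) (is ! k)) (L.P.Lt (is ! k))"
        using sym(3)[OF k'] k' wl by simp
    qed (use wl in simp)
    then show "f is (ws[k := xs ! k \<ominus>\<^bsub>map space (map2 obj Ks is) ! k\<^esub> zs ! k]) \<in> mhs_parts (obj L (sum_list is)) (L.P.Lt (sum_list is))"
      using k' len by simp
  qed
  then show ?thesis
    using f_cycles[OF len(1,3) sym(1)] f_parts(1)[OF len(1,3) sym(2)] by (simp add: has_symbol_def L.P.symbol_def)
qed

end

lemma restr_apply: "length is = length Ks \<Longrightarrow> xs \<in> inputs Ks is \<Longrightarrow> restr Ks f is xs = f is xs"
  by (simp add: restr_def)

lemma restr_cong:
  "(\<And>is xs. length is = length Ks \<Longrightarrow> xs \<in> inputs Ks is \<Longrightarrow> f is xs = g is xs) \<Longrightarrow> restr Ks f = restr Ks g"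
  by (auto simp: restr_def fun_eq_iff)

lemma restr_restr:
  assumes "length Ks' = length Ks"
    "\<And>is xs. length is = length Ks \<Longrightarrow> xs \<in> inputs Ks is \<Longrightarrow> xs \<in> inputs Ks' is"
  shows "restr Ks (restr Ks' f) = restr Ks f"
  using assms by (intro restr_cong) (simp add: restr_apply)

abbreviation pure_operad :: "rat \<Rightarrow> ('a mhs_complex, 'a multimor) operad"
  where "pure_operad \<alpha> \<equiv> full_suboperad Ch_MHS (alpha_pure \<alpha>)"

lemma pure_operad_simps [simp]:
  "colors (pure_operad \<alpha>) = {K. is_mhs_complex K \<and> alpha_pure \<alpha> K}"
  "ops (pure_operad \<alpha>) = ops Ch_MHS"
  "ident (pure_operad \<alpha>) = (\<lambda>K. ch_ident (underlying K))"
  "pcomp (pure_operad \<alpha>) = (\<lambda>Ls Ks Ls'. ch_pcomp (map underlying Ls) (map underlying Ks) (map underlying Ls'))"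
  "act (pure_operad \<alpha>) = (\<lambda>Ks L. ch_act (map underlying Ks) (underlying L))"
  by (auto simp: full_suboperad_def Ch_MHS_def)

lemma Ch_Q_simps [simp]:
  "colors Ch_Q = {K. is_ch K}" "ops Ch_Q = ch_ops" "ident Ch_Q = ch_ident" "pcomp Ch_Q = ch_pcomp" "act Ch_Q = ch_act"
  by (simp_all add: Ch_Q_def)

lemma trunc_inputs_iff:
  "length is = length Ks \<Longrightarrow> xs \<in> inputs (map (trunc_ch \<alpha>) Ks) is \<longleftrightarrow>
    length xs = length Ks \<and> (\<forall>i<length Ks. xs ! i \<in> trunc_part \<alpha> (Ks ! i) (is ! i))"
  by (auto simp: inputs_iff)

lemma trunc_inputs_sub:
  assumes "\<And>i. i < length Ks \<Longrightarrow> pure_mhs_complex \<alpha> (Ks ! i)" "length is = length Ks"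
    "xs \<in> inputs (map (trunc_ch \<alpha>) Ks) is"
  shows "xs \<in> inputs (map underlying Ks) is"
  using assms pure_mhs_complex.trunc_part_carrier[OF assms(1)] by (auto simp: inputs_iff trunc_inputs_iff subset_iff)

lemma pure_operationI:
  assumes "\<alpha> \<noteq> 0" "Ks \<in> lists (colors (pure_operad \<alpha>))" "L \<in> colors (pure_operad \<alpha>)" "f \<in> ops (pure_operad \<alpha>) Ks L"
  shows "pure_operation \<alpha> Ks L f"
  using assms by unfold_locales (auto simp: in_lists_conv_set)

lemma Ch_MHS_op: "f \<in> ops Ch_MHS Ks L \<Longrightarrow> f \<in> ch_ops (map underlying Ks) (underlying L)"
  by (simp add: Ch_MHS_def)

lemma Pi_Q_operad_map: "is_operad_map (pure_operad \<alpha>) Ch_Q Pi_Q"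
  by (auto simp: is_operad_map_def Pi_Q_def is_mhs_complex_def dest: Ch_MHS_op)

context pure_operation
begin

definition trunc_op :: "'a multimor"
  where "trunc_op = restr (map (trunc_ch \<alpha>) Ks) f"

lemma trunc_op_apply: "length is = length Ks \<Longrightarrow> length xs = length Ks \<Longrightarrow>
    (\<And>i. i < length Ks \<Longrightarrow> xs ! i \<in> trunc_part \<alpha> (Ks ! i) (is ! i)) \<Longrightarrow> trunc_op is xs = f is xs"
  by (simp add: trunc_op_def restr_apply trunc_inputs_iff)

lemma trunc_op_multilin:
  assumes len: "length is = length Ks"
  shows "multilin (map2 obj (map (trunc_ch \<alpha>) Ks) is) (obj (trunc_ch \<alpha> L) (sum_list is)) (trunc_op is)"
  unfolding multilin_def
proof (intro conjI ballI allI impI)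
  let ?Ts = "map2 obj (map (trunc_ch \<alpha>) Ks) is"
  have mem: "xs \<in> listset (map carrier ?Ts) \<longleftrightarrow>
      length xs = length Ks \<and> (\<forall>i<length Ks. xs ! i \<in> trunc_part \<alpha> (Ks ! i) (is ! i))" for xs
    using len by (auto simp: listset_iff)
  fix xs assume xs: "xs \<in> listset (map carrier ?Ts)"
  then have x: "length xs = length Ks" "\<And>i. i < length Ks \<Longrightarrow> xs ! i \<in> trunc_part \<alpha> (Ks ! i) (is ! i)"
    using mem by auto
  show "trunc_op is xs \<in> carrier (obj (trunc_ch \<alpha> L) (sum_list is))"
    using trunc_op_apply[OF len x] f_trunc_part[OF len x] by simp
  fix j assume "j < length ?Ts"
  then have j: "j < length Ks" using len by simp
  interpret Kj: pure_mhs_complex \<alpha> "Ks ! j" by (rule sources[OF j])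
  have up: "trunc_op is (xs[j := x]) = f is (xs[j := x])" "f is (xs[j := x]) \<in> trunc_part \<alpha> L (sum_list is)"
    if "x \<in> trunc_part \<alpha> (Ks ! j) (is ! j)" for x
    using that x j len by (intro trunc_op_apply f_trunc_part; auto simp: nth_list_update)+
  have lin: "lin (space (obj (Ks ! j) (is ! j))) (space (obj L (sum_list is))) (\<lambda>x. f is (xs[j := x]))"
    by (rule f_slot_lin[OF trunc_part_underlying_ok[OF len x] j])
  have T: "trunc_part \<alpha> (Ks ! j) (is ! j) \<subseteq> carrier (space (obj (Ks ! j) (is ! j)))" by (rule Kj.trunc_part_carrier)
  have cl: "x \<oplus>\<^bsub>space (obj (Ks ! j) (is ! j))\<^esub> y \<in> trunc_part \<alpha> (Ks ! j) (is ! j)"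
    "q \<odot>\<^bsub>space (obj (Ks ! j) (is ! j))\<^esub> x \<in> trunc_part \<alpha> (Ks ! j) (is ! j)"
    if "x \<in> trunc_part \<alpha> (Ks ! j) (is ! j)" "y \<in> trunc_part \<alpha> (Ks ! j) (is ! j)" for x y q
    using Kj.P.subspcD(3,4)[of "is ! j" "trunc_part \<alpha> (Ks ! j) (is ! j)"] Kj.trunc_part_sub that by auto
  have nth: "?Ts ! j = obj (trunc_ch \<alpha> (Ks ! j)) (is ! j)" using j len by simp
  show "lin (?Ts ! j) (obj (trunc_ch \<alpha> L) (sum_list is)) (\<lambda>x. trunc_op is (xs[j := x]))"
    unfolding nth lin_def trunc_ch_simps
    using up cl lin T unfolding lin_def by (auto simp: subset_iff)
qed

lemma trunc_op_leibniz: "leibniz (map (trunc_ch \<alpha>) Ks) (trunc_ch \<alpha> L) trunc_op"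
  unfolding leibniz_def
proof (intro allI ballI impI)
  fix "is" xs assume xs: "xs \<in> inputs (map (trunc_ch \<alpha>) Ks) is" and "length is = length (map (trunc_ch \<alpha>) Ks)"
  then have len: "length is = length Ks" by simp
  then have x: "length xs = length Ks" "\<And>i. i < length Ks \<Longrightarrow> xs ! i \<in> trunc_part \<alpha> (Ks ! i) (is ! i)"
    using xs by (auto simp: trunc_inputs_iff)
  let ?n = "sum_list is - 1"
  interpret S: vs "space (obj L ?n)" using L.P.vs_axioms[of ?n] by simp
  interpret T: vs "(space (obj L ?n))\<lparr>carrier := trunc_part \<alpha> L ?n\<rparr>" by (rule S.restrict_carrier[OF L.trunc_part_sub])
  let ?t = "\<lambda>j. parity_sign (sum_list (take j is)) \<odot>\<^bsub>space (obj L ?n)\<^esub>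
           f (is[j := is ! j - 1]) (xs[j := dif (Ks ! j) (is ! j) (xs ! j)])"
  have tm: "trunc_op (is[j := is ! j - 1]) (xs[j := dif (map (trunc_ch \<alpha>) Ks ! j) (is ! j) (xs ! j)]) =
        f (is[j := is ! j - 1]) (xs[j := dif (Ks ! j) (is ! j) (xs ! j)])"
    and memf: "?t j \<in> trunc_part \<alpha> L ?n" if j: "j < length Ks" for j
  proof -
    have h: "(xs[j := dif (Ks ! j) (is ! j) (xs ! j)]) ! i \<in> trunc_part \<alpha> (Ks ! i) (is[j := is ! j - 1] ! i)" if "i < length Ks" for i
      using x(2)[OF that] pure_mhs_complex.d_trunc_part[OF sources[OF j] x(2)[OF j]] that j len x(1)
      by (cases "i = j") auto
    have s: "sum_list (is[j := is ! j - 1]) = ?n" using j len by (simp add: sum_list_update_int)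
    have "f (is[j := is ! j - 1]) (xs[j := dif (Ks ! j) (is ! j) (xs ! j)]) \<in> trunc_part \<alpha> L ?n"
      using f_trunc_part[OF _ _ h] len x(1) s by simp
    then show "?t j \<in> trunc_part \<alpha> L ?n" by (rule S.subspcD(4)[OF L.trunc_part_sub])
    have "dif (map (trunc_ch \<alpha>) Ks ! j) (is ! j) (xs ! j) = dif (Ks ! j) (is ! j) (xs ! j)"
      using j x(2)[OF j] by simp
    then show "trunc_op (is[j := is ! j - 1]) (xs[j := dif (map (trunc_ch \<alpha>) Ks ! j) (is ! j) (xs ! j)]) =
        f (is[j := is ! j - 1]) (xs[j := dif (Ks ! j) (is ! j) (xs ! j)])"
      using trunc_op_apply[OF _ _ h] len x(1) by simp
  qed
  have "dif (trunc_ch \<alpha> L) (sum_list is) (trunc_op is xs) = dif L (sum_list is) (f is xs)"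
    using trunc_op_apply[OF len x] f_trunc_part[OF len x] by simp
  also have "\<dots> = (\<Oplus>\<^bsub>space (obj L ?n)\<^esub>j\<in>{..<length Ks}. ?t j)"
    using trunc_part_underlying_ok[OF len x] by (intro f_leibniz) (auto simp: underlying_ok_inputs)
  also have "\<dots> = (\<Oplus>\<^bsub>(space (obj L ?n))\<lparr>carrier := trunc_part \<alpha> L ?n\<rparr>\<^esub>j\<in>{..<length Ks}. ?t j)"
    using memf by (intro finsum_restrict_carrier[symmetric] S.vs_axioms L.trunc_part_sub) auto
  also have "\<dots> = (\<Oplus>\<^bsub>(space (obj L ?n))\<lparr>carrier := trunc_part \<alpha> L ?n\<rparr>\<^esub>j\<in>{..<length Ks}.
      parity_sign (sum_list (take j is)) \<odot>\<^bsub>obj (trunc_ch \<alpha> L) ?n\<^esub>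
        trunc_op (is[j := is ! j - 1]) (xs[j := dif (map (trunc_ch \<alpha>) Ks ! j) (is ! j) (xs ! j)]))"
    using memf tm by (intro T.finsum_cong') auto
  finally show "dif (trunc_ch \<alpha> L) (sum_list is) (trunc_op is xs) =
      (\<Oplus>\<^bsub>obj (trunc_ch \<alpha> L) ?n\<^esub>j\<in>{..<length is}.
         parity_sign (sum_list (take j is)) \<odot>\<^bsub>obj (trunc_ch \<alpha> L) ?n\<^esub>
           trunc_op (is[j := is ! j - 1]) (xs[j := dif (map (trunc_ch \<alpha>) Ks ! j) (is ! j) (xs ! j)]))"
    unfolding len by (simp only: trunc_ch_def complexes.simps)
qed

lemma trunc_op_op: "trunc_op \<in> ch_ops (map (trunc_ch \<alpha>) Ks) (trunc_ch \<alpha> L)"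
  unfolding ch_ops_def using trunc_op_multilin trunc_op_leibniz restr_restr[of "map (trunc_ch \<alpha>) Ks" "map (trunc_ch \<alpha>) Ks" f]
  by (simp add: trunc_op_def)

lemma trunc_op_act:
  assumes \<sigma>: "\<sigma> permutes {..<length Ks}"
  shows "restr (map (trunc_ch \<alpha>) (permute_list \<sigma> Ks)) (ch_act (map underlying Ks) (underlying L) \<sigma> f) =
    ch_act (map (trunc_ch \<alpha>) Ks) (trunc_ch \<alpha> L) \<sigma> trunc_op"
proof -
  let ?Ks = "permute_list \<sigma> Ks"
  have len: "length ?Ks = length Ks" by simp
  have p: "permute_list \<sigma> (map g Ks) = map g ?Ks" for g :: "'a mhs_complex \<Rightarrow> 'a ch"
    using \<sigma> by (rule permute_list_map)
  have src: "pure_mhs_complex \<alpha> (?Ks ! i)" if "i < length ?Ks" for i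
    using that permute_list_nth[OF \<sigma>, of i] sources permutes_in_image[OF \<sigma>, of i] by auto
  have inv: "inv_into UNIV \<sigma> permutes {..<length Ks}" using \<sigma> by (rule permutes_inv)
  let ?g = "\<lambda>h is xs. koszul_sign \<sigma> is \<odot>\<^bsub>space (obj L (sum_list is))\<^esub>
      h (permute_list (inv_into UNIV \<sigma>) is) (permute_list (inv_into UNIV \<sigma>) xs)"
  have "restr (map (trunc_ch \<alpha>) ?Ks) (ch_act (map underlying Ks) (underlying L) \<sigma> f) =
      restr (map (trunc_ch \<alpha>) ?Ks) (?g f)"
    unfolding ch_act_def p underlying_simps
    by (rule restr_restr) (use trunc_inputs_sub[OF src] in auto)
  also have "\<dots> = restr (map (trunc_ch \<alpha>) ?Ks) (?g trunc_op)"
  proof (rule restr_cong)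
    fix "is" xs assume il: "length is = length (map (trunc_ch \<alpha>) ?Ks)" and xs: "xs \<in> inputs (map (trunc_ch \<alpha>) ?Ks) is"
    then have x: "length is = length Ks" "length xs = length Ks"
      "\<And>i. i < length Ks \<Longrightarrow> xs ! i \<in> trunc_part \<alpha> (?Ks ! i) (is ! i)" by (auto simp: trunc_inputs_iff)
    have "permute_list (inv_into UNIV \<sigma>) xs ! i \<in> trunc_part \<alpha> (Ks ! i) (permute_list (inv_into UNIV \<sigma>) is ! i)" if i: "i < length Ks" for i
    proof -
      have j: "inv_into UNIV \<sigma> i < length Ks" using permutes_in_image[OF inv, of i] i by simp
      have "\<sigma> (inv_into UNIV \<sigma> i) = i" by (rule permutes_inverses(1)[OF \<sigma>])
      then have "?Ks ! inv_into UNIV \<sigma> i = Ks ! i" using permute_list_nth[OF \<sigma> j] by simp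
      then show ?thesis
        using x(3)[OF j] permute_list_nth[of "inv_into UNIV \<sigma>" xs i] permute_list_nth[of "inv_into UNIV \<sigma>" "is" i] inv x(1,2) i by simp
    qed
    then have "trunc_op (permute_list (inv_into UNIV \<sigma>) is) (permute_list (inv_into UNIV \<sigma>) xs) = f (permute_list (inv_into UNIV \<sigma>) is) (permute_list (inv_into UNIV \<sigma>) xs)"
      using x by (intro trunc_op_apply) auto
    then show "?g f is xs = ?g trunc_op is xs" by simp
  qed
  also have "\<dots> = ch_act (map (trunc_ch \<alpha>) Ks) (trunc_ch \<alpha> L) \<sigma> trunc_op"
    unfolding ch_act_def p trunc_ch_simps ..
  finally show ?thesis .
qed

end

lemma trunc_op_pcomp:
  assumes g: "pure_operation \<alpha> (Ls @ [M] @ Ls') N g" and f: "pure_operation \<alpha> Ks M f"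
  shows "restr (map (trunc_ch \<alpha>) (Ls @ Ks @ Ls')) (ch_pcomp (map underlying Ls) (map underlying Ks) (map underlying Ls') g f) =
    ch_pcomp (map (trunc_ch \<alpha>) Ls) (map (trunc_ch \<alpha>) Ks) (map (trunc_ch \<alpha>) Ls')
      (restr (map (trunc_ch \<alpha>) (Ls @ [M] @ Ls')) g) (restr (map (trunc_ch \<alpha>) Ks) f)"
proof -
  interpret g: pure_operation \<alpha> "Ls @ [M] @ Ls'" N g by (rule g)
  interpret f: pure_operation \<alpha> Ks M f by (rule f)
  let ?a = "length Ls" and ?b = "length Ks"
  let ?h = "\<lambda>g f is xs.
    g (take ?a is @ [sum_list (take ?b (drop ?a is))] @ drop (?a + ?b) is)
      (take ?a xs @ [f (take ?b (drop ?a is)) (take ?b (drop ?a xs))] @ drop (?a + ?b) xs)"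
  have src: "pure_mhs_complex \<alpha> ((Ls @ Ks @ Ls') ! i)" if "i < length (Ls @ Ks @ Ls')" for i
  proof -
    consider "i < ?a" | "?a \<le> i" "i < ?a + ?b" | "?a + ?b \<le> i" by linarith
    then show ?thesis
    proof cases
      case 1 then show ?thesis using g.sources[of i] by (simp add: nth_append)
    next
      case 2
      then have "i - ?a < ?b" by linarith
      then show ?thesis using f.sources[of "i - ?a"] 2(1) by (simp add: nth_append)
    next
      case 3
      then obtain c where "i = ?a + ?b + c" using le_Suc_ex by blast
      then show ?thesis using g.sources[of "Suc (?a + c)"] that by (simp add: nth_append)
    qed
  qed
  have "restr (map (trunc_ch \<alpha>) (Ls @ Ks @ Ls')) (ch_pcomp (map underlying Ls) (map underlying Ks) (map underlying Ls') g f) =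
      restr (map (trunc_ch \<alpha>) (Ls @ Ks @ Ls')) (?h g f)"
    unfolding ch_pcomp_def length_map map_append[symmetric] Let_def
    by (rule restr_restr) (use trunc_inputs_sub[OF src] in auto)
  also have "\<dots> = restr (map (trunc_ch \<alpha>) (Ls @ Ks @ Ls')) (?h g.trunc_op f.trunc_op)"
  proof (rule restr_cong)
    fix "is" xs assume il: "length is = length (map (trunc_ch \<alpha>) (Ls @ Ks @ Ls'))"
      and xs: "xs \<in> inputs (map (trunc_ch \<alpha>) (Ls @ Ks @ Ls')) is"
    let ?n = "?a + ?b + length Ls'"
    have len: "length is = ?n" "length xs = ?n"
      and x: "\<And>i. i < ?n \<Longrightarrow> xs ! i \<in> trunc_part \<alpha> ((Ls @ Ks @ Ls') ! i) (is ! i)"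
      using il trunc_inputs_iff[of "is" "Ls @ Ks @ Ls'" xs \<alpha>] xs by (simp_all add: add.assoc)
    let ?js = "take ?b (drop ?a is)" and ?ys = "take ?b (drop ?a xs)"
    have y: "?ys ! i \<in> trunc_part \<alpha> (Ks ! i) (?js ! i)" if "i < ?b" for i
      using x[of "?a + i"] that len by (simp add: nth_append)
    have fy: "f.trunc_op ?js ?ys = f ?js ?ys" using len y by (intro f.trunc_op_apply) auto
    have fT: "f ?js ?ys \<in> trunc_part \<alpha> M (sum_list ?js)" using len y by (intro f.f_trunc_part) auto
    have "g.trunc_op (take ?a is @ [sum_list ?js] @ drop (?a + ?b) is) (take ?a xs @ [f ?js ?ys] @ drop (?a + ?b) xs) =
        g (take ?a is @ [sum_list ?js] @ drop (?a + ?b) is) (take ?a xs @ [f ?js ?ys] @ drop (?a + ?b) xs)"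
    proof (rule g.trunc_op_apply)
      fix i assume i: "i < length (Ls @ [M] @ Ls')"
      consider "i < ?a" | "i = ?a" | c where "i = Suc (?a + c)" "c < length Ls'"
        using i by (metis add_Suc_right length_Cons length_append less_imp_Suc_add linorder_neqE_nat
            append_Cons append_Nil nat_add_left_cancel_less not_less_eq)
      then show "(take ?a xs @ [f ?js ?ys] @ drop (?a + ?b) xs) ! i \<in>
          trunc_part \<alpha> ((Ls @ [M] @ Ls') ! i) ((take ?a is @ [sum_list ?js] @ drop (?a + ?b) is) ! i)"
      proof cases
        case 1 then show ?thesis using x[of i] len by (simp add: nth_append)
      next
        case 2 then show ?thesis using fT len by (simp add: nth_append)
      next
        case 3
        then show ?thesis using x[of "?a + ?b + c"] len by (simp add: nth_append)
      qed
    qed (use len in auto)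
    then show "?h g f is xs = ?h g.trunc_op f.trunc_op is xs" by (simp only: fy)
  qed
  also have "\<dots> = ch_pcomp (map (trunc_ch \<alpha>) Ls) (map (trunc_ch \<alpha>) Ks) (map (trunc_ch \<alpha>) Ls') g.trunc_op f.trunc_op"
    unfolding ch_pcomp_def length_map map_append Let_def ..
  finally show ?thesis unfolding g.trunc_op_def f.trunc_op_def .
qed

text \<open>
  Restriction of operations to the truncation is compatible with the structure of the operads because the
  restricted inputs are again mapped into the truncation.
\<close>

lemma trunc_functor_operad_map:
  assumes \<alpha>: "\<alpha> \<noteq> 0"
  shows "is_operad_map (pure_operad \<alpha>) Ch_Q (trunc_functor \<alpha>)"
  unfolding is_operad_map_def
proof (intro conjI ballI allI impI)
  fix K assume "K \<in> colors (pure_operad \<alpha>)"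
  then interpret K: pure_mhs_complex \<alpha> K using \<alpha> by unfold_locales auto
  show "on_col (trunc_functor \<alpha>) K \<in> colors Ch_Q" using K.trunc_is_ch by (simp add: trunc_functor_def)
  have "restr [trunc_ch \<alpha> K] (restr [underlying K] (\<lambda>is xs. hd xs)) = restr [trunc_ch \<alpha> K] (\<lambda>is xs. hd xs)"
    by (rule restr_restr) (use trunc_inputs_sub[of "[K]" \<alpha>] K.pure_mhs_complex_axioms in auto)
  then show "on_op (trunc_functor \<alpha>) [K] K (ident (pure_operad \<alpha>) K) = ident Ch_Q (on_col (trunc_functor \<alpha>) K)"
    by (simp add: trunc_functor_def ch_ident_def)
next
  fix Ks L f assume "Ks \<in> lists (colors (pure_operad \<alpha>))" "L \<in> colors (pure_operad \<alpha>)" "f \<in> ops (pure_operad \<alpha>) Ks L"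
  then interpret pure_operation \<alpha> Ks L f by (rule pure_operationI[OF \<alpha>])
  show "on_op (trunc_functor \<alpha>) Ks L f \<in> ops Ch_Q (map (on_col (trunc_functor \<alpha>)) Ks) (on_col (trunc_functor \<alpha>) L)"
    using trunc_op_op by (simp add: trunc_functor_def trunc_op_def)
  fix \<sigma> assume "\<sigma> permutes {..<length Ks}"
  from trunc_op_act[OF this] show "on_op (trunc_functor \<alpha>) (permute_list \<sigma> Ks) L (act (pure_operad \<alpha>) Ks L \<sigma> f) =
      act Ch_Q (map (on_col (trunc_functor \<alpha>)) Ks) (on_col (trunc_functor \<alpha>) L) \<sigma> (on_op (trunc_functor \<alpha>) Ks L f)"
    by (simp add: trunc_functor_def trunc_op_def)
next
  fix Ls Ks Ls' M N g f
  assume h: "Ls \<in> lists (colors (pure_operad \<alpha>))" "Ks \<in> lists (colors (pure_operad \<alpha>))" "Ls' \<in> lists (colors (pure_operad \<alpha>))"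
    "M \<in> colors (pure_operad \<alpha>)" "N \<in> colors (pure_operad \<alpha>)"
    "g \<in> ops (pure_operad \<alpha>) (Ls @ [M] @ Ls') N" "f \<in> ops (pure_operad \<alpha>) Ks M"
  have "pure_operation \<alpha> (Ls @ [M] @ Ls') N g" using h by (intro pure_operationI[OF \<alpha>]) auto
  moreover have "pure_operation \<alpha> Ks M f" using h by (intro pure_operationI[OF \<alpha>]) auto
  ultimately show "on_op (trunc_functor \<alpha>) (Ls @ Ks @ Ls') N (pcomp (pure_operad \<alpha>) Ls Ks Ls' g f) =
      pcomp Ch_Q (map (on_col (trunc_functor \<alpha>)) Ls) (map (on_col (trunc_functor \<alpha>)) Ks) (map (on_col (trunc_functor \<alpha>)) Ls')
        (on_op (trunc_functor \<alpha>) (Ls @ [M] @ Ls') N g) (on_op (trunc_functor \<alpha>) Ks M f)"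
    using trunc_op_pcomp[of \<alpha> Ls M Ls' N g Ks f] by (simp add: trunc_functor_def)
qed

section \<open>Formality\<close>

lemma inclusion_arrow:
  assumes \<alpha>: "\<alpha> \<noteq> 0"
  shows "quasi_iso_arrow (pure_operad \<alpha>) (trunc_functor \<alpha>)
    (Pi_Q :: ('a mhs_complex, 'a multimor, 'a) ch_functor)"
  unfolding quasi_iso_arrow_def
proof (intro exI[of _ "\<lambda>K n x. x"] conjI ballI)
  have qi: "quasi_iso (on_col (trunc_functor \<alpha>) K) (on_col Pi_Q K) (\<lambda>n x. x)"
    if "K \<in> colors (pure_operad \<alpha>)" for K :: "'a mhs_complex"
    using that pure_mhs_complex.inclusion_quasi_iso[of \<alpha> K] \<alpha>
    by (simp add: trunc_functor_def Pi_Q_def pure_mhs_complex_def)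
  show "quasi_iso (on_col (trunc_functor \<alpha>) K) (on_col Pi_Q K) (\<lambda>n x. x)"
    if "K \<in> colors (pure_operad \<alpha>)" for K :: "'a mhs_complex"
    using qi[OF that] .
  have cm: "chain_map (on_col (trunc_functor \<alpha>) K) (on_col Pi_Q K) (\<lambda>n x. x)"
    if "K \<in> colors (pure_operad \<alpha>)" for K :: "'a mhs_complex"
    using qi[OF that] unfolding quasi_iso_def by blast
  show "monoidal_transformation (pure_operad \<alpha>) (trunc_functor \<alpha>)
      (Pi_Q :: ('a mhs_complex, 'a multimor, 'a) ch_functor) (\<lambda>K n x. x)"
    unfolding monoidal_transformation_def
  proof (intro conjI ballI allI impI cm)
    fix Ks :: "'a mhs_complex list" and L f "is" xs
    assume "length is = length Ks" "xs \<in> inputs (map (on_col (trunc_functor \<alpha>)) Ks) is"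
    then have "length is = length Ks" "xs \<in> inputs (map (trunc_ch \<alpha>) Ks) is" "length xs = length Ks"
      by (auto simp: trunc_functor_def inputs_iff)
    moreover have "map (\<lambda>j. xs ! j) [0..<length Ks] = xs" using \<open>length xs = length Ks\<close> by (metis map_nth)
    ultimately show "on_op (trunc_functor \<alpha>) Ks L f is xs = on_op Pi_Q Ks L f is (map (\<lambda>j. xs ! j) [0..<length Ks])"
      by (simp add: trunc_functor_def Pi_Q_def restr_apply)
  qed
qed

text \<open>
  On homology a multimorphism is computed with arbitrary representing cycles, in particular with the
  symbols of the inputs, whose product is a symbol of the product.
\<close>

lemma homology_arrow:
  fixes \<alpha> :: rat
  assumes \<alpha>: "\<alpha> \<noteq> 0"
  shows "quasi_iso_arrow (pure_operad \<alpha>) (trunc_functor \<alpha>)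
    (operad_map_comp homology_functor (Pi_Q :: ('a mhs_complex, 'a multimor, 'a) ch_functor))"
  unfolding quasi_iso_arrow_def
proof (intro exI[of _ "symbol_class \<alpha>"] conjI ballI)
  let ?H = "operad_map_comp homology_functor (Pi_Q :: ('a mhs_complex, 'a multimor, 'a) ch_functor)"
  have on_col: "on_col ?H K = homology_ch (underlying K)" for K
    by (simp add: operad_map_comp_def homology_functor_def Pi_Q_def)
  have on_op: "on_op ?H Ks L f = restr (map homology_ch (map underlying Ks)) (\<lambda>is Xs.
       \<Union>xs\<in>listset Xs. boundaries (underlying L) (sum_list is) +>\<^bsub>obj (underlying L) (sum_list is)\<^esub> f is xs)"
    for Ks :: "'a mhs_complex list" and L f
    by (simp add: operad_map_comp_def homology_functor_def Pi_Q_def)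
  have qi: "quasi_iso (on_col (trunc_functor \<alpha>) K) (on_col ?H K) (symbol_class \<alpha> K)"
    if "K \<in> colors (pure_operad \<alpha>)" for K :: "'a mhs_complex"
    using that pure_mhs_complex.symbol_class_quasi_iso[of \<alpha> K] \<alpha>
    unfolding on_col by (simp add: trunc_functor_def pure_mhs_complex_def)
  show "quasi_iso (on_col (trunc_functor \<alpha>) K) (on_col ?H K) (symbol_class \<alpha> K)"
    if "K \<in> colors (pure_operad \<alpha>)" for K :: "'a mhs_complex"
    using qi[OF that] .
  have cm: "chain_map (on_col (trunc_functor \<alpha>) K) (on_col ?H K) (symbol_class \<alpha> K)"
    if "K \<in> colors (pure_operad \<alpha>)" for K :: "'a mhs_complex"
    using qi[OF that] unfolding quasi_iso_def by blast
  show "monoidal_transformation (pure_operad \<alpha>) (trunc_functor \<alpha>) ?H (symbol_class \<alpha>)"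
    unfolding monoidal_transformation_def
  proof (intro conjI ballI allI impI cm)
    fix Ks :: "'a mhs_complex list" and L f "is" xs
    assume h: "Ks \<in> lists (colors (pure_operad \<alpha>))" "L \<in> colors (pure_operad \<alpha>)" "f \<in> ops (pure_operad \<alpha>) Ks L"
      and len: "length is = length Ks" and xs: "xs \<in> inputs (map (on_col (trunc_functor \<alpha>)) Ks) is"
    interpret pure_operation \<alpha> Ks L f by (rule pure_operationI[OF \<alpha> h])
    have x: "length xs = length Ks" "\<And>i. i < length Ks \<Longrightarrow> xs ! i \<in> trunc_part \<alpha> (Ks ! i) (is ! i)"
      using xs len by (auto simp: trunc_functor_def trunc_inputs_iff)
    have "\<exists>z. i < length Ks \<longrightarrow> has_symbol \<alpha> (Ks ! i) (is ! i) (xs ! i) z" for i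
      using pure_mhs_complex.has_symbol_exists[OF sources x(2)] by blast
    then obtain z where z: "\<And>i. i < length Ks \<Longrightarrow> has_symbol \<alpha> (Ks ! i) (is ! i) (xs ! i) (z i)" by metis
    define zs where "zs = map z [0..<length Ks]"
    have zs: "length zs = length Ks" "\<And>i. i < length Ks \<Longrightarrow> has_symbol \<alpha> (Ks ! i) (is ! i) (xs ! i) (zs ! i)"
      using z by (auto simp: zs_def)
    have zc: "zs ! i \<in> cycles (underlying (Ks ! i)) (is ! i)" if "i < length Ks" for i
      using pure_mhs_complex.has_symbol_cycle[OF sources[OF that] zs(2)[OF that]] .
    have xc: "xs ! i \<in> carrier (space (obj (Ks ! i) (is ! i)))" if "i < length Ks" for i
      using pure_mhs_complex.trunc_part_carrier[OF sources[OF that]] x(2)[OF that] by blast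
    (* The inputs of the operation on homology are the classes of the symbols zs. *)
    define Xs where "Xs = map (\<lambda>j. symbol_class \<alpha> (Ks ! j) (is ! j) (xs ! j)) [0..<length Ks]"
    have Xi: "Xs ! i = boundaries (underlying (Ks ! i)) (is ! i) +>\<^bsub>space (obj (Ks ! i) (is ! i))\<^esub> zs ! i" if "i < length Ks" for i
      using pure_mhs_complex.symbol_class_symbol[OF sources[OF that] xc[OF that] zs(2)[OF that]] that by (simp add: Xs_def)
    let ?S = "space (obj L (sum_list is))" and ?B = "boundaries (underlying L) (sum_list is)"
    have Bs: "subspc ?S ?B" using L.P.boundaries_sub[of "sum_list is"] by simp
    interpret S: vs ?S using L.P.vs_axioms[of "sum_list is"] by simp
    have fc: "f is ws \<in> carrier ?S" if "length ws = length Ks" "\<And>i. i < length Ks \<Longrightarrow> ws ! i \<in> cycles (underlying (Ks ! i)) (is ! i)" for ws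
      using f_cycles[OF len that] L.P.cycles_carrier[of "sum_list is"] by auto
    have "symbol_class \<alpha> L (sum_list is) (on_op (trunc_functor \<alpha>) Ks L f is xs) = symbol_class \<alpha> L (sum_list is) (f is xs)"
      using len x by (simp add: trunc_functor_def restr_apply trunc_inputs_iff)
    also have "\<dots> = ?B +>\<^bsub>?S\<^esub> f is zs"
      using L.symbol_class_symbol[OF _ f_has_symbol[OF len x(1) zs(1) x(2) zs(2)]] f_trunc_part[OF len x] L.trunc_part_carrier by blast
    also have "\<dots> = (\<Union>ws\<in>listset Xs. ?B +>\<^bsub>?S\<^esub> f is ws)"
    proof -
      have eq: "?B +>\<^bsub>?S\<^esub> f is ws = ?B +>\<^bsub>?S\<^esub> f is zs" if ws: "ws \<in> listset Xs" for ws
      proof -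
        have wl: "length ws = length Ks" using ws by (simp add: listset_iff Xs_def)
        have w: "ws ! i \<ominus>\<^bsub>space (obj (Ks ! i) (is ! i))\<^esub> zs ! i \<in> boundaries (underlying (Ks ! i)) (is ! i) \<and>
            ws ! i \<in> cycles (underlying (Ks ! i)) (is ! i)" if i: "i < length Ks" for i
        proof -
          interpret Ki: pure_mhs_complex \<alpha> "Ks ! i" by (rule sources[OF i])
          have zci: "zs ! i \<in> carrier (obj (underlying (Ks ! i)) (is ! i))" using zc[OF i] Ki.P.cycles_carrier by blast
          have "ws ! i \<in> Xs ! i" using ws i by (auto simp: listset_iff Xs_def)
          then have a: "ws ! i \<in> carrier (space (obj (Ks ! i) (is ! i)))"
            "ws ! i \<ominus>\<^bsub>space (obj (Ks ! i) (is ! i))\<^esub> zs ! i \<in> boundaries (underlying (Ks ! i)) (is ! i)"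
            using Ki.P.rcos_mem_iff[OF Ki.P.boundaries_sub zci] unfolding Xi[OF i] by auto
          have "(ws ! i \<ominus>\<^bsub>space (obj (Ks ! i) (is ! i))\<^esub> zs ! i) \<oplus>\<^bsub>space (obj (Ks ! i) (is ! i))\<^esub> zs ! i
              \<in> cycles (underlying (Ks ! i)) (is ! i)"
            using Ki.P.subspcD(3)[OF Ki.P.cycles_sub[of "is ! i"] subsetD[OF Ki.P.boundaries_cycles a(2)] zc[OF i]] by simp
          moreover have "(ws ! i \<ominus>\<^bsub>space (obj (Ks ! i) (is ! i))\<^esub> zs ! i) \<oplus>\<^bsub>space (obj (Ks ! i) (is ! i))\<^esub> zs ! i = ws ! i"
            using Ki.P.a_assoc[of "ws ! i" "is ! i"] Ki.P.l_neg[of "zs ! i" "is ! i"] Ki.P.a_inv_closed[of "zs ! i" "is ! i"] Ki.P.r_zero[of "ws ! i" "is ! i"] a(1) zci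
            by (simp add: a_minus_def)
          ultimately show ?thesis using a by simp
        qed
        have "f is ws \<ominus>\<^bsub>?S\<^esub> f is zs \<in> ?B" using w zc by (intro f_homologous len wl zs(1)) auto
        then show ?thesis using S.rcos_eq_iff[OF Bs fc[OF wl] fc[OF zs(1) zc]] w by blast
      qed
      have "zs \<in> listset Xs"
        unfolding listset_iff
      proof (intro conjI allI impI)
        show "length zs = length Xs" using zs by (simp add: Xs_def)
        fix i assume "i < length Xs"
        then have i: "i < length Ks" by (simp add: Xs_def)
        interpret Ki: pure_mhs_complex \<alpha> "Ks ! i" by (rule sources[OF i])
        have "zs ! i \<in> carrier (obj (underlying (Ks ! i)) (is ! i))" using zc[OF i] Ki.P.cycles_carrier by blast
        from Ki.P.rcos_self[OF Ki.P.boundaries_sub this] show "zs ! i \<in> Xs ! i" by (simp add: Xi[OF i])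
      qed
      then show ?thesis using eq by blast
    qed
    also have "\<dots> = on_op ?H Ks L f is Xs"
    proof -
      have "Xs \<in> inputs (map homology_ch (map underlying Ks)) is"
      proof -
        have "Xs ! i \<in> carrier (homology (underlying (Ks ! i)) (is ! i))" if i: "i < length Ks" for i
        proof -
          interpret Ki: pure_mhs_complex \<alpha> "Ks ! i" by (rule sources[OF i])
          show ?thesis using Ki.P.homology_simps(1)[of "is ! i"] zc[OF i] by (simp add: Xi[OF i])
        qed
        then show ?thesis using len by (simp add: inputs_iff Xs_def)
      qed
      then show ?thesis unfolding on_op using len by (simp add: restr_apply)
    qed
    finally show "symbol_class \<alpha> L (sum_list is) (on_op (trunc_functor \<alpha>) Ks L f is xs) =
        on_op ?H Ks L f is (map (\<lambda>j. symbol_class \<alpha> (Ks ! j) (is ! j) (xs ! j)) [0..<length Ks])"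
      by (simp only: Xs_def)
  qed
qed

theorem corollary4p6:
  fixes \<alpha> :: rat
  assumes "\<alpha> \<noteq> 0"
  shows "formal (full_suboperad Ch_MHS (alpha_pure \<alpha>))
    (Pi_Q :: ('a mhs_complex, 'a multimor, 'a) ch_functor)"
  unfolding formal_def
  using Pi_Q_operad_map trunc_functor_operad_map[OF assms] inclusion_arrow[OF assms] homology_arrow[OF assms]
  by (intro conjI exI[of _ "[trunc_functor \<alpha>]"]) auto

end
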